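(* Let $X$ be a Gorenstein toric Fano variety (not necessarily smooth) over $\mathbb{C}$. If $(X,-K_X)$ is asymptotically Chow semistable with respect to toric test configurations, then $(X,-K_X)$ is Ding polystable with respect to toric test configurations.
   Context: A complex normal projective variety $X$ is Fano if $-K_X$ is ample, and Gorenstein if $-K_X$ is Cartier. Let $M\cong\mathbb{Z}^n$ be a lattice, $M_{\mathbb{R}}=M\otimes\mathbb{R}\cong\mathbb{R}^n$, with dual lattice $N$. An $n$-dimensional lattice polytope $\Delta\subset M_{\mathbb{R}}$ is reflexive if $\mathbf{0}\in\mathrm{Int}(\Delta)$ and $\Delta=\{y\in M_{\mathbb{R}} : \langle x,y\rangle\ge -1 \text{ for all } x\in P\}$ for some lattice polytope $P\subset N_{\mathbb{R}}$ with $\mathbf{0}\in \mathrm{Int}(P)$ whose vertices are primitive. Isomorphism classes of $n$-dimensional Gorenstein toric Fano varieties correspond bijectively to isomorphism classes of $n$-dimensional reflexive polytopes; $X$ corresponds to the polytope $\Delta$ of the anticanonical divisor $-K_X=\sum_\rho D_\rho$ (sum over the rays of the fan of $X$, with $D_\rho$ the torus-invariant prime divisors), so that $H^0(X,-iK_X)$ has a basis of characters indexed by $\Delta\cap(\mathbb{Z}/i)^n$. Chow stability. Let $X\subset\mathbb{CP}^{N}$ be an irreducible $n$-dimensional projective variety of degree $d\ge 2$. The set $Z_X=\{L\in\mathbb{G}(N-n-1,\mathbb{CP}^N) : L\cap X\ne\emptyset\}$ is an irreducible divisor of degree $d$ in the Grassmannian of $(N-n-1)$-dimensional projective linear subspaces,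 so $Z_X=\{R_X=0\}$ for some $R_X\in H^0(\mathbb{G}(N-n-1,\mathbb{CP}^N),\mathcal{O}(d))$, unique up to scale, called the $X$-resultant. $X$ is Chow semistable if the closure of the $\mathrm{SL}(N+1,\mathbb{C})$-orbit of $R_X$ does not contain the origin. For a toric variety embedded by the complete linear system $|-iK_X|$, using the basis of characters as homogeneous coordinates, it is Chow semistable with respect to toric test configurations if the closure of the orbit of $R_X$ under the maximal torus of diagonal matrices of $\mathrm{SL}(N+1,\mathbb{C})$ does not contain the origin. $(X,-K_X)$ is asymptotically Chow semistable with respect to toric test configurations if there is $i_0$ such that for every $i\ge i_0$ the image of the Kodaira embedding $X\to\mathbb{P}(H^0(X,-iK_X)^* )$ is Chow semistable in this sense. Ding stability. A toric test configuration of $(X,-K_X)$ is given by a (rational) piecewise linear convex function $u$ on $\Delta$, i.e. a maximum of finitely many affine functions, and its Ding invariant is $$\mathcal{I}_\Delta(u)=-u(\mathbf{0})+\frac{1}{\mathrm{vol}(\Delta)}\int_\Delta u(\boldsymbol{x})\,dv,$$ where $dv$ is Lebesgue measure. $(X,-K_X)$ is Ding polystable with respect to toric test configurations if $\mathcal{I}_\Delta(u)\ge 0$ for all convex piecewise linear functions $u$ on $\Delta$, with equality if and only if $u$ is affine linear. *)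

theory Defs
  imports "HOL-Analysis.Analysis"
begin

section \<open>Reflexive polytopes\<close>

text \<open>The lattices M and N are both identified with the standard lattice of \<^typ>\<open>real^'n\<close>, and
  the duality pairing with the inner product.\<close>

definition lattice_points :: "(real^'n) set" where
  "lattice_points = {m. \<forall>k. m $ k \<in> \<int>}"

definition lattice_polytope :: "(real^'n) set \<Rightarrow> bool" where
  "lattice_polytope P \<longleftrightarrow> (\<exists>V. finite V \<and> V \<subseteq> lattice_points \<and> P = convex hull V)"

definition primitive :: "real^'n \<Rightarrow> bool" where
  "primitive v \<longleftrightarrow> v \<in> lattice_points \<and>
     (\<forall>k::nat. \<forall>w\<in>lattice_points. v = real k *\<^sub>R w \<longrightarrow> k = 1)"

definition reflexive_polytope :: "(real^'n) set \<Rightarrow> bool" where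
  "reflexive_polytope \<Delta> \<longleftrightarrow>
     lattice_polytope \<Delta> \<and> 0 \<in> interior \<Delta> \<and>
     (\<exists>P. lattice_polytope P \<and> 0 \<in> interior P \<and>
          (\<forall>v. v extreme_point_of P \<longrightarrow> primitive v) \<and>
          \<Delta> = {y. \<forall>x\<in>P. x \<bullet> y \<ge> - 1})"


section \<open>Projective space and its Grassmannians\<close>

text \<open>The homogeneous coordinates are indexed by a finite set \<open>A\<close> (so that N + 1 is the
  cardinality of \<open>A\<close>). A vector of the coordinate space is a function vanishing off \<open>A\<close>, and a
  point of projective space is the set of nonzero multiples of a nonzero vector.\<close>

definition coord_space :: "'a set \<Rightarrow> ('a \<Rightarrow> complex) set" where
  "coord_space A = {x. \<forall>a. a \<notin> A \<longrightarrow> x a = 0}"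

definition proj_point :: "('a \<Rightarrow> complex) \<Rightarrow> ('a \<Rightarrow> complex) set" where
  "proj_point x = {\<lambda>a. c * x a | c. c \<noteq> 0}"

definition proj_space :: "'a set \<Rightarrow> ('a \<Rightarrow> complex) set set" where
  "proj_space A = proj_point ` (coord_space A - {\<lambda>_. 0})"

text \<open>A linear subspace of codimension \<open>CARD('k)\<close> is described by \<open>CARD('k)\<close> independent linear
  equations, i.e. as the kernel of a surjective linear map from the coordinate space to
  \<^typ>\<open>complex^'k\<close>. Such a map is given by its columns \<open>f a\<close>; two of them define the same subspace iff
  they differ by an invertible matrix acting on the left.\<close>

definition lin_map :: "'a set \<Rightarrow> ('a \<Rightarrow> complex^'k) \<Rightarrow> ('a \<Rightarrow> complex) \<Rightarrow> complex^'k" where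
  "lin_map A f x = (\<Sum>a\<in>A. x a *s f a)"

definition frames :: "'a set \<Rightarrow> ('a \<Rightarrow> complex^'k) set" where
  "frames A = {f. lin_map A f ` coord_space A = UNIV}"

definition lin_subspace :: "'a set \<Rightarrow> ('a \<Rightarrow> complex^'k) \<Rightarrow> ('a \<Rightarrow> complex) set set" where
  "lin_subspace A f = {p \<in> proj_space A. \<forall>x\<in>p. lin_map A f x = 0}"

inductive_set frame_polys :: "'a set \<Rightarrow> (('a \<Rightarrow> complex^'k) \<Rightarrow> complex) set" for A where
  const: "(\<lambda>_. c) \<in> frame_polys A"
| coord: "a \<in> A \<Longrightarrow> (\<lambda>f. f a $ j) \<in> frame_polys A"
| add: "p \<in> frame_polys A \<Longrightarrow> q \<in> frame_polys A \<Longrightarrow> (\<lambda>f. p f + q f) \<in> frame_polys A"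
| mult: "p \<in> frame_polys A \<Longrightarrow> q \<in> frame_polys A \<Longrightarrow> (\<lambda>f. p f * q f) \<in> frame_polys A"

text \<open>The global sections of \<open>\<O>(d)\<close> on the Grassmannian. This line bundle is associated with the
  character \<open>det ^ d\<close> of GL on the principal bundle of frames, so a section is a regular function on
  frames which is equivariant for this character. The non-surjective maps have codimension at least
  2 in the space of all maps (whenever \<open>CARD('k) < card A\<close>), so a regular function on frames is the
  restriction of a unique polynomial.\<close>

definition grass_sections :: "'a set \<Rightarrow> nat \<Rightarrow> (('a \<Rightarrow> complex^'k) \<Rightarrow> complex) set" where
  "grass_sections A d =
     {R \<in> frame_polys A. \<forall>(g::complex^'k^'k) f. R (\<lambda>a. g *v f a) = det g ^ d * R f}"


section \<open>Chow stability\<close>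

text \<open>The dimension n of the variety \<open>X\<close> is the cardinality of the type \<open>'n\<close>: linear subspaces of
  codimension n have frames in \<^typ>\<open>complex^'n\<close>, those of codimension n + 1 have frames in
  \<^typ>\<open>complex^('n option)\<close>.

  The degree is the number of points of intersection with a generic linear subspace of
  codimension n.\<close>

definition has_degree ::
    "'n::finite itself \<Rightarrow> 'a set \<Rightarrow> ('a \<Rightarrow> complex) set set \<Rightarrow> nat \<Rightarrow> bool" where
  "has_degree (_::'n itself) A X d \<longleftrightarrow>
     (\<exists>G \<in> frame_polys A. (\<exists>f. G f \<noteq> 0) \<and>
        (\<forall>f :: 'a \<Rightarrow> complex^'n. f \<in> frames A \<and> G f \<noteq> 0 \<longrightarrow>
           finite (X \<inter> lin_subspace A f) \<and> card (X \<inter> lin_subspace A f) = d))"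

text \<open>Since the divisor of all linear subspaces meeting \<open>X\<close> is irreducible of degree d, a section
  of \<open>\<O>(d)\<close> with this zero set vanishes on it to first order, and is unique up to scale.\<close>

definition is_X_resultant ::
    "'a set \<Rightarrow> ('a \<Rightarrow> complex) set set \<Rightarrow> (('a \<Rightarrow> complex^('n::finite option)) \<Rightarrow> complex) \<Rightarrow> bool" where
  "is_X_resultant A X R \<longleftrightarrow>
     (\<exists>d\<ge>2. has_degree TYPE('n) A X d \<and> R \<in> grass_sections A d \<and>
        (\<forall>f\<in>frames A. R f = 0 \<longleftrightarrow> lin_subspace A f \<inter> X \<noteq> {}))"

text \<open>The orbit under the diagonal matrices of determinant 1. Moving a subspace by the diagonal
  matrix \<open>t\<close> multiplies the columns of its frames by the inverses of the entries of \<open>t\<close>.\<close>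

definition torus_orbit ::
    "'a set \<Rightarrow> (('a \<Rightarrow> complex^'k) \<Rightarrow> complex) \<Rightarrow> (('a \<Rightarrow> complex^'k) \<Rightarrow> complex) set" where
  "torus_orbit A R =
     {\<lambda>f. R (\<lambda>a. t a *s f a) | t. (\<forall>a\<in>A. t a \<noteq> 0) \<and> (\<Prod>a\<in>A. t a) = 1}"

text \<open>The closure is taken for the topology of pointwise convergence, which induces on the
  finite-dimensional space of sections its usual topology.\<close>

definition torus_chow_semistable ::
    "'n::finite itself \<Rightarrow> 'a set \<Rightarrow> ('a \<Rightarrow> complex) set set \<Rightarrow> bool" where
  "torus_chow_semistable (_::'n itself) A X \<longleftrightarrow>
     (\<exists>R :: ('a \<Rightarrow> complex^('n option)) \<Rightarrow> complex.
        is_X_resultant A X R \<and> (\<lambda>_. 0) \<notin> closure (torus_orbit A R))"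


section \<open>The toric variety of a reflexive polytope\<close>

text \<open>The characters forming a basis of the sections of \<open>-iK\<close>.\<close>

definition section_chars :: "(real^'n) set \<Rightarrow> nat \<Rightarrow> (real^'n) set" where
  "section_chars \<Delta> i = lattice_points \<inter> (\<lambda>x. real i *\<^sub>R x) ` \<Delta>"

text \<open>The maximal cones of the fan of X are the inner normal cones of \<open>\<Delta>\<close> at its vertices, and the
  points of the affine chart of a cone are the homomorphisms from the monoid of lattice points of
  the dual cone to the multiplicative monoid of the complex numbers.\<close>

definition normal_cone :: "(real^'n) set \<Rightarrow> real^'n \<Rightarrow> (real^'n) set" where
  "normal_cone \<Delta> v = {w. \<forall>y\<in>\<Delta>. w \<bullet> v \<le> w \<bullet> y}"

definition dual_cone_monoid :: "(real^'n) set \<Rightarrow> (real^'n) set" where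
  "dual_cone_monoid \<sigma> = {m \<in> lattice_points. \<forall>w\<in>\<sigma>. w \<bullet> m \<ge> 0}"

definition chart_points :: "(real^'n) set \<Rightarrow> (real^'n \<Rightarrow> complex) set" where
  "chart_points \<sigma> = {\<gamma>. \<gamma> 0 = 1 \<and>
     (\<forall>m\<in>dual_cone_monoid \<sigma>. \<forall>m'\<in>dual_cone_monoid \<sigma>. \<gamma> (m + m') = \<gamma> m * \<gamma> m')}"

text \<open>On the chart of a vertex \<open>v\<close> the line bundle \<open>-iK\<close> is trivialized by the character \<open>i v\<close>, so
  the section given by the character \<open>m\<close> becomes the function \<open>m - i v\<close> on the chart. The Kodaira map
  sends a point to the values of all these sections.\<close>

definition kodaira_image :: "(real^'n) set \<Rightarrow> nat \<Rightarrow> (real^'n \<Rightarrow> complex) set set" where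
  "kodaira_image \<Delta> i =
     {proj_point (\<lambda>m. if m \<in> section_chars \<Delta> i then \<gamma> (m - real i *\<^sub>R v) else 0) | v \<gamma>.
        v extreme_point_of \<Delta> \<and> \<gamma> \<in> chart_points (normal_cone \<Delta> v)}"

definition asymp_torus_chow_semistable :: "(real^'n) set \<Rightarrow> bool" where
  "asymp_torus_chow_semistable \<Delta> \<longleftrightarrow>
     (\<exists>i0. \<forall>i\<ge>i0. torus_chow_semistable TYPE('n) (section_chars \<Delta> i) (kodaira_image \<Delta> i))"


section \<open>Ding stability\<close>

definition convex_pl_on :: "(real^'n) set \<Rightarrow> (real^'n \<Rightarrow> real) \<Rightarrow> bool" where
  "convex_pl_on \<Delta> u \<longleftrightarrow>
     (\<exists>F :: ((real^'n) \<times> real) set. finite F \<and> F \<noteq> {} \<and>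
        (\<forall>x\<in>\<Delta>. u x = Max ((\<lambda>(a, b). a \<bullet> x + b) ` F)))"

definition affine_fun_on :: "(real^'n) set \<Rightarrow> (real^'n \<Rightarrow> real) \<Rightarrow> bool" where
  "affine_fun_on \<Delta> u \<longleftrightarrow> (\<exists>a b. \<forall>x\<in>\<Delta>. u x = a \<bullet> x + b)"

definition ding_invariant :: "(real^'n) set \<Rightarrow> (real^'n \<Rightarrow> real) \<Rightarrow> real" where
  "ding_invariant \<Delta> u = - u 0 + 1 / measure lebesgue \<Delta> * (LINT x:\<Delta>|lebesgue. u x)"

definition toric_ding_polystable :: "(real^'n) set \<Rightarrow> bool" where
  "toric_ding_polystable \<Delta> \<longleftrightarrow>
     (\<forall>u. convex_pl_on \<Delta> u \<longrightarrow>
        ding_invariant \<Delta> u \<ge> 0 \<and> (ding_invariant \<Delta> u = 0 \<longleftrightarrow> affine_fun_on \<Delta> u))"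

end

theory Submission
  imports Defs "HOL-Complex_Analysis.Conformal_Mappings"
    "HOL-Computational_Algebra.Fundamental_Theorem_Algebra" "HOL-Real_Asymp.Real_Asymp"
begin

text \<open>Let \<open>A i\<close> be the set of lattice points of \<open>i \<Delta>\<close>, with mean \<open>\<mu> i\<close>. The variety is the closure of a
  torus, so the polynomials vanishing on all frames of subspaces meeting the torus form a prime
  ideal, and any two forms with this zero locus have proportional powers. For the X-resultant and
  its translate by a diagonal matrix coming from the torus this shows that the resultant is an
  eigenvector up to constants of modulus 1, and semistability forces its weight to be its degree
  times \<open>\<mu> i\<close>. Comparing the resultants at the levels \<open>i\<close> and \<open>k i\<close> through the dilation
  \<open>m \<mapsto> k m\<close> of the characters then gives \<open>\<mu> (k i) = k \<mu> i\<close>. Hence there is a vector \<open>b\<close> with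
  \<open>\<mu> i = i b\<close> for all large \<open>i\<close>.

  Since \<open>\<Delta>\<close> is reflexive, its gauge takes integer values at lattice points, and summing the
  relation over all levels below \<open>L\<close> turns it into an identity of Riemann sums for continuous
  piecewise quadratic functions. These sums approximate their integrals with error \<open>o(1/L)\<close>, and
  the terms of order \<open>1/L\<close> give \<open>b = 0\<close>. So the barycenter of \<open>\<Delta>\<close> is the origin, and the Ding
  invariant is nonnegative by Jensen's inequality.\<close>

section \<open>Polynomial functions of frames\<close>

text \<open>The hypothesis describes a resultant only by its zeros among surjective maps and by its
  equivariance. Irreducibility of the zero locus comes from entire curves: any two points of the
  torus locus lie on one, and entire functions have no zero divisors. This yields proportional
  powers, with unknown exponents and an unknown constant. Neither does harm, because only growth
  rates of moduli along one-parameter subgroups are compared.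

  The relation at a single level is not precise enough to give b = 0: Riemann sums of a function cut
  off at the boundary of \<Delta> have errors of order 1/L, as large as the term sought. Adding all
  levels below L replaces the cut-off by a factor that vanishes on the boundary. A lattice point m
  enters at level g m, where g is the gauge, and the sum of all j with g m \<le> j < L falls short
  of (L^2 - (g m)^2) / 2 by half the number of these levels. That half is the term of order
  1/L.\<close>

lemma frame_polys_cong:
  "p \<in> frame_polys A \<Longrightarrow> (\<And>a. a \<in> A \<Longrightarrow> f a = g a) \<Longrightarrow> p f = p g"
  by (induction rule: frame_polys.induct) auto

lemma frame_polys_sum:
  "(\<And>i. i \<in> I \<Longrightarrow> p i \<in> frame_polys A) \<Longrightarrow> (\<lambda>f. \<Sum>i\<in>I. p i f) \<in> frame_polys A"
  by (induction I rule: infinite_finite_induct) (auto intro: frame_polys.intros)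

lemma frame_polys_prod:
  "(\<And>i. i \<in> I \<Longrightarrow> p i \<in> frame_polys A) \<Longrightarrow> (\<lambda>f. \<Prod>i\<in>I. p i f) \<in> frame_polys A"
  by (induction I rule: infinite_finite_induct) (auto intro: frame_polys.intros)

lemma frame_polys_compose:
  assumes "p \<in> frame_polys A"
    and "\<And>a j. a \<in> A \<Longrightarrow> (\<lambda>f. \<phi> f a $ j) \<in> frame_polys B"
  shows "(\<lambda>f. p (\<phi> f)) \<in> frame_polys B"
  using assms(1) by (induction rule: frame_polys.induct) (auto intro: frame_polys.intros assms(2))

lemma frame_polys_holomorphic:
  assumes "p \<in> frame_polys A"
    and "\<And>a j. a \<in> A \<Longrightarrow> (\<lambda>\<tau>. \<eta> \<tau> a $ j) holomorphic_on UNIV"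
  shows "(\<lambda>\<tau>. p (\<eta> \<tau>)) holomorphic_on UNIV"
  using assms(1) by (induction rule: frame_polys.induct) (auto intro!: holomorphic_intros assms(2))

text \<open>Where \<open>f\<close> is nonzero it is nonzero on a ball, so \<open>g\<close> vanishes
  there, and by the identity theorem everywhere. The irreducibility arguments below reduce to this
  fact.\<close>

lemma holomorphic_mult_eq_0:
  assumes "f holomorphic_on UNIV" "g holomorphic_on UNIV" "\<And>z. f z * g z = (0::complex)"
    and "f z1 \<noteq> 0" "g z2 \<noteq> 0"
  shows False
proof -
  have "isCont f z1"
    using assms(1) holomorphic_on_imp_continuous_on continuous_on_eq_continuous_at by blast
  then obtain e where e: "e > 0" "\<And>w. w \<in> ball z1 e \<Longrightarrow> f w \<noteq> 0"
    using continuous_at_avoid[of z1 f 0] assms(4) by (auto simp: dist_commute)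
  then have z: "\<And>w. w \<in> ball z1 e \<Longrightarrow> g w = 0"
    using assms(3) mult_eq_0_iff by metis
  have "g z2 = 0"
    by (rule analytic_continuation[OF assms(2), of "ball z1 e" z1])
       (use z e in \<open>auto simp: islimpt_ball\<close>)
  then show False using assms by simp
qed

text \<open>On the complex line through \<open>f\<close> and \<open>g\<close> both polynomials
  become entire functions of one variable.\<close>

lemma frame_polys_no_zero_divisors:
  fixes p q :: "('a \<Rightarrow> complex^'k) \<Rightarrow> complex"
  assumes "p \<in> frame_polys A" "q \<in> frame_polys A" "p f \<noteq> 0" "q g \<noteq> 0"
  shows "\<exists>h. p h * q h \<noteq> 0"
proof (rule ccontr)
  assume c: "\<not> ?thesis"
  define \<eta> where "\<eta> \<tau> = (\<lambda>a. f a + \<tau> *s (g a - f a))" for \<tau>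
  have h: "(\<lambda>\<tau>. \<eta> \<tau> a $ j) holomorphic_on UNIV" for a j
    by (auto simp: \<eta>_def intro!: holomorphic_intros)
  show False
    by (rule holomorphic_mult_eq_0[OF frame_polys_holomorphic[OF assms(1) h]
          frame_polys_holomorphic[OF assms(2) h], where ?z1.0 = 0 and ?z2.0 = 1]) (use c assms in \<open>auto simp: \<eta>_def\<close>)
qed

text \<open>Packing the functions into a type with an \<open>idom\<close> instance makes
  \<open>poly\<close>, \<open>degree\<close> and pseudo-division available over this ring.\<close>

typedef ('a, 'k) frame_poly = "frame_polys UNIV :: (('a \<Rightarrow> complex^'k::finite) \<Rightarrow> complex) set"
  by (auto intro: frame_polys.const)

setup_lifting type_definition_frame_poly

instantiation frame_poly :: (type, finite) idom
begin
lift_definition zero_frame_poly :: "('a, 'b) frame_poly" is "\<lambda>_. 0" by (rule frame_polys.const)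
lift_definition one_frame_poly :: "('a, 'b) frame_poly" is "\<lambda>_. 1" by (rule frame_polys.const)
lift_definition plus_frame_poly :: "('a, 'b) frame_poly \<Rightarrow> ('a, 'b) frame_poly \<Rightarrow> ('a, 'b) frame_poly"
  is "\<lambda>p q f. p f + q f" by (rule frame_polys.add)
lift_definition times_frame_poly :: "('a, 'b) frame_poly \<Rightarrow> ('a, 'b) frame_poly \<Rightarrow> ('a, 'b) frame_poly"
  is "\<lambda>p q f. p f * q f" by (rule frame_polys.mult)
lift_definition uminus_frame_poly :: "('a, 'b) frame_poly \<Rightarrow> ('a, 'b) frame_poly"
  is "\<lambda>p f. - p f" using frame_polys.mult[OF frame_polys.const[of "-1"]] by auto
lift_definition minus_frame_poly :: "('a, 'b) frame_poly \<Rightarrow> ('a, 'b) frame_poly \<Rightarrow> ('a, 'b) frame_poly"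
  is "\<lambda>p q f. p f - q f"
  subgoal for p q
    using frame_polys.add[OF _ frame_polys.mult[OF frame_polys.const[of "-1"]], of p _ q] by auto
  done
instance
proof
  fix a b c :: "('a, 'b) frame_poly"
  show "a * b * c = a * (b * c)" "a * b = b * a" "1 * a = a" "a + b + c = a + (b + c)"
    "a + b = b + a" "0 + a = a" "- a + a = 0" "a - b = a + - b" "(a + b) * c = a * c + b * c"
    "0 * a = 0" "a * 0 = 0" "a * (b + c) = a * b + a * c"
    by (transfer; simp add: algebra_simps)+
  show "(0 :: ('a, 'b) frame_poly) \<noteq> 1" by transfer (simp add: fun_eq_iff)
  show "a * b \<noteq> 0" if "a \<noteq> 0" "b \<noteq> 0"
    using that
  proof transfer
    fix a b :: "('a \<Rightarrow> complex^'b) \<Rightarrow> complex"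
    assume p: "a \<in> frame_polys UNIV" "b \<in> frame_polys UNIV" and "a \<noteq> (\<lambda>_. 0)" "b \<noteq> (\<lambda>_. 0)"
    then obtain f g where "a f \<noteq> 0" "b g \<noteq> 0" by (meson ext)
    then show "(\<lambda>f. a f * b f) \<noteq> (\<lambda>_. 0)"
      using frame_polys_no_zero_divisors[OF p] by (auto simp: fun_eq_iff)
  qed
qed
end

lift_definition const_fp :: "complex \<Rightarrow> ('a, 'k::finite) frame_poly" is "\<lambda>c _. c"
  by (rule frame_polys.const)

text \<open>A polynomial in one variable over the ring of polynomial functions is evaluated at a
  frame \<open>y\<close> and at the value \<open>s\<close> of the variable.\<close>

definition fp_eval :: "('a, 'k::finite) frame_poly poly \<Rightarrow> ('a \<Rightarrow> complex^'k) \<Rightarrow> complex \<Rightarrow> complex" where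
  "fp_eval \<Phi> y s = Rep_frame_poly (poly \<Phi> (const_fp s)) y"

lemma fp_eval_simps [simp]:
  "fp_eval 0 y s = 0" "fp_eval 1 y s = 1"
  "fp_eval (\<Phi> + \<Psi>) y s = fp_eval \<Phi> y s + fp_eval \<Psi> y s"
  "fp_eval (\<Phi> * \<Psi>) y s = fp_eval \<Phi> y s * fp_eval \<Psi> y s"
  "fp_eval (smult c \<Phi>) y s = Rep_frame_poly c y * fp_eval \<Phi> y s"
  "fp_eval (pCons c \<Phi>) y s = Rep_frame_poly c y + s * fp_eval \<Phi> y s"
  by (simp_all add: fp_eval_def zero_frame_poly.rep_eq one_frame_poly.rep_eq
      plus_frame_poly.rep_eq times_frame_poly.rep_eq const_fp.rep_eq)

lemma fp_eval_power [simp]: "fp_eval (\<Phi> ^ n) y s = fp_eval \<Phi> y s ^ n"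
  by (induction n) auto

lemma fp_eval_map_poly:
  "fp_eval \<Phi> y s = poly (map_poly (\<lambda>c. Rep_frame_poly c y) \<Phi>) s"
  by (induction \<Phi>) (auto simp: map_poly_pCons zero_frame_poly.rep_eq)

text \<open>The direction \<open>v\<close> is fixed while the base point \<open>y\<close> stays a
  variable: \<open>p\<close> is expanded in powers of \<open>s\<close>, with coefficients that are
  polynomial functions of \<open>y\<close>.\<close>

lemma fp_line:
  assumes "p \<in> frame_polys (UNIV::'a set)"
  shows "\<exists>\<Phi> :: ('a, 'k::finite) frame_poly poly. \<forall>y s. fp_eval \<Phi> y s = p (\<lambda>a. y a + s *s v a)"
  using assms
proof (induction rule: frame_polys.induct)
  case (const c)
  show ?case by (rule exI[of _ "[:const_fp c:]"]) (simp add: const_fp.rep_eq)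
next
  case (coord a j)
  have m: "(\<lambda>y. y a $ j) \<in> frame_polys UNIV" by (rule frame_polys.coord) simp
  show ?case
    by (rule exI[of _ "[:Abs_frame_poly (\<lambda>y. y a $ j), const_fp (v a $ j):]"])
       (simp add: const_fp.rep_eq Abs_frame_poly_inverse[OF m])
next
  case (add p q)
  then obtain \<Phi> \<Psi> where "\<forall>y s. fp_eval \<Phi> y s = p (\<lambda>a. y a + s *s v a)"
     "\<forall>y s. fp_eval \<Psi> y s = q (\<lambda>a. y a + s *s v a)" by auto
  then show ?case by (intro exI[of _ "\<Phi> + \<Psi>"]) simp
next
  case (mult p q)
  then obtain \<Phi> \<Psi> where "\<forall>y s. fp_eval \<Phi> y s = p (\<lambda>a. y a + s *s v a)"
     "\<forall>y s. fp_eval \<Psi> y s = q (\<lambda>a. y a + s *s v a)" by auto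
  then show ?case by (intro exI[of _ "\<Phi> * \<Psi>"]) simp
qed

lemma fp_eval_holomorphic:
  fixes \<Phi> :: "('a, 'k::finite) frame_poly poly"
  assumes "\<And>a j. (\<lambda>\<tau>. \<eta> \<tau> a $ j) holomorphic_on UNIV" "\<sigma> holomorphic_on UNIV"
  shows "(\<lambda>\<tau>. fp_eval \<Phi> (\<eta> \<tau>) (\<sigma> \<tau>)) holomorphic_on UNIV"
proof (induction \<Phi>)
  case (pCons a p)
  have "(\<lambda>\<tau>. Rep_frame_poly a (\<eta> \<tau>)) holomorphic_on UNIV"
    using frame_polys_holomorphic[OF Rep_frame_poly] assms by auto
  then show ?case using pCons by (auto intro!: holomorphic_intros assms)
qed auto

section \<open>Prime ideals of one-variable polynomials over a domain\<close>

locale prime_no_const =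
  fixes I :: "'r::idom poly set"
  assumes add: "a \<in> I \<Longrightarrow> b \<in> I \<Longrightarrow> a + b \<in> I"
    and mult: "a \<in> I \<Longrightarrow> a * b \<in> I"
    and prime: "a * b \<in> I \<Longrightarrow> a \<in> I \<or> b \<in> I"
    and const: "[:c:] \<in> I \<Longrightarrow> c = 0"
begin

lemma smult_iff: "c \<noteq> 0 \<Longrightarrow> smult c a \<in> I \<longleftrightarrow> a \<in> I"
  using prime[of "[:c:]" a] const[of c] mult[of a "[:c:]"] by (auto simp: mult.commute)

lemma diff: "a \<in> I \<Longrightarrow> b \<in> I \<Longrightarrow> a - b \<in> I"
  using add[of a "-b"] mult[of b "-1"] by simp

text \<open>The ideal \<open>I\<close> meets the coefficient ring only in 0. Over the fraction field
  it would be generated by any nonzero element of least degree; here denominators are cleared by a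
  factor \<open>c\<close> instead.\<close>

lemma pseudo_div:
  assumes "(r::'r poly) \<noteq> 0"
  obtains c q s where "c \<noteq> 0" "smult c f = r * q + s" "s = 0 \<or> degree s < degree r"
proof -
  obtain q s where qs: "pseudo_divmod f r = (q, s)" by force
  from pseudo_divmod[OF assms qs] show ?thesis
    using that[of "coeff r (degree r) ^ (Suc (degree f) - degree r)" q s] assms by auto
qed

text \<open>The remainder of \<open>F\<close> modulo \<open>p\<close> lies in \<open>I\<close> and
  has smaller degree than \<open>p\<close>, so it vanishes. Dividing again while the quotient stays
  in \<open>I\<close> comes to an end because \<open>p\<close> has positive degree.\<close>

lemma factor:
  assumes p: "p \<in> I" "p \<noteq> 0" "\<And>x. x \<in> I \<Longrightarrow> x \<noteq> 0 \<Longrightarrow> degree p \<le> degree x"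
    and F: "F \<in> I" "F \<noteq> 0"
  shows "\<exists>c a q. c \<noteq> 0 \<and> a > 0 \<and> q \<notin> I \<and> smult c F = p ^ a * q"
  using F
proof (induction "degree F" arbitrary: F rule: less_induct)
  case less
  have dp: "degree p > 0"
    using p(1,2) const by (metis degree_eq_zeroE not_gr_zero pCons_0_0)
  obtain c q s where c: "c \<noteq> 0" "smult c F = p * q + s" "s = 0 \<or> degree s < degree p"
    using pseudo_div[OF p(2)] by metis
  have "s = smult c F - p * q" using c by simp
  then have "s \<in> I" using diff smult_iff[OF c(1)] less(2) mult[OF p(1)] by simp
  then have s: "s = 0" using c(3) p(3)[of s] by (meson not_le)
  show ?case
  proof (cases "q \<in> I")
    case False
    then show ?thesis using c s by (intro exI[of _ c] exI[of _ 1] exI[of _ q]) auto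
  next
    case True
    have q0: "q \<noteq> 0" using c s less by auto
    have "degree F = degree p + degree q"
      using c s q0 p(2) by (metis add.right_neutral degree_mult_eq degree_smult_eq)
    then have "degree q < degree F" using dp by simp
    then obtain c' a q' where "c' \<noteq> 0" "a > 0" "q' \<notin> I" "smult c' q = p ^ a * q'"
      using less(1)[OF _ True q0] by blast
    moreover have "smult (c' * c) F = p * smult c' q"
      using c s by (simp flip: smult_smult)
    ultimately show ?thesis
      using c by (intro exI[of _ "c' * c"] exI[of _ "Suc a"] exI[of _ q']) auto
  qed
qed

text \<open>An element \<open>r\<close> of least degree in the ideal generated by \<open>p\<close>
  and \<open>q\<close> divides both up to constants. Since \<open>q\<close> lies outside
  \<open>I\<close>, so does \<open>r\<close>. By primeness the cofactor of \<open>p\<close> is then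
  in \<open>I\<close> and has at least the degree of \<open>p\<close>, which leaves degree 0 for
  \<open>r\<close>.\<close>

lemma bezout:
  assumes p: "p \<in> I" "p \<noteq> 0" "\<And>x. x \<in> I \<Longrightarrow> x \<noteq> 0 \<Longrightarrow> degree p \<le> degree x"
    and q: "q \<notin> I"
  shows "\<exists>e a b. e \<noteq> 0 \<and> [:e:] = a * p + b * q"
proof -
  define J where "J = {a * p + b * q | a b. True}"
  have J: "x - y * z \<in> J" if "x \<in> J" "y \<in> J" for x y z
  proof -
    obtain a b a' b' where "x = a * p + b * q" "y = a' * p + b' * q" using \<open>x \<in> J\<close> \<open>y \<in> J\<close> by (auto simp: J_def)
    then have "x - y * z = (a - a' * z) * p + (b - b' * z) * q" by (simp add: algebra_simps)
    then show ?thesis unfolding J_def by blast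
  qed
  have "1 * p + 0 * q \<in> J" "0 * p + 1 * q \<in> J" unfolding J_def by blast+
  then have pq: "p \<in> J" "q \<in> J" by auto
  \<comment> \<open>A multiple by \<open>c\<close> is obtained as \<open>x\<close> minus its
    multiple by \<open>1 - c\<close>.\<close>
  have Js: "smult c x \<in> J" if "x \<in> J" for c x
    using J[OF that that, of "[:1-c:]"] by (simp add: smult_diff_left)
  define r where "r = arg_min degree (\<lambda>x. x \<in> J \<and> x \<noteq> 0)"
  have r: "r \<in> J" "r \<noteq> 0" "\<And>x. x \<in> J \<Longrightarrow> x \<noteq> 0 \<Longrightarrow> degree r \<le> degree x"
    using arg_min_natI[of "\<lambda>x. x \<in> J \<and> x \<noteq> 0" p degree] pq p(2)
      arg_min_nat_le[of "\<lambda>x. x \<in> J \<and> x \<noteq> 0" _ degree] by (auto simp: r_def)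
  have dv: "\<exists>c h. c \<noteq> 0 \<and> smult c x = r * h" if "x \<in> J" for x
  proof -
    obtain c h s where c: "c \<noteq> 0" "smult c x = r * h + s" "s = 0 \<or> degree s < degree r"
      using pseudo_div[OF r(2)] by metis
    then have "s = smult c x - r * h" by simp
    then have "s \<in> J" using J Js that r(1) by auto
    then have "s = 0" using c(3) r(3)[of s] by (meson not_le)
    then show ?thesis using c by auto
  qed
  obtain c h where c: "c \<noteq> 0" "smult c p = r * h" using dv pq by blast
  obtain c' h' where c': "c' \<noteq> 0" "smult c' q = r * h'" using dv pq by blast
  have "r \<notin> I" using c' q mult smult_iff by metis
  then have h: "h \<in> I" using prime[of r h] c smult_iff p(1) by metis
  have h0: "h \<noteq> 0" using c p(2) by auto
  have "degree p = degree r + degree h"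
    using c r(2) h0 by (metis degree_mult_eq degree_smult_eq)
  then have "degree r = 0" using p(3)[OF h h0] by simp
  then obtain e where e: "r = [:e:]" by (rule degree_eq_zeroE)
  then show ?thesis using r(1,2) unfolding J_def by auto
qed

end

section \<open>The locus of subspaces meeting the torus\<close>

text \<open>The character \<open>m\<close> at the torus point with logarithmic coordinates
  \<open>z\<close>. Logarithms turn the torus into a vector space: two points are joined by an
  entire curve, and a k-th root is a division by k.\<close>

definition torus_char :: "complex^'n \<Rightarrow> real^'n \<Rightarrow> complex" where
  "torus_char z m = exp (\<Sum>k\<in>UNIV. of_real (m $ k) * z $ k)"

lemma torus_char_add: "torus_char z (m + m') = torus_char z m * torus_char z m'"
  by (simp add: torus_char_def exp_add[symmetric] sum.distrib[symmetric] algebra_simps)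

lemma torus_char_add_left: "torus_char (z + z') m = torus_char z m * torus_char z' m"
  by (simp add: torus_char_def exp_add[symmetric] sum.distrib[symmetric] algebra_simps)

lemma torus_char_0 [simp]: "torus_char z 0 = 1" "torus_char 0 m = 1"
  by (simp_all add: torus_char_def)

lemma torus_char_nonzero [simp]: "torus_char z m \<noteq> 0"
  by (simp add: torus_char_def)

lemma torus_char_separates:
  assumes "m \<noteq> m'"
  shows "\<exists>z. torus_char z m \<noteq> torus_char z m'"
proof -
  obtain k where k: "m $ k \<noteq> m' $ k" using assms by (auto simp: vec_eq_iff)
  have "torus_char (axis k 1) x = exp (of_real (x $ k))" for x :: "real^'a"
    by (simp add: torus_char_def axis_def if_distrib cong: if_cong)
  then show ?thesis using k by (metis exp_inj_iff exp_of_real of_real_eq_iff)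
qed

text \<open>Dedekind's argument: translating the relation by \<open>z0\<close> and subtracting
  \<open>torus_char z0 m1\<close> times the original one removes the term of \<open>m1\<close>,
  while the term of \<open>m\<close> keeps a nonzero factor if \<open>z0\<close> separates
  \<open>m\<close> from \<open>m1\<close>.\<close>

lemma torus_char_independent:
  assumes "finite M" "\<And>z. (\<Sum>m\<in>M. c m * torus_char z m) = 0" "m \<in> M"
  shows "c m = 0"
  using assms
proof (induction M arbitrary: c m rule: finite_induct)
  case (insert m1 M)
  have s: "c m1 * torus_char z m1 + (\<Sum>m\<in>M. c m * torus_char z m) = 0" for z
    using insert.prems(1)[of z] insert.hyps by simp
  have s': "(\<Sum>m\<in>M. c m * torus_char z m) = - (c m1 * torus_char z m1)" for z
    using s[of z] by (simp add: eq_neg_iff_add_eq_0 add.commute)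
  have "c m = 0" if m: "m \<in> M" for m
  proof -
    obtain z0 where z0: "torus_char z0 m \<noteq> torus_char z0 m1"
      using torus_char_separates[of m m1] m insert.hyps by metis
    have "(\<Sum>m\<in>M. c m * (torus_char z0 m - torus_char z0 m1) * torus_char z m) = 0" for z
    proof -
      have "(\<Sum>m\<in>M. c m * (torus_char z0 m - torus_char z0 m1) * torus_char z m)
        = (\<Sum>m\<in>M. c m * torus_char (z + z0) m) - torus_char z0 m1 * (\<Sum>m\<in>M. c m * torus_char z m)"
        by (simp add: torus_char_add_left sum_subtractf sum_distrib_left algebra_simps)
      also have "\<dots> = - (c m1 * torus_char (z + z0) m1) - torus_char z0 m1 * (- (c m1 * torus_char z m1))"
        by (simp only: s')
      also have "\<dots> = 0" by (simp add: torus_char_add_left)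
      finally show ?thesis .
    qed
    from insert.IH[OF this m] z0 show ?thesis by simp
  qed
  with s[of 0] insert.prems(2) show ?case by auto
qed auto

text \<open>For lattice points \<open>A\<close>, a frame \<open>f\<close> is read as a system of
  \<open>CARD('k)\<close> Laurent polynomials with exponents in \<open>A\<close>. The locus consists
  of the systems with a common zero in the torus, surjective or not.\<close>

definition torus_locus :: "(real^'n) set \<Rightarrow> (real^'n \<Rightarrow> complex^'k) set" where
  "torus_locus A = {f. \<exists>z. (\<Sum>a\<in>A. torus_char z a *s f a) = 0}"

text \<open>Along a chart, a polynomial in the frame coordinates becomes a linear combination of
  characters. It vanishes on the whole chart once it vanishes on the torus, since characters of
  the torus are linearly independent. This avoids approximating boundary points by torus points.\<close>

definition monoid_combs :: "(real^'n) set \<Rightarrow> ((real^'n \<Rightarrow> complex) \<Rightarrow> complex) set" where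
  "monoid_combs \<sigma> = {F. \<exists>M c. finite M \<and> M \<subseteq> dual_cone_monoid \<sigma> \<and>
     (\<forall>\<gamma>\<in>chart_points \<sigma>. F \<gamma> = (\<Sum>m\<in>M. c m * \<gamma> m))}"

lemma monoid_combs_single:
  "m \<in> dual_cone_monoid \<sigma> \<Longrightarrow> (\<And>\<gamma>. \<gamma> \<in> chart_points \<sigma> \<Longrightarrow> F \<gamma> = c * \<gamma> m) \<Longrightarrow> F \<in> monoid_combs \<sigma>"
  unfolding monoid_combs_def by (auto intro!: exI[of _ "{m}"] exI[of _ "\<lambda>_. c"])

lemma dual_cone_monoid_0 [simp]: "0 \<in> dual_cone_monoid \<sigma>"
  by (simp add: dual_cone_monoid_def lattice_points_def)

lemma dual_cone_monoid_add:
  "m \<in> dual_cone_monoid \<sigma> \<Longrightarrow> m' \<in> dual_cone_monoid \<sigma> \<Longrightarrow> m + m' \<in> dual_cone_monoid \<sigma>"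
  by (auto simp: dual_cone_monoid_def lattice_points_def inner_add_right)

lemma monoid_combs_add:
  assumes "F \<in> monoid_combs \<sigma>" "G \<in> monoid_combs \<sigma>"
  shows "(\<lambda>\<gamma>. F \<gamma> + G \<gamma>) \<in> monoid_combs \<sigma>"
proof -
  obtain M c where M: "finite M" "M \<subseteq> dual_cone_monoid \<sigma>"
    "\<And>\<gamma>. \<gamma>\<in>chart_points \<sigma> \<Longrightarrow> F \<gamma> = (\<Sum>m\<in>M. c m * \<gamma> m)"
    using assms(1) unfolding monoid_combs_def by blast
  obtain M' c' where M': "finite M'" "M' \<subseteq> dual_cone_monoid \<sigma>"
    "\<And>\<gamma>. \<gamma>\<in>chart_points \<sigma> \<Longrightarrow> G \<gamma> = (\<Sum>m\<in>M'. c' m * \<gamma> m)"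
    using assms(2) unfolding monoid_combs_def by blast
  define d where "d m = (if m \<in> M then c m else 0) + (if m \<in> M' then c' m else 0)" for m
  have "F \<gamma> + G \<gamma> = (\<Sum>m\<in>M \<union> M'. d m * \<gamma> m)" if "\<gamma> \<in> chart_points \<sigma>" for \<gamma>
  proof -
    have "F \<gamma> = (\<Sum>m\<in>M \<union> M'. (if m \<in> M then c m else 0) * \<gamma> m)"
      unfolding M(3)[OF that]
    proof (rule sum.mono_neutral_cong_left)
      show "finite (M \<union> M')" using M(1) M'(1) by blast
      show "M \<subseteq> M \<union> M'" by blast
    qed simp_all
    moreover have "G \<gamma> = (\<Sum>m\<in>M \<union> M'. (if m \<in> M' then c' m else 0) * \<gamma> m)"
      unfolding M'(3)[OF that]
    proof (rule sum.mono_neutral_cong_left)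
      show "finite (M \<union> M')" using M(1) M'(1) by blast
      show "M' \<subseteq> M \<union> M'" by blast
    qed simp_all
    ultimately show ?thesis by (simp only: d_def distrib_right sum.distrib)
  qed
  then show ?thesis unfolding monoid_combs_def using M M'
    by (intro CollectI exI[of _ "M \<union> M'"] exI[of _ d]) auto
qed

lemma monoid_combs_sum:
  "finite I \<Longrightarrow> (\<And>i. i \<in> I \<Longrightarrow> F i \<in> monoid_combs \<sigma>) \<Longrightarrow> (\<lambda>\<gamma>. \<Sum>i\<in>I. F i \<gamma>) \<in> monoid_combs \<sigma>"
proof (induction I rule: finite_induct)
  case empty
  show ?case by (rule monoid_combs_single[of 0 _ _ 0]) auto
next
  case (insert i I)
  then show ?case by (auto intro!: monoid_combs_add)
qed

lemma monoid_combs_cong: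
  "(\<And>\<gamma>. \<gamma> \<in> chart_points \<sigma> \<Longrightarrow> F \<gamma> = G \<gamma>) \<Longrightarrow> F \<in> monoid_combs \<sigma> \<longleftrightarrow> G \<in> monoid_combs \<sigma>"
  unfolding monoid_combs_def by auto

lemma monoid_combs_mult:
  assumes "F \<in> monoid_combs \<sigma>" "G \<in> monoid_combs \<sigma>"
  shows "(\<lambda>\<gamma>. F \<gamma> * G \<gamma>) \<in> monoid_combs \<sigma>"
proof -
  obtain M c where M: "finite M" "M \<subseteq> dual_cone_monoid \<sigma>"
    "\<And>\<gamma>. \<gamma>\<in>chart_points \<sigma> \<Longrightarrow> F \<gamma> = (\<Sum>m\<in>M. c m * \<gamma> m)"
    using assms(1) unfolding monoid_combs_def by blast
  obtain M' c' where M': "finite M'" "M' \<subseteq> dual_cone_monoid \<sigma>"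
    "\<And>\<gamma>. \<gamma>\<in>chart_points \<sigma> \<Longrightarrow> G \<gamma> = (\<Sum>m\<in>M'. c' m * \<gamma> m)"
    using assms(2) unfolding monoid_combs_def by blast
  have mu: "\<gamma> (m + m') = \<gamma> m * \<gamma> m'"
    if "\<gamma> \<in> chart_points \<sigma>" "m \<in> M" "m' \<in> M'" for \<gamma> m m'
    using that M(2) M'(2) unfolding chart_points_def by blast
  have "(\<lambda>\<gamma>. \<Sum>m\<in>M. \<Sum>m'\<in>M'. c m * c' m' * \<gamma> (m + m')) \<in> monoid_combs \<sigma>"
  proof (intro monoid_combs_sum M(1) M'(1))
    fix m m' assume "m \<in> M" "m' \<in> M'"
    then have "m + m' \<in> dual_cone_monoid \<sigma>" using M(2) M'(2) dual_cone_monoid_add by blast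
    then show "(\<lambda>\<gamma>. c m * c' m' * \<gamma> (m + m')) \<in> monoid_combs \<sigma>"
      by (rule monoid_combs_single[where c = "c m * c' m'"]) simp
  qed
  then show ?thesis
  proof (rule monoid_combs_cong[THEN iffD2, rotated])
    fix \<gamma> assume that: "\<gamma> \<in> chart_points \<sigma>"
    show "F \<gamma> * G \<gamma> = (\<Sum>m\<in>M. \<Sum>m'\<in>M'. c m * c' m' * \<gamma> (m + m'))"
    unfolding M(3)[OF that] M'(3)[OF that] sum_product
    by (intro sum.cong refl) (simp add: mu[OF that] mult_ac)
  qed
qed

lemma torus_char_chart_point: "torus_char z \<in> chart_points \<sigma>"
  by (simp add: chart_points_def torus_char_add)

lemma monoid_combs_vanish:
  assumes "F \<in> monoid_combs \<sigma>" "\<And>z. F (torus_char z) = 0" "\<gamma> \<in> chart_points \<sigma>"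
  shows "F \<gamma> = 0"
proof -
  obtain M c where M: "finite M" "M \<subseteq> dual_cone_monoid \<sigma>"
    "\<And>\<gamma>. \<gamma>\<in>chart_points \<sigma> \<Longrightarrow> F \<gamma> = (\<Sum>m\<in>M. c m * \<gamma> m)"
    using assms(1) unfolding monoid_combs_def by blast
  have "c m = 0" if "m \<in> M" for m
    by (rule torus_char_independent[OF M(1) _ that])
       (use M(3)[OF torus_char_chart_point] assms(2) in auto)
  then show ?thesis using M(3)[OF assms(3)] by simp
qed

text \<open>The column \<open>f a0\<close> has the coefficient \<open>\<gamma> 0 = 1\<close> in the
  relation, which can therefore be solved for it. The systems vanishing at \<open>\<gamma>\<close>
  are thus given by a formula in the values of \<open>\<gamma>\<close>, to which the independence of
  characters applies.\<close>

lemma vanish_chart_point: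
  fixes p :: "(real^'n \<Rightarrow> complex^'k) \<Rightarrow> complex"
  assumes p: "p \<in> frame_polys UNIV" "\<And>g. g \<in> torus_locus A \<Longrightarrow> p g = 0"
    and A: "finite A" "a0 \<in> A" "\<And>a. a \<in> A \<Longrightarrow> a - a0 \<in> dual_cone_monoid \<sigma>"
    and f: "\<gamma> \<in> chart_points \<sigma>" "(\<Sum>a\<in>A. \<gamma> (a - a0) *s f a) = 0"
  shows "p f = 0"
proof -
  \<comment> \<open>Only the column at \<open>a0\<close> varies with the chart point; at the given
    point the formula returns \<open>f\<close> itself.\<close>
  define \<phi> where "\<phi> \<gamma> = f(a0 := - (\<Sum>a\<in>A - {a0}. \<gamma> (a - a0) *s f a))" for \<gamma>
  have "(\<lambda>\<gamma>. p (\<phi> \<gamma>)) \<in> monoid_combs \<sigma>"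
    using p(1)
  proof (induction rule: frame_polys.induct)
    case (const c)
    show ?case by (rule monoid_combs_single[of 0 _ _ c]) (auto simp: chart_points_def)
  next
    case (coord a j)
    show ?case
    proof (cases "a = a0")
      case True
      have "(\<lambda>\<gamma>. \<Sum>a\<in>A - {a0}. - (f a $ j) * \<gamma> (a - a0)) \<in> monoid_combs \<sigma>"
      proof (intro monoid_combs_sum)
        fix a assume "a \<in> A - {a0}"
        then show "(\<lambda>\<gamma>. - (f a $ j) * \<gamma> (a - a0)) \<in> monoid_combs \<sigma>"
          using A by (intro monoid_combs_single[of "a - a0" _ _ "- (f a $ j)"]) auto
      qed (use A in auto)
      moreover have "\<phi> \<gamma> a $ j = (\<Sum>a\<in>A - {a0}. - (f a $ j) * \<gamma> (a - a0))" for \<gamma>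
        using True by (simp add: \<phi>_def sum_negf mult.commute)
      ultimately show ?thesis by simp
    next
      case False
      show ?thesis
        by (rule monoid_combs_single[of 0 _ _ "f a $ j"]) (use False in \<open>auto simp: \<phi>_def chart_points_def\<close>)
    qed
  qed (auto intro: monoid_combs_add monoid_combs_mult)
  moreover have "p (\<phi> (torus_char z)) = 0" for z
  proof (rule p(2))
    have "(\<Sum>a\<in>A. torus_char z a *s \<phi> (torus_char z) a)
       = torus_char z a0 *s (\<Sum>a\<in>A. torus_char z (a - a0) *s \<phi> (torus_char z) a)"
      by (simp add: vec.scale_sum_right flip: torus_char_add)
    also have "(\<Sum>a\<in>A. torus_char z (a - a0) *s \<phi> (torus_char z) a) = 0"
      using A by (subst sum.remove[of _ a0]) (auto simp: \<phi>_def)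
    finally show "\<phi> (torus_char z) \<in> torus_locus A" unfolding torus_locus_def by auto
  qed
  ultimately have "p (\<phi> \<gamma>) = 0" using f monoid_combs_vanish by blast
  moreover have "\<phi> \<gamma> = f"
    using f A unfolding \<phi>_def
    by (subst (asm) sum.remove[of _ a0]) (auto simp: fun_eq_iff chart_points_def add_eq_0_iff2)
  ultimately show ?thesis by simp
qed

text \<open>A point of the locus is given by a torus point and the columns off \<open>a0\<close>,
  all free, and these determine the column at \<open>a0\<close>. Linear interpolation of the free
  data gives an entire curve in the locus through both given points, and on it two nonzero entire
  functions have a nonzero product.\<close>

lemma torus_locus_prime:
  fixes \<Phi> \<Psi> :: "(real^'n, 'k::finite) frame_poly poly"
  assumes A: "finite A" "a0 \<in> A"
    and 1: "(\<lambda>a. y1 a + s1 *s v a) \<in> torus_locus A" "fp_eval \<Phi> y1 s1 \<noteq> 0"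
    and 2: "(\<lambda>a. y2 a + s2 *s v a) \<in> torus_locus A" "fp_eval \<Psi> y2 s2 \<noteq> 0"
  shows "\<exists>y s. (\<lambda>a. y a + s *s v a) \<in> torus_locus A \<and> fp_eval \<Phi> y s \<noteq> 0 \<and> fp_eval \<Psi> y s \<noteq> 0"
proof -
  define z1 z2 where "z1 = (\<lambda>a. y1 a + s1 *s v a)" and "z2 = (\<lambda>a. y2 a + s2 *s v a)"
  obtain w1 w2 where w: "(\<Sum>a\<in>A. torus_char w1 a *s z1 a) = 0" "(\<Sum>a\<in>A. torus_char w2 a *s z2 a) = 0"
    using 1 2 unfolding torus_locus_def z1_def z2_def by blast
  define \<zeta> where "\<zeta> \<tau> = w1 + \<tau> *s (w2 - w1)" for \<tau>
  define F where "F \<tau> = (\<lambda>a. z1 a + \<tau> *s (z2 a - z1 a))" for \<tau>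
  \<comment> \<open>The column at \<open>a0\<close> is adjusted so that \<open>Z \<tau>\<close> has
    the zero \<open>\<zeta> \<tau>\<close>. At 0 and 1 the interpolated column already has the right
    value.\<close>
  define Z where "Z \<tau> = (F \<tau>)(a0 := - (\<Sum>a\<in>A - {a0}. torus_char (\<zeta> \<tau>) (a - a0) *s F \<tau> a))" for \<tau>
  define \<sigma> where "\<sigma> \<tau> = s1 + \<tau> * (s2 - s1)" for \<tau>
  \<comment> \<open>Removing the part in direction \<open>v\<close> leaves a base point, so that
    \<open>(\<eta> \<tau>, \<sigma> \<tau>)\<close> runs from \<open>(y1, s1)\<close> to
    \<open>(y2, s2)\<close>.\<close>
  define \<eta> where "\<eta> \<tau> = (\<lambda>a. Z \<tau> a - \<sigma> \<tau> *s v a)" for \<tau>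
  have s: "(\<Sum>a\<in>A. torus_char z a *s g a)
       = torus_char z a0 *s (g a0 + (\<Sum>a\<in>A - {a0}. torus_char z (a - a0) *s g a))" for z and g :: "real^'n \<Rightarrow> complex^'k"
  proof -
    have "(\<Sum>a\<in>A. torus_char z a *s g a) = torus_char z a0 *s (\<Sum>a\<in>A. torus_char z (a - a0) *s g a)"
      by (simp add: vec.scale_sum_right flip: torus_char_add)
    then show ?thesis using A by (simp add: sum.remove[of _ a0])
  qed
  have Z: "Z \<tau> \<in> torus_locus A" for \<tau>
    unfolding torus_locus_def by (auto simp: s Z_def intro!: exI[of _ "\<zeta> \<tau>"])
  have "z1 a0 = - (\<Sum>a\<in>A - {a0}. torus_char w1 (a - a0) *s z1 a)"
    "z2 a0 = - (\<Sum>a\<in>A - {a0}. torus_char w2 (a - a0) *s z2 a)"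
    using w unfolding s vec.scale_eq_0_iff by (simp_all add: add_eq_0_iff2)
  then have Z01: "Z 0 = z1" "Z 1 = z2"
    by (auto simp: Z_def F_def \<zeta>_def fun_eq_iff add_eq_0_iff2)
  have hch: "(\<lambda>\<tau>. torus_char (\<zeta> \<tau>) m) holomorphic_on UNIV" for m
    unfolding torus_char_def \<zeta>_def by (simp, intro holomorphic_intros)
  have hF: "(\<lambda>\<tau>. F \<tau> a $ j) holomorphic_on UNIV" for a j
    unfolding F_def by (simp, intro holomorphic_intros)
  have h\<sigma>: "\<sigma> holomorphic_on UNIV"
    unfolding \<sigma>_def by (intro holomorphic_intros)
  have "(\<lambda>\<tau>. Z \<tau> a $ j) holomorphic_on UNIV" for a j
    by (cases "a = a0") (auto simp: Z_def intro!: holomorphic_intros hF hch)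
  then have h\<eta>: "(\<lambda>\<tau>. \<eta> \<tau> a $ j) holomorphic_on UNIV" for a j
    unfolding \<eta>_def using h\<sigma> by (auto intro!: holomorphic_intros)
  have e: "\<eta> 0 = y1" "\<sigma> 0 = s1" "\<eta> 1 = y2" "\<sigma> 1 = s2"
    by (auto simp: \<eta>_def Z01 \<sigma>_def z1_def z2_def)
  have hol: "(\<lambda>\<tau>. fp_eval X (\<eta> \<tau>) (\<sigma> \<tau>)) holomorphic_on UNIV" for X :: "(real^'n, 'k) frame_poly poly"
    by (rule fp_eval_holomorphic[OF h\<eta> h\<sigma>])
  have "\<exists>\<tau>. fp_eval \<Phi> (\<eta> \<tau>) (\<sigma> \<tau>) * fp_eval \<Psi> (\<eta> \<tau>) (\<sigma> \<tau>) \<noteq> 0"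
    using holomorphic_mult_eq_0[OF hol[of \<Phi>] hol[of \<Psi>], where ?z1.0 = 0 and ?z2.0 = 1] 1(2) 2(2)
    unfolding e by blast
  then obtain \<tau> where "fp_eval \<Phi> (\<eta> \<tau>) (\<sigma> \<tau>) \<noteq> 0 \<and> fp_eval \<Psi> (\<eta> \<tau>) (\<sigma> \<tau>) \<noteq> 0"
    by auto
  moreover have "(\<lambda>a. \<eta> \<tau> a + \<sigma> \<tau> *s v a) \<in> torus_locus A"
    using Z[of \<tau>] by (simp add: \<eta>_def)
  ultimately show ?thesis by blast
qed

section \<open>Lines that contain only surjective maps\<close>

definition minor :: "('k::finite \<Rightarrow> 'a) \<Rightarrow> ('a \<Rightarrow> complex^'k) \<Rightarrow> complex" where
  "minor \<beta> f = det (\<chi> j k. f (\<beta> k) $ j)"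

lemma minor_frame_polys: "minor (\<beta> :: 'k::finite \<Rightarrow> 'a) \<in> frame_polys UNIV"
proof -
  have "(\<lambda>f. of_int (sign p) * (\<Prod>i\<in>UNIV. f (\<beta> (p i)) $ i)) \<in> frame_polys UNIV" for p
    by (intro frame_polys.mult frame_polys.const frame_polys_prod frame_polys.coord UNIV_I)
  then have "(\<lambda>f. \<Sum>p\<in>{p. p permutes (UNIV::'k set)}. of_int (sign p) * (\<Prod>i\<in>UNIV. f (\<beta> (p i)) $ i))
     \<in> frame_polys UNIV"
    by (intro frame_polys_sum)
  moreover have "minor \<beta> = (\<lambda>f. \<Sum>p\<in>{p. p permutes UNIV}. of_int (sign p) * (\<Prod>i\<in>UNIV. f (\<beta> (p i)) $ i))"
    by (simp add: minor_def[abs_def] det_def)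
  ultimately show ?thesis by simp
qed

lemma minor_frames:
  fixes f :: "'a \<Rightarrow> complex^'k"
  assumes "finite A" "inj \<beta>" "range \<beta> \<subseteq> A" "minor \<beta> f \<noteq> 0"
  shows "f \<in> frames A"
  unfolding frames_def
proof safe
  fix x :: "complex^'k"
  define M where "M = (\<chi> j k. f (\<beta> k) $ j)"
  have "invertible M" using assms(4) by (simp add: M_def minor_def invertible_det_nz)
  then obtain c where c: "M *v c = x"
    by (metis invertible_def matrix_vector_mul_assoc matrix_vector_mul_lid)
  define X where "X a = (if a \<in> range \<beta> then c $ inv \<beta> a else 0)" for a
  have "X \<in> coord_space A" using assms(3) by (auto simp: X_def coord_space_def)
  moreover have "lin_map A f X = x"
  proof -
    have "lin_map A f X = (\<Sum>a\<in>range \<beta>. X a *s f a)"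
      unfolding lin_map_def using assms by (intro sum.mono_neutral_right) (auto simp: X_def)
    also have "\<dots> = (\<Sum>k\<in>UNIV. c $ k *s f (\<beta> k))"
      using assms(2) by (subst sum.reindex) (auto simp: X_def)
    also have "\<dots> = M *v c"
      by (simp add: vec_eq_iff matrix_vector_mult_def M_def mult.commute)
    finally show ?thesis using c by simp
  qed
  ultimately show "x \<in> lin_map A f ` coord_space A" by blast
qed auto

lemma minor_nonzero:
  fixes \<beta> :: "'k::finite \<Rightarrow> 'a"
  assumes "inj \<beta>"
  shows "minor \<beta> (\<lambda>a. axis (inv \<beta> a) 1) \<noteq> 0"
proof -
  have "(\<chi> j k. (axis (inv \<beta> (\<beta> k)) 1 :: complex^'k) $ j) = mat 1"
    using assms by (auto simp: vec_eq_iff axis_def mat_def)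
  then show ?thesis by (simp add: minor_def)
qed

lemma frame_polys_prod_nonzero:
  fixes p :: "'i \<Rightarrow> ('a \<Rightarrow> complex^'k::finite) \<Rightarrow> complex"
  assumes "finite I" "\<And>i. i \<in> I \<Longrightarrow> p i \<in> frame_polys A" "\<And>i. i \<in> I \<Longrightarrow> \<exists>f. p i f \<noteq> 0"
  shows "\<exists>f. \<forall>i\<in>I. p i f \<noteq> 0"
  using assms
proof (induction I rule: finite_induct)
  case (insert i I)
  then obtain f g where f: "p i f \<noteq> 0" "(\<Prod>i\<in>I. p i g) \<noteq> 0"
    by (metis insert_iff prod_zero_iff)
  have "p i \<in> frame_polys A" "(\<lambda>f. \<Prod>i\<in>I. p i f) \<in> frame_polys A"
    using insert by (auto intro!: frame_polys_prod)
  from frame_polys_no_zero_divisors[OF this f] insert(1) show ?case by auto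
qed auto

text \<open>A resultant also vanishes at the maps that are not surjective, where the corresponding
  linear system need not be related to the variety. They have codimension at least 2, so a generic
  line in the direction \<open>v\<close> contains none of them: two disjoint minors have no common zero on it.\<close>

lemma avoid_non_frames:
  fixes v :: "'a \<Rightarrow> complex^'k"
  assumes A: "finite A" "2 * CARD('k) \<le> card A"
    and E: "E \<in> frame_polys UNIV" "E y0 \<noteq> 0"
  shows "\<exists>y. E y \<noteq> 0 \<and> (\<forall>s. (\<lambda>a. y a + s *s v a) \<in> frames A)"
proof -
  obtain B1 where B1: "B1 \<subseteq> A" "card B1 = CARD('k)" 
    using A by (metis add_leD1 mult_2 obtain_subset_with_card_n)
  have fB1: "finite B1" using A B1 finite_subset by blast
  have "CARD('k) \<le> card (A - B1)" using A B1 fB1 by (simp add: card_Diff_subset)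
  then obtain B2 where B2: "B2 \<subseteq> A - B1" "card B2 = CARD('k)" 
    by (metis obtain_subset_with_card_n)
  have fB2: "finite B2" using A B2 finite_subset by (metis finite_Diff)
  obtain \<beta>1 :: "'k \<Rightarrow> 'a" where b1: "bij_betw \<beta>1 UNIV B1" 
    using finite_same_card_bij[of "UNIV::'k set" B1] fB1 B1 by auto
  obtain \<beta>2 :: "'k \<Rightarrow> 'a" where b2: "bij_betw \<beta>2 UNIV B2" 
    using finite_same_card_bij[of "UNIV::'k set" B2] fB2 B2 by auto
  have i: "inj \<beta>1" "inj \<beta>2" "range \<beta>1 = B1" "range \<beta>2 = B2"
    using b1 b2 by (auto simp: bij_betw_def)
  obtain y1 where y1: "E y1 \<noteq> 0" "minor \<beta>1 y1 \<noteq> 0"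
    using frame_polys_no_zero_divisors[OF E(1) minor_frame_polys E(2) minor_nonzero[OF i(1)]] by auto
  obtain \<Phi> where \<Phi>: "\<And>y s. fp_eval \<Phi> y s = minor \<beta>1 (\<lambda>a. y a + s *s v a)"
    using fp_line[OF minor_frame_polys] by blast
  define \<pi> where "\<pi> = map_poly (\<lambda>c. Rep_frame_poly c y1) \<Phi>"
  have \<pi>: "poly \<pi> s = minor \<beta>1 (\<lambda>a. y1 a + s *s v a)" for s
    by (simp add: \<pi>_def fp_eval_map_poly[symmetric] \<Phi>)
  have "poly \<pi> 0 \<noteq> 0" using y1 by (simp add: \<pi>)
  then have fin: "finite {s. poly \<pi> s = 0}" by (metis poly_0 poly_roots_finite)
  \<comment> \<open>On the line through \<open>y1\<close> the first minor vanishes at finitely many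
    parameters only. Changing just the columns in \<open>B2\<close> keeps it as it is, and leaves
    room to make the second minor nonzero at these parameters.\<close>
  define \<eta> where "\<eta> h = (\<lambda>a. y1 a + (if a \<in> B2 then h a else 0))" for h :: "'a \<Rightarrow> complex^'k"
  have poly\<eta>: "(\<lambda>h. p (\<lambda>a. \<eta> h a + s *s v a)) \<in> frame_polys UNIV" if "p \<in> frame_polys UNIV" for p s
  proof (rule frame_polys_compose[OF that])
    fix a j
    show "(\<lambda>h. (\<eta> h a + s *s v a) $ j) \<in> frame_polys UNIV"
      by (cases "a \<in> B2") (auto simp: \<eta>_def intro!: frame_polys.intros)
  qed
  define I where "I = insert None (Some ` {s. poly \<pi> s = 0})"
  define q where "q i = (case i of None \<Rightarrow> (\<lambda>h. E (\<eta> h)) |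
     Some s \<Rightarrow> (\<lambda>h. minor \<beta>2 (\<lambda>a. \<eta> h a + s *s v a)))" for i
  have "\<exists>h. \<forall>i\<in>I. q i h \<noteq> 0"
  proof (rule frame_polys_prod_nonzero)
    show "finite I" using fin by (simp add: I_def)
    show "q i \<in> frame_polys UNIV" if "i \<in> I" for i
      using poly\<eta>[OF E(1), of 0] poly\<eta>[OF minor_frame_polys] by (auto simp: q_def split: option.split)
    show "\<exists>h. q i h \<noteq> 0" for i
    proof (cases i)
      case None
      then show ?thesis using y1 by (auto simp: q_def \<eta>_def intro!: exI[of _ "\<lambda>_. 0"])
    next
      case (Some s)
      \<comment> \<open>At the parameter \<open>s\<close> this choice turns the columns in
        \<open>B2\<close> into the standard basis.\<close>
      let ?h = "\<lambda>a. axis (inv \<beta>2 a) 1 - y1 a - s *s v a"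
      have "minor \<beta>2 (\<lambda>a. \<eta> ?h a + s *s v a) = minor \<beta>2 (\<lambda>a. axis (inv \<beta>2 a) 1)"
        unfolding minor_def \<eta>_def using i(4) by (auto intro!: arg_cong[of _ _ det] simp: vec_eq_iff)
      then show ?thesis using Some minor_nonzero[OF i(2)] by (auto simp: q_def intro!: exI[of _ ?h])
    qed
  qed
  then obtain h where h: "\<And>i. i \<in> I \<Longrightarrow> q i h \<noteq> 0" by blast
  have "(\<lambda>a. \<eta> h a + s *s v a) \<in> frames A" for s
  proof (cases "poly \<pi> s = 0")
    case True
    then have "minor \<beta>2 (\<lambda>a. \<eta> h a + s *s v a) \<noteq> 0" using h[of "Some s"] by (auto simp: q_def I_def)
    then show ?thesis using minor_frames[OF A(1) i(2)] i B2 by blast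
  next
    case False
    have "\<beta>1 k \<notin> B2" for k using i(3) B2 by blast
    then have "minor \<beta>1 (\<lambda>a. \<eta> h a + s *s v a) = poly \<pi> s"
      unfolding \<pi> minor_def \<eta>_def by simp
    then show ?thesis using minor_frames[OF A(1) i(1)] i B1 False by simp
  qed
  moreover have "E (\<eta> h) \<noteq> 0" using h[of None] by (auto simp: q_def I_def)
  ultimately show ?thesis by blast
qed

section \<open>Forms with the same zero locus have proportional powers\<close>

lemma fundamental_theorem_of_algebra_degree:
  assumes "degree (p :: complex poly) \<noteq> 0"
  shows "\<exists>z. poly p z = 0"
  using assms fundamental_theorem_of_algebra[of p] by (auto simp: constant_degree)

lemma frame_poly_line_limit:
  fixes P :: "('a \<Rightarrow> complex^'k::finite) \<Rightarrow> complex"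
  assumes "P \<in> frame_polys UNIV"
  shows "((\<lambda>h. P (\<lambda>a. v a + h *s y a)) \<longlongrightarrow> P v) (at 0)"
proof -
  obtain \<Phi> where \<Phi>: "\<And>v s. fp_eval \<Phi> v s = P (\<lambda>a. v a + s *s y a)"
    using fp_line[OF assms] by blast
  have "isCont (\<lambda>h. P (\<lambda>a. v a + h *s y a)) 0"
    unfolding \<Phi>[symmetric] fp_eval_map_poly by (intro continuous_intros)
  then show ?thesis by (simp add: isCont_def)
qed

text \<open>The substitution \<open>s = 1 / h\<close> moves the behaviour at infinity of the line
  \<open>y + s v\<close> to \<open>h = 0\<close>, where \<open>P v\<close> appears as the
  coefficient of \<open>s ^ D\<close>.\<close>

lemma homogeneous_line:
  fixes P :: "('a \<Rightarrow> complex^'k::finite) \<Rightarrow> complex"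
  assumes "\<And>c f. P (\<lambda>a. c *s f a) = c ^ D * P f" "h \<noteq> 0"
  shows "P (\<lambda>a. v a + h *s y a) = h ^ D * P (\<lambda>a. y a + inverse h *s v a)"
  using assms(2) by (simp add: assms(1)[symmetric] vec.scale_right_distrib add.commute)

text \<open>Along the line \<open>P\<close> grows like \<open>P v * s ^ DP\<close> and
  \<open>Q\<close> like \<open>Q v * s ^ DQ\<close>, with both coefficients nonzero.\<close>

lemma homogeneous_line_degree:
  fixes P Q :: "('a \<Rightarrow> complex^'k::finite) \<Rightarrow> complex"
  assumes P: "P \<in> frame_polys UNIV" "\<And>c f. P (\<lambda>a. c *s f a) = c ^ DP * P f" "P v \<noteq> 0"
    and Q: "Q \<in> frame_polys UNIV" "\<And>c f. Q (\<lambda>a. c *s f a) = c ^ DQ * Q f" "Q v \<noteq> 0"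
    and eq: "\<And>s. \<alpha> * P (\<lambda>a. y a + s *s v a) = \<beta> * Q (\<lambda>a. y a + s *s v a)"
    and "\<alpha> \<noteq> 0" "\<beta> \<noteq> 0"
  shows "DP \<le> DQ"
proof (rule ccontr)
  assume "\<not> DP \<le> DQ"
  then obtain e where e: "DP = DQ + Suc e" by (metis add_Suc_right less_imp_Suc_add not_le)
  have "\<alpha> * P (\<lambda>a. v a + h *s y a) = h ^ Suc e * \<beta> * Q (\<lambda>a. v a + h *s y a)" if "h \<noteq> 0" for h
    using eq[of "inverse h"]
      homogeneous_line[of P, OF P(2) that, of v y] homogeneous_line[of Q, OF Q(2) that, of v y]
    by (simp add: e power_add)
  then have ev: "\<forall>\<^sub>F h in at 0. \<alpha> * P (\<lambda>a. v a + h *s y a) = h ^ Suc e * \<beta> * Q (\<lambda>a. v a + h *s y a)"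
    by (simp add: eventually_at_filter)
  have l1: "((\<lambda>h. \<alpha> * P (\<lambda>a. v a + h *s y a)) \<longlongrightarrow> \<alpha> * P v) (at 0)"
    by (intro tendsto_intros frame_poly_line_limit P)
  have l2: "((\<lambda>h. h ^ Suc e * \<beta> * Q (\<lambda>a. v a + h *s y a)) \<longlongrightarrow> 0 ^ Suc e * \<beta> * Q v) (at 0)"
    by (intro tendsto_intros frame_poly_line_limit Q)
  have "\<alpha> * P v = 0"
    using LIM_unique[OF Lim_transform_eventually[OF l1 ev] l2] by simp
  then show False using assms by simp
qed

lemma homogeneous_line_lead:
  fixes P Q :: "('a \<Rightarrow> complex^'k::finite) \<Rightarrow> complex"
  assumes P: "P \<in> frame_polys UNIV" "\<And>c f. P (\<lambda>a. c *s f a) = c ^ D * P f"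
    and Q: "Q \<in> frame_polys UNIV" "\<And>c f. Q (\<lambda>a. c *s f a) = c ^ D * Q f"
    and eq: "\<And>s. \<alpha> * P (\<lambda>a. y a + s *s v a) = \<beta> * Q (\<lambda>a. y a + s *s v a)"
  shows "\<alpha> * P v = \<beta> * Q v"
proof -
  have "\<alpha> * P (\<lambda>a. v a + h *s y a) = \<beta> * Q (\<lambda>a. v a + h *s y a)" if "h \<noteq> 0" for h
    using eq[of "inverse h"]
      homogeneous_line[of P, OF P(2) that, of v y] homogeneous_line[of Q, OF Q(2) that, of v y]
    by simp
  then have ev: "\<forall>\<^sub>F h in at 0. \<alpha> * P (\<lambda>a. v a + h *s y a) = \<beta> * Q (\<lambda>a. v a + h *s y a)"
    by (simp add: eventually_at_filter)
  have l1: "((\<lambda>h. \<alpha> * P (\<lambda>a. v a + h *s y a)) \<longlongrightarrow> \<alpha> * P v) (at 0)"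
    by (intro tendsto_intros frame_poly_line_limit P)
  have l2: "((\<lambda>h. \<beta> * Q (\<lambda>a. v a + h *s y a)) \<longlongrightarrow> \<beta> * Q v) (at 0)"
    by (intro tendsto_intros frame_poly_line_limit Q)
  show ?thesis
    by (rule LIM_unique[OF Lim_transform_eventually[OF l1 ev] l2])
qed

text \<open>Apart from the maps that are not surjective, the zero locus of such a form is the closure
  of the torus locus.\<close>

definition torus_form :: "(real^'n) set \<Rightarrow> ((real^'n \<Rightarrow> complex^'k::finite) \<Rightarrow> complex) \<Rightarrow> nat \<Rightarrow> bool" where
  "torus_form A P D \<longleftrightarrow> P \<in> frame_polys UNIV \<and> D > 0 \<and> (\<forall>c f. P (\<lambda>a. c *s f a) = c ^ D * P f) \<and>
     (\<forall>f\<in>torus_locus A. P f = 0) \<and>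
     (\<forall>f\<in>frames A. P f = 0 \<longrightarrow>
        (\<forall>p\<in>frame_polys UNIV. (\<forall>g\<in>torus_locus A. p g = 0) \<longrightarrow> p f = 0))"

text \<open>Without a root the restriction to the line would be constant, although its coefficient
  at \<open>s ^ D\<close> is \<open>P v\<close> and \<open>D\<close> is positive.\<close>

lemma torus_form_line_root:
  fixes P :: "(real^'n \<Rightarrow> complex^'k::finite) \<Rightarrow> complex"
  assumes P: "torus_form A P D" and v: "P v \<noteq> 0"
  shows "\<exists>s. P (\<lambda>a. y a + s *s v a) = 0"
proof (rule ccontr)
  assume n: "\<not> ?thesis"
  have P': "P \<in> frame_polys UNIV" "\<And>c f. P (\<lambda>a. c *s f a) = c ^ D * P f" "D > 0"
    using P by (auto simp: torus_form_def)
  obtain \<Phi> where \<Phi>: "\<And>y s. fp_eval \<Phi> y s = P (\<lambda>a. y a + s *s v a)"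
    using fp_line[OF P'(1)] by blast
  have "constant (poly (map_poly (\<lambda>c. Rep_frame_poly c y) \<Phi>))"
    using fundamental_theorem_of_algebra n by (auto simp: \<Phi>[symmetric] fp_eval_map_poly)
  then have "fp_eval \<Phi> y s = fp_eval \<Phi> y 0" for s
    unfolding fp_eval_map_poly constant_def by blast
  then have c: "P (\<lambda>a. y a + s *s v a) = P y" for s
    unfolding \<Phi> by simp
  have "D \<le> 0"
    by (rule homogeneous_line_degree[where \<alpha> = 1 and \<beta> = "P y" and Q = "\<lambda>_. 1" and P = P and y = y and v = v])
       (use P' v c n in \<open>auto intro: frame_polys.const\<close>)
  then show False using P' by simp
qed

text \<open>Over rational functions of the base point the ideal of the locus is generated by one
  polynomial in \<open>s\<close>, so each form is a power of it times a cofactor outside the ideal.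
  On a line of surjective maps a zero of the cofactor is a zero of the form, hence of the generator;
  but on a generic line the two have no common zero. So the cofactor is constant in
  \<open>s\<close>, and it remains to remove factors that depend on \<open>y\<close>.\<close>

lemma torus_forms_proportional:
  fixes P Q :: "(real^'n \<Rightarrow> complex^'k::finite) \<Rightarrow> complex"
  assumes A: "finite A" "2 * CARD('k) \<le> card A"
    and P: "torus_form A P DP" and Q: "torus_form A Q DQ"
    and v: "P v \<noteq> 0" "Q v \<noteq> 0"
  shows "\<exists>a b c. a > 0 \<and> b > 0 \<and> b * DP = a * DQ \<and> c \<noteq> 0 \<and> (\<forall>f. P f ^ b = c * Q f ^ a)"
proof -
  \<comment> \<open>Forms are expanded in a direction \<open>v\<close> in which both have constant leading coefficient. The
    elements of the ideal \<open>I\<close> are then compared with an element \<open>p\<close> of least degree.\<close>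
  define I where "I = {\<Phi> :: (real^'n, 'k) frame_poly poly.
    \<forall>y s. (\<lambda>a. y a + s *s v a) \<in> torus_locus A \<longrightarrow> fp_eval \<Phi> y s = 0}"
  have "card A > 0" using A(2) by (metis card_gt_0_iff finite less_le_trans mult_pos_pos pos2 UNIV_not_empty)
  then obtain a0 where a0: "a0 \<in> A" by (metis card_gt_0_iff ex_in_conv)
  \<comment> \<open>At fixed \<open>s\<close> an element of the ideal becomes a polynomial in the
    point \<open>f = y + s v\<close> itself, the shape in which \<open>torus_form\<close> extends
    vanishing beyond the locus.\<close>
  have shift: "(\<lambda>f. fp_eval \<Phi> (\<lambda>a. f a - s *s v a) s) \<in> frame_polys UNIV" for s and \<Phi> :: "(real^'n, 'k) frame_poly poly"
  proof (induction \<Phi>)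
    case 0
    show ?case by (simp add: frame_polys.const)
  next
    case (pCons c \<Phi>)
    have "(\<lambda>f. (f a - s *s v a) $ j) \<in> frame_polys UNIV" for a j
      using frame_polys.add[OF frame_polys.coord frame_polys.const, of a UNIV j "- (s * v a $ j)"] by simp
    then have "(\<lambda>f. Rep_frame_poly c (\<lambda>a. f a - s *s v a)) \<in> frame_polys UNIV"
      by (rule frame_polys_compose[OF Rep_frame_poly])
    then show ?case using pCons by (auto intro!: frame_polys.intros)
  qed
  have vanish: "fp_eval \<Phi> y s = 0" if F: "torus_form A F D" and \<Phi>: "\<Phi> \<in> I"
    and "F (\<lambda>a. y a + s *s v a) = 0" "(\<lambda>a. y a + s *s v a) \<in> frames A" for \<Phi> y s F D
  proof -
    have "\<forall>g\<in>torus_locus A. fp_eval \<Phi> (\<lambda>a. g a - s *s v a) s = 0"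
      using \<Phi> unfolding I_def by simp
    moreover have "p (\<lambda>a. y a + s *s v a) = 0"
      if "p \<in> frame_polys UNIV" "\<forall>g\<in>torus_locus A. p g = 0" for p
      using F \<open>F (\<lambda>a. y a + s *s v a) = 0\<close> \<open>(\<lambda>a. y a + s *s v a) \<in> frames A\<close> that
      unfolding torus_form_def by simp
    ultimately have "fp_eval \<Phi> (\<lambda>a. (y a + s *s v a) - s *s v a) s = 0"
      using shift[of \<Phi> s] by fast
    then show ?thesis by simp
  qed
  interpret prime_no_const I
  proof
    show "a \<in> I \<or> b \<in> I" if "a * b \<in> I" for a b
    proof (rule ccontr)
      assume "\<not> (a \<in> I \<or> b \<in> I)"
      then obtain y1 s1 y2 s2
        where "(\<lambda>x. y1 x + s1 *s v x) \<in> torus_locus A" "fp_eval a y1 s1 \<noteq> 0"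
          "(\<lambda>x. y2 x + s2 *s v x) \<in> torus_locus A" "fp_eval b y2 s2 \<noteq> 0"
        unfolding I_def by blast
      from torus_locus_prime[OF A(1) a0 this] that show False unfolding I_def by auto
    qed
    \<comment> \<open>A constant in the ideal vanishes at \<open>y\<close> as soon as the line
      through \<open>y\<close> consists of surjective maps, since \<open>P\<close> has a root on
      every line in direction \<open>v\<close>. Such \<open>y\<close> exist where \<open>c\<close>
      is nonzero.\<close>
    show "c = 0" if c: "[:c:] \<in> I" for c
    proof (rule ccontr)
      assume "c \<noteq> 0"
      then obtain y0 where y0: "Rep_frame_poly c y0 \<noteq> 0"
        by (metis Rep_frame_poly_inject zero_frame_poly.rep_eq ext)
      obtain y where y: "Rep_frame_poly c y \<noteq> 0" "\<And>s. (\<lambda>a. y a + s *s v a) \<in> frames A"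
        using avoid_non_frames[OF A Rep_frame_poly y0] by blast
      obtain s where "P (\<lambda>a. y a + s *s v a) = 0" using torus_form_line_root[OF P v(1)] by blast
      from vanish[OF P c this y(2)] y(1) show False by simp
    qed
  qed (auto simp: I_def)
  obtain \<Phi>P where \<Phi>P: "\<And>y s. fp_eval \<Phi>P y s = P (\<lambda>a. y a + s *s v a)"
    using fp_line P unfolding torus_form_def by blast
  obtain \<Phi>Q where \<Phi>Q: "\<And>y s. fp_eval \<Phi>Q y s = Q (\<lambda>a. y a + s *s v a)"
    using fp_line Q unfolding torus_form_def by blast
  have in_I: "\<Phi>P \<in> I" "\<Phi>Q \<in> I" using P Q by (simp_all add: I_def \<Phi>P \<Phi>Q torus_form_def)
  have nz: "\<Phi>P \<noteq> 0" "\<Phi>Q \<noteq> 0"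
    using \<Phi>P[of v 0] \<Phi>Q[of v 0] v by auto
  define p where "p = arg_min degree (\<lambda>x. x \<in> I \<and> x \<noteq> 0)"
  have p: "p \<in> I" "p \<noteq> 0" "\<And>x. x \<in> I \<Longrightarrow> x \<noteq> 0 \<Longrightarrow> degree p \<le> degree x"
    using arg_min_natI[of "\<lambda>x. x \<in> I \<and> x \<noteq> 0" \<Phi>P degree] in_I nz
      arg_min_nat_le[of "\<lambda>x. x \<in> I \<and> x \<noteq> 0" _ degree] by (auto simp: p_def)
  have power: "\<exists>c a q0. c \<noteq> 0 \<and> q0 \<noteq> 0 \<and> a > 0 \<and> smult c \<Phi> = smult q0 (p ^ a)"
    if F: "torus_form A F D" and \<Phi>: "\<Phi> \<in> I" "\<Phi> \<noteq> 0" "\<And>y s. fp_eval \<Phi> y s = F (\<lambda>a. y a + s *s v a)"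
    for F D \<Phi>
  proof -
    obtain c a q where c: "c \<noteq> 0" "a > 0" "q \<notin> I" "smult c \<Phi> = p ^ a * q"
      using factor[OF p \<Phi>(1,2)] by blast
    obtain e a' b' where e: "e \<noteq> 0" "[:e:] = a' * p + b' * q"
      using bezout[OF p c(3)] by blast
    have q0: "q \<noteq> 0" using c(3) \<open>\<Phi> \<in> I\<close> by (auto simp: I_def)
    have "degree q = 0"
    proof (rule ccontr)
      assume d: "degree q \<noteq> 0"
      \<comment> \<open>The point \<open>y\<close> is generic in three respects: \<open>c\<close>
        lets zeros of \<open>q\<close> pass to \<open>F\<close>, \<open>e\<close> gives the
        contradiction, and the leading coefficient keeps the degree of \<open>q\<close> after
        specialization.\<close>
      have "c * e * lead_coeff q \<noteq> 0" using c e q0 by simp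
      then obtain y0 where y0: "Rep_frame_poly (c * e * lead_coeff q) y0 \<noteq> 0"
        by (metis Rep_frame_poly_inject zero_frame_poly.rep_eq ext)
      obtain y where y: "Rep_frame_poly (c * e * lead_coeff q) y \<noteq> 0" "\<And>s. (\<lambda>a. y a + s *s v a) \<in> frames A"
        using avoid_non_frames[OF A Rep_frame_poly y0] by blast
      then have y': "Rep_frame_poly c y \<noteq> 0" "Rep_frame_poly e y \<noteq> 0" "Rep_frame_poly (lead_coeff q) y \<noteq> 0"
        by (auto simp: times_frame_poly.rep_eq)
      let ?q = "map_poly (\<lambda>c. Rep_frame_poly c y) q"
      have "coeff ?q (degree q) \<noteq> 0"
        using y'(3) by (simp add: coeff_map_poly zero_frame_poly.rep_eq)
      then have "degree ?q \<noteq> 0" using d le_degree by (metis le_zero_eq)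
      then obtain s where s: "fp_eval q y s = 0"
        using fundamental_theorem_of_algebra_degree[of ?q] unfolding fp_eval_map_poly by blast
      have "Rep_frame_poly c y * fp_eval \<Phi> y s = 0"
        using arg_cong[OF c(4), of "\<lambda>x. fp_eval x y s"] s by simp
      then have "F (\<lambda>a. y a + s *s v a) = 0" using y' \<Phi>(3) by simp
      from vanish[OF F p(1) this y(2)] have "fp_eval p y s = 0" .
      then have "Rep_frame_poly e y = 0"
        using arg_cong[OF e(2), of "\<lambda>x. fp_eval x y s"] s by simp
      then show False using y' by simp
    qed
    then obtain q0 where "q = [:q0:]" by (rule degree_eq_zeroE)
    then show ?thesis using c q0 by (intro exI[of _ c] exI[of _ q0] exI[of _ a]) auto
  qed
  obtain c a q where cP: "c \<noteq> 0" "q \<noteq> 0" "a > 0" "smult c \<Phi>P = smult q (p ^ a)"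
    using power[OF P in_I(1) nz(1) \<Phi>P] by (elim exE conjE)
  obtain c' b q' where cQ: "c' \<noteq> 0" "q' \<noteq> 0" "b > 0" "smult c' \<Phi>Q = smult q' (p ^ b)"
    using power[OF Q in_I(2) nz(2) \<Phi>Q] by (elim exE conjE)
  \<comment> \<open>Raising the two factorizations to the powers \<open>b\<close> and
    \<open>a\<close> equalizes the exponents of \<open>p\<close>, which can then be
    eliminated.\<close>
  define \<alpha> \<beta> where "\<alpha> = q' ^ a * c ^ b" and "\<beta> = q ^ b * c' ^ a"
  have ab: "\<alpha> \<noteq> 0" "\<beta> \<noteq> 0" using cP cQ by (auto simp: \<alpha>_def \<beta>_def)
  have "smult \<alpha> (\<Phi>P ^ b) = smult (q' ^ a) ((smult c \<Phi>P) ^ b)"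
    by (simp add: \<alpha>_def smult_power)
  also have "\<dots> = smult (q ^ b) ((smult c' \<Phi>Q) ^ a)"
    unfolding cP(4) cQ(4) by (simp add: smult_power mult.commute[of a b] mult.commute[of "q' ^ a"] flip: power_mult)
  also have "\<dots> = smult \<beta> (\<Phi>Q ^ a)"
    by (simp add: \<beta>_def smult_power)
  finally have main: "Rep_frame_poly \<alpha> y * P (\<lambda>a. y a + s *s v a) ^ b
      = Rep_frame_poly \<beta> y * Q (\<lambda>a. y a + s *s v a) ^ a" for y s
    unfolding \<Phi>P[symmetric] \<Phi>Q[symmetric] by (metis fp_eval_power fp_eval_simps(5))
  have Pb: "(\<lambda>f. P f ^ b) \<in> frame_polys UNIV" and Qa: "(\<lambda>f. Q f ^ a) \<in> frame_polys UNIV"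
    using P Q frame_polys_prod[of "{..<b}" "\<lambda>_. P"] frame_polys_prod[of "{..<a}" "\<lambda>_. Q"]
    by (auto simp: torus_form_def)
  have homP: "P (\<lambda>a. x *s f a) ^ b = x ^ (b * DP) * P f ^ b"
    and homQ: "Q (\<lambda>a. x *s f a) ^ a = x ^ (a * DQ) * Q f ^ a" for x f
    using P Q by (auto simp: torus_form_def power_mult_distrib mult.commute simp flip: power_mult)
  have vb: "P v ^ b \<noteq> 0" "Q v ^ a \<noteq> 0" using v by auto
  have deg: "b * DP = a * DQ"
  proof -
    obtain y where y: "Rep_frame_poly (\<alpha> * \<beta>) y \<noteq> 0"
      using ab by (metis Rep_frame_poly_inject zero_frame_poly.rep_eq ext no_zero_divisors)
    then have y: "Rep_frame_poly \<alpha> y \<noteq> 0" "Rep_frame_poly \<beta> y \<noteq> 0"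
      by (auto simp: times_frame_poly.rep_eq)
    show ?thesis
      using homogeneous_line_degree[OF Pb homP vb(1) Qa homQ vb(2) main y]
        homogeneous_line_degree[OF Qa homQ vb(2) Pb homP vb(1) main[symmetric] y(2,1)] by simp
  qed
  have lead: "Rep_frame_poly \<alpha> y * P v ^ b = Rep_frame_poly \<beta> y * Q v ^ a" for y
    by (rule homogeneous_line_lead[OF Pb homP Qa homQ[folded deg] main])
  \<comment> \<open>\<open>lead\<close> and \<open>main\<close> at \<open>s = 0\<close> carry the
    same two factors, so cross-multiplication eliminates them wherever both are nonzero. For
    polynomials this is enough.\<close>
  have "P f ^ b * Q v ^ a = P v ^ b * Q f ^ a" for f
  proof (rule ccontr)
    assume n: "P f ^ b * Q v ^ a \<noteq> P v ^ b * Q f ^ a"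
    define q where "q = (\<lambda>f. P f ^ b * Q v ^ a + - (P v ^ b) * Q f ^ a)"
    have "q \<in> frame_polys UNIV"
      unfolding q_def by (intro frame_polys.add frame_polys.mult Pb Qa frame_polys.const)
    moreover have "q f \<noteq> 0" using n by (simp add: q_def)
    moreover obtain y0 where "Rep_frame_poly (\<alpha> * \<beta>) y0 \<noteq> 0"
      using ab by (metis Rep_frame_poly_inject zero_frame_poly.rep_eq ext no_zero_divisors)
    ultimately obtain y where y: "Rep_frame_poly (\<alpha> * \<beta>) y * q y \<noteq> 0"
      using frame_polys_no_zero_divisors[OF Rep_frame_poly] by blast
    have m: "Rep_frame_poly \<alpha> y * P y ^ b = Rep_frame_poly \<beta> y * Q y ^ a"
      using main[of y 0] by simp
    have "Rep_frame_poly (\<alpha> * \<beta>) y * q y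
        = (Rep_frame_poly \<alpha> y * P y ^ b) * (Rep_frame_poly \<beta> y * Q v ^ a)
          - (Rep_frame_poly \<alpha> y * P v ^ b) * (Rep_frame_poly \<beta> y * Q y ^ a)"
      unfolding q_def times_frame_poly.rep_eq by (simp add: algebra_simps)
    then have "Rep_frame_poly (\<alpha> * \<beta>) y * q y = 0"
      unfolding lead m by simp
    then show False using y by simp
  qed
  then have fin: "P f ^ b = P v ^ b / Q v ^ a * Q f ^ a" for f
    using vb by (simp add: field_simps)
  have "P v ^ b / Q v ^ a \<noteq> 0" using vb by simp
  with fin show ?thesis using cP(3) cQ(3) deg by blast
qed

section \<open>Weights of resultants\<close>

lemma finite_lattice_points_bounded:
  assumes "bounded (S :: (real^'n) set)"
  shows "finite (lattice_points \<inter> S)"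
proof -
  obtain B where B: "\<And>x. x \<in> S \<Longrightarrow> norm x \<le> B" using assms bounded_iff by blast
  define T :: "real set" where "T = of_int ` {- \<lceil>B\<rceil>..\<lceil>B\<rceil>}"
  have "lattice_points \<inter> S \<subseteq> vec_lambda ` (PiE (UNIV::'n set) (\<lambda>_. T))"
  proof
    fix x assume x: "x \<in> lattice_points \<inter> S"
    have "x $ k \<in> T" for k
    proof -
      obtain z where z: "x $ k = of_int z" using x unfolding lattice_points_def by (auto elim: Ints_cases)
      have "\<bar>x $ k\<bar> \<le> B" using B[of x] component_le_norm_cart[of x k] x by auto
      then have "\<bar>z\<bar> \<le> \<lceil>B\<rceil>" using z by (simp add: abs_le_iff) linarith
      then have "z \<in> {- \<lceil>B\<rceil>..\<lceil>B\<rceil>}" by auto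
      then show ?thesis using z unfolding T_def by blast
    qed
    then show "x \<in> vec_lambda ` (PiE UNIV (\<lambda>_. T))"
      by (intro image_eqI[of _ _ "\<lambda>k. x $ k"]) auto
  qed
  moreover have "finite (PiE (UNIV::'n set) (\<lambda>_. T))"
    by (intro finite_PiE) (auto simp: T_def)
  ultimately show ?thesis using finite_subset by blast
qed

lemma lattice_points_diff: "x \<in> lattice_points \<Longrightarrow> y \<in> lattice_points \<Longrightarrow> x - y \<in> lattice_points"
  and lattice_points_scaleR: "x \<in> lattice_points \<Longrightarrow> real k *\<^sub>R x \<in> lattice_points"
  by (auto simp: lattice_points_def)

lemma lattice_polytope_compact: "lattice_polytope \<Delta> \<Longrightarrow> compact \<Delta>"
  and lattice_polytope_convex: "lattice_polytope \<Delta> \<Longrightarrow> convex \<Delta>"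
  unfolding lattice_polytope_def by (auto intro: finite_imp_compact_convex_hull)

lemma extreme_point_lattice: "lattice_polytope \<Delta> \<Longrightarrow> v extreme_point_of \<Delta> \<Longrightarrow> v \<in> lattice_points"
  unfolding lattice_polytope_def using extreme_point_of_convex_hull by blast

lemma finite_section_chars: "lattice_polytope \<Delta> \<Longrightarrow> finite (section_chars \<Delta> i)"
  unfolding section_chars_def
  by (intro finite_lattice_points_bounded bounded_scaling compact_imp_bounded lattice_polytope_compact)

lemma section_chars_vertex:
  assumes "lattice_polytope \<Delta>" "v extreme_point_of \<Delta>"
  shows "real i *\<^sub>R v \<in> section_chars \<Delta> i"
  using assms extreme_point_lattice lattice_points_scaleR
  unfolding section_chars_def extreme_point_of_def by blast

lemma section_chars_diff_vertex:
  assumes "lattice_polytope \<Delta>" "v extreme_point_of \<Delta>" "a \<in> section_chars \<Delta> i"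
  shows "a - real i *\<^sub>R v \<in> dual_cone_monoid (normal_cone \<Delta> v)"
proof -
  obtain x where x: "x \<in> \<Delta>" "a = real i *\<^sub>R x" "a \<in> lattice_points"
    using assms(3) unfolding section_chars_def by blast
  have "w \<bullet> (a - real i *\<^sub>R v) \<ge> 0" if "w \<in> normal_cone \<Delta> v" for w
    using that x(1) unfolding x(2) normal_cone_def by (auto simp: inner_diff_right mult_left_mono)
  then show ?thesis
    using x(3) assms lattice_points_diff lattice_points_scaleR extreme_point_lattice
    unfolding dual_cone_monoid_def by blast
qed

text \<open>Freed from projective points, the condition can be pulled back along maps of the variety
  by changing \<open>\<gamma>\<close> alone.\<close>

definition meets_toric :: "(real^'n) set \<Rightarrow> nat \<Rightarrow> (real^'n \<Rightarrow> complex^'k) \<Rightarrow> bool" where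
  "meets_toric \<Delta> i f \<longleftrightarrow> (\<exists>v \<gamma>. v extreme_point_of \<Delta> \<and> \<gamma> \<in> chart_points (normal_cone \<Delta> v) \<and>
     (\<Sum>a\<in>section_chars \<Delta> i. \<gamma> (a - real i *\<^sub>R v) *s f a) = 0)"

lemma lin_subspace_kodaira_image:
  assumes "lattice_polytope \<Delta>"
  shows "lin_subspace (section_chars \<Delta> i) f \<inter> kodaira_image \<Delta> i \<noteq> {} \<longleftrightarrow> meets_toric \<Delta> i f"
proof -
  define A where "A = section_chars \<Delta> i"
  have fin: "finite A" using assms by (simp add: A_def finite_section_chars)
  have key: "proj_point (\<lambda>m. if m \<in> A then \<gamma> (m - real i *\<^sub>R v) else 0) \<in> lin_subspace A f
      \<longleftrightarrow> (\<Sum>a\<in>A. \<gamma> (a - real i *\<^sub>R v) *s f a) = 0"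
    if v: "v extreme_point_of \<Delta>" and \<gamma>: "\<gamma> \<in> chart_points (normal_cone \<Delta> v)" for v \<gamma>
  proof -
    define x where "x = (\<lambda>m. if m \<in> A then \<gamma> (m - real i *\<^sub>R v) else 0)"
    \<comment> \<open>The coordinate of the trivializing character \<open>i v\<close> is
      \<open>\<gamma> 0\<close>, so the Kodaira vector is never zero.\<close>
    have "x (real i *\<^sub>R v) = 1"
      using \<gamma> section_chars_vertex[OF assms v] by (simp add: x_def A_def chart_points_def)
    then have "x \<noteq> (\<lambda>_. 0)" by (metis zero_neq_one)
    then have "x \<in> coord_space A - {\<lambda>_. 0}" by (auto simp: x_def coord_space_def)
    then have p: "proj_point x \<in> proj_space A" unfolding proj_space_def by blast
    have l: "lin_map A f (\<lambda>a. c * x a) = c *s lin_map A f x" for c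
      by (simp add: lin_map_def vec.scale_sum_right)
    have "(\<forall>y\<in>proj_point x. lin_map A f y = 0) \<longleftrightarrow> lin_map A f x = 0"
      unfolding proj_point_def by (auto simp: l intro: exI[of _ "1::complex"])
    then have "proj_point x \<in> lin_subspace A f \<longleftrightarrow> lin_map A f x = 0"
      using p by (simp add: lin_subspace_def)
    moreover have "lin_map A f x = (\<Sum>a\<in>A. \<gamma> (a - real i *\<^sub>R v) *s f a)"
      unfolding lin_map_def by (intro sum.cong) (auto simp: x_def)
    ultimately show ?thesis by (simp add: x_def)
  qed
  show ?thesis
    unfolding kodaira_image_def meets_toric_def A_def[symmetric] using key by blast
qed

lemma mat_scalar_mult: "mat c *v (x :: complex^'k) = c *s x"
  by (simp add: vec_eq_iff matrix_vector_mult_def mat_def if_distrib if_distribR cong: if_cong)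

lemma grass_sections_homogeneous:
  fixes R :: "('a \<Rightarrow> complex^'k) \<Rightarrow> complex"
  assumes "R \<in> grass_sections A d"
  shows "R (\<lambda>a. c *s f a) = c ^ (CARD('k) * d) * R f"
proof -
  have "det (mat c :: complex^'k^'k) = c ^ CARD('k)"
    by (subst det_diagonal) (auto simp: mat_def)
  moreover have "R (\<lambda>a. mat c *v f a) = det (mat c :: complex^'k^'k) ^ d * R f"
    using assms by (auto simp: grass_sections_def)
  ultimately show ?thesis by (simp add: mat_scalar_mult power_mult)
qed

text \<open>The columns of \<open>f\<close> lie in a proper subspace \<open>W\<close>. A linear map
  into \<open>W\<close> that fixes \<open>W\<close> pointwise leaves \<open>f\<close> unchanged but
  has determinant 0, and equivariance does the rest.\<close>

lemma grass_sections_non_frame: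
  fixes R :: "('a \<Rightarrow> complex^'k) \<Rightarrow> complex"
  assumes R: "R \<in> grass_sections A d" "d > 0" and A: "finite A" and f: "f \<notin> frames A"
  shows "R f = 0"
proof -
  define W where "W = lin_map A f ` coord_space A"
  have W: "vec.subspace W"
  proof (rule vec.subspaceI)
    show "0 \<in> W" unfolding W_def by (rule image_eqI[of _ _ "\<lambda>_. 0"]) (auto simp: lin_map_def coord_space_def)
    show "x + y \<in> W" if xy: "x \<in> W" "y \<in> W" for x y
    proof -
      obtain X Y where "X \<in> coord_space A" "Y \<in> coord_space A" "x = lin_map A f X" "y = lin_map A f Y"
        using xy unfolding W_def by blast
      then show ?thesis unfolding W_def
        by (intro image_eqI[of _ _ "\<lambda>a. X a + Y a"])
           (auto simp: lin_map_def coord_space_def vec.scale_left_distrib sum.distrib)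
    qed
    show "c *s x \<in> W" if xy: "x \<in> W" for c x
    proof -
      obtain X where "X \<in> coord_space A" "x = lin_map A f X"
        using xy unfolding W_def by blast
      then show ?thesis unfolding W_def
        by (intro image_eqI[of _ _ "\<lambda>a. c * X a"])
           (auto simp: lin_map_def coord_space_def vec.scale_sum_right)
    qed
  qed
  have fW: "f a \<in> W" if "a \<in> A" for a
  proof -
    have "lin_map A f (\<lambda>b. if b = a then 1 else 0) = (\<Sum>b\<in>A. if b = a then f b else 0)"
      unfolding lin_map_def by (intro sum.cong) auto
    also have "\<dots> = f a" using A that by simp
    finally show ?thesis unfolding W_def using that
      by (intro image_eqI[of _ _ "\<lambda>b. if b = a then 1 else 0"]) (auto simp: coord_space_def)
  qed
  have "W \<noteq> UNIV" using f by (simp add: W_def frames_def)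
  have "Vector_Spaces.linear (*s) (*s) (\<lambda>x :: complex^'k. x)" by (rule vec.linear_ident)
  from vec.linear_exists_left_inverse_on[OF this W] obtain g
    where g: "g ` UNIV \<subseteq> W" "Vector_Spaces.linear (*s) (*s) g" "\<And>x. x \<in> W \<Longrightarrow> g x = x"
    by (auto simp: inj_on_def)
  have mg: "matrix g *v x = g x" for x using g(2) by (rule matrix_works)
  have "\<not> surj g" using g(1) \<open>W \<noteq> UNIV\<close> by blast
  then have "\<not> invertible (matrix g)"
    by (metis invertible_right_inverse matrix_right_invertible_surjective mg ext)
  then have "det (matrix g) = 0" using invertible_det_nz by blast
  moreover have "R (\<lambda>a. matrix g *v f a) = det (matrix g) ^ d * R f"
    using R by (auto simp: grass_sections_def)
  moreover have "R (\<lambda>a. matrix g *v f a) = R f"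
    by (rule frame_polys_cong[of _ A]) (use R fW g in \<open>auto simp: grass_sections_def mg\<close>)
  ultimately show ?thesis using R(2) by (simp add: power_0_left)
qed

text \<open>For \<open>k = 1\<close> this is the translation by an element of the torus, and for \<open>\<zeta> = 0\<close> it is the
  substitution \<open>x \<mapsto> x^k\<close> in a system of Laurent polynomials.\<close>

definition dilate :: "(real^'n) set \<Rightarrow> nat \<Rightarrow> complex^'n \<Rightarrow> (real^'n \<Rightarrow> complex^'k) \<Rightarrow> real^'n \<Rightarrow> complex^'k" where
  "dilate A k \<zeta> f m = (if (1 / real k) *\<^sub>R m \<in> A then torus_char \<zeta> m *s f ((1 / real k) *\<^sub>R m) else 0)"

lemma dilate_sum:
  assumes \<Delta>: "lattice_polytope \<Delta>" and k: "k > 0"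
  shows "(\<Sum>m\<in>section_chars \<Delta> (k * i). h m *s dilate (section_chars \<Delta> i) k \<zeta> f m)
     = (\<Sum>a\<in>section_chars \<Delta> i. (h (real k *\<^sub>R a) * torus_char \<zeta> (real k *\<^sub>R a)) *s f a)"
proof -
  let ?A = "section_chars \<Delta> i"
  have sub: "(*\<^sub>R) (real k) ` ?A \<subseteq> section_chars \<Delta> (k * i)"
    using lattice_points_scaleR unfolding section_chars_def by fastforce
  have "(\<Sum>m\<in>section_chars \<Delta> (k * i). h m *s dilate ?A k \<zeta> f m)
      = (\<Sum>m\<in>(*\<^sub>R) (real k) ` ?A. h m *s dilate ?A k \<zeta> f m)"
  proof (rule sum.mono_neutral_right[OF finite_section_chars[OF \<Delta>] sub], intro ballI)
    fix m assume m: "m \<in> section_chars \<Delta> (k * i) - (*\<^sub>R) (real k) ` ?A"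
    have "m = real k *\<^sub>R ((1 / real k) *\<^sub>R m)" using k by simp
    then have "(1 / real k) *\<^sub>R m \<notin> ?A" using m by (metis DiffD2 image_eqI)
    then show "h m *s dilate ?A k \<zeta> f m = 0" by (simp add: dilate_def)
  qed
  also have "\<dots> = (\<Sum>a\<in>?A. h (real k *\<^sub>R a) *s dilate ?A k \<zeta> f (real k *\<^sub>R a))"
    using k by (subst sum.reindex) (auto simp: inj_on_def)
  also have "\<dots> = (\<Sum>a\<in>?A. (h (real k *\<^sub>R a) * torus_char \<zeta> (real k *\<^sub>R a)) *s f a)"
    using k by (intro sum.cong) (auto simp: dilate_def)
  finally show ?thesis .
qed

lemma dilate_frames:
  fixes f :: "real^'n \<Rightarrow> complex^'k"
  assumes \<Delta>: "lattice_polytope \<Delta>" and k: "k > 0" and f: "f \<in> frames (section_chars \<Delta> i)"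
  shows "dilate (section_chars \<Delta> i) k \<zeta> f \<in> frames (section_chars \<Delta> (k * i))"
  unfolding frames_def
proof safe
  fix x :: "complex^'k"
  let ?A = "section_chars \<Delta> i"
  have "x \<in> lin_map ?A f ` coord_space ?A" using f by (simp add: frames_def)
  then obtain X where X: "X \<in> coord_space ?A" "lin_map ?A f X = x" by blast
  define Y where "Y m = (if m \<in> section_chars \<Delta> (k * i) then X ((1 / real k) *\<^sub>R m) / torus_char \<zeta> m else 0)" for m
  have kA: "real k *\<^sub>R a \<in> section_chars \<Delta> (k * i)" if "a \<in> ?A" for a
    using that lattice_points_scaleR unfolding section_chars_def by fastforce
  have "lin_map (section_chars \<Delta> (k * i)) (dilate ?A k \<zeta> f) Y = lin_map ?A f X"
    unfolding lin_map_def dilate_sum[OF \<Delta> k] using kA k by (intro sum.cong) (auto simp: Y_def)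
  moreover have "Y \<in> coord_space (section_chars \<Delta> (k * i))"
    by (auto simp: coord_space_def Y_def)
  ultimately show "x \<in> lin_map (section_chars \<Delta> (k * i)) (dilate ?A k \<zeta> f) ` coord_space (section_chars \<Delta> (k * i))"
    using X by (metis image_eqI)
qed auto

lemma torus_char_scaleR: "torus_char z (c *\<^sub>R m) = torus_char (of_real c *s z) m"
  by (simp add: torus_char_def mult_ac)

lemma torus_char_minus_left: "torus_char (- z) m = inverse (torus_char z m)"
  by (simp add: torus_char_def sum_negf exp_minus)

text \<open>The k-th power map and the translation by \<open>\<zeta>\<close> extend to the charts:
  multiplication by \<open>k\<close> preserves the dual monoid, so \<open>\<gamma>'\<close> is again
  a chart point.\<close>

lemma dilate_meets:
  assumes \<Delta>: "lattice_polytope \<Delta>" and k: "k > 0"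
    and m: "meets_toric \<Delta> (k * i) (dilate (section_chars \<Delta> i) k \<zeta> f)"
  shows "meets_toric \<Delta> i f"
proof -
  let ?A = "section_chars \<Delta> i"
  obtain v \<gamma> where v: "v extreme_point_of \<Delta>" "\<gamma> \<in> chart_points (normal_cone \<Delta> v)"
    and s: "(\<Sum>a\<in>?A. (\<gamma> (real k *\<^sub>R a - real (k * i) *\<^sub>R v) * torus_char \<zeta> (real k *\<^sub>R a)) *s f a) = 0"
    using m unfolding meets_toric_def dilate_sum[OF \<Delta> k, where h = "\<lambda>m. \<gamma> (m - real (k * i) *\<^sub>R v)" for \<gamma> v] by blast
  define \<gamma>' where "\<gamma>' m = \<gamma> (real k *\<^sub>R m) * torus_char \<zeta> (real k *\<^sub>R m)" for m
  have sc: "real k *\<^sub>R m \<in> dual_cone_monoid \<sigma>" if "m \<in> dual_cone_monoid \<sigma>" for m \<sigma>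
    using that lattice_points_scaleR by (auto simp: dual_cone_monoid_def)
  have "\<gamma> (real k *\<^sub>R m + real k *\<^sub>R m') = \<gamma> (real k *\<^sub>R m) * \<gamma> (real k *\<^sub>R m')"
    if "m \<in> dual_cone_monoid (normal_cone \<Delta> v)" "m' \<in> dual_cone_monoid (normal_cone \<Delta> v)" for m m'
    using v(2) sc[OF that(1)] sc[OF that(2)] unfolding chart_points_def by blast
  then have "\<gamma>' \<in> chart_points (normal_cone \<Delta> v)"
    using v(2) by (auto simp: chart_points_def \<gamma>'_def torus_char_add scaleR_add_right)
  moreover have "(\<Sum>a\<in>?A. \<gamma>' (a - real i *\<^sub>R v) *s f a) = 0"
  proof -
    have "\<gamma>' (a - real i *\<^sub>R v) = torus_char \<zeta> (- (real k *\<^sub>R real i *\<^sub>R v)) *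
       (\<gamma> (real k *\<^sub>R a - real (k * i) *\<^sub>R v) * torus_char \<zeta> (real k *\<^sub>R a))" for a
      unfolding \<gamma>'_def by (simp add: scaleR_diff_right flip: torus_char_add)
    then have "(\<Sum>a\<in>?A. \<gamma>' (a - real i *\<^sub>R v) *s f a) = torus_char \<zeta> (- (real k *\<^sub>R real i *\<^sub>R v)) *s
       (\<Sum>a\<in>?A. (\<gamma> (real k *\<^sub>R a - real (k * i) *\<^sub>R v) * torus_char \<zeta> (real k *\<^sub>R a)) *s f a)"
      by (simp only: vec.scale_sum_right vec.scale_scale)
    then show ?thesis using s by simp
  qed
  ultimately show ?thesis unfolding meets_toric_def using v by blast
qed

text \<open>A common zero in the torus has a k-th root there, \<open>z / k\<close> in logarithmic
  coordinates; \<open>w\<close> is this root with the translation by \<open>\<zeta>\<close>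
  undone.\<close>

lemma dilate_torus_locus:
  assumes \<Delta>: "lattice_polytope \<Delta>" and k: "k > 0" and f: "f \<in> torus_locus (section_chars \<Delta> i)"
  shows "dilate (section_chars \<Delta> i) k \<zeta> f \<in> torus_locus (section_chars \<Delta> (k * i))"
proof -
  obtain z where z: "(\<Sum>a\<in>section_chars \<Delta> i. torus_char z a *s f a) = 0"
    using f unfolding torus_locus_def by blast
  define w where "w = of_real (1 / real k) *s z - \<zeta>"
  have "torus_char w (real k *\<^sub>R a) * torus_char \<zeta> (real k *\<^sub>R a) = torus_char z a" for a
    using k by (simp add: w_def flip: torus_char_add_left) (simp add: torus_char_scaleR vec.scale_scale)
  then have "(\<Sum>m\<in>section_chars \<Delta> (k * i). torus_char w m *s dilate (section_chars \<Delta> i) k \<zeta> f m) = 0"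
    unfolding dilate_sum[OF \<Delta> k] using z by simp
  then show ?thesis unfolding torus_locus_def by blast
qed

definition resultant_of_degree :: "(real^'n) set \<Rightarrow> nat \<Rightarrow> nat \<Rightarrow> ((real^'n \<Rightarrow> complex^'k::finite) \<Rightarrow> complex) \<Rightarrow> bool" where
  "resultant_of_degree \<Delta> i d R \<longleftrightarrow> d > 0 \<and> R \<in> grass_sections (section_chars \<Delta> i) d \<and>
     (\<forall>f\<in>frames (section_chars \<Delta> i). R f = 0 \<longleftrightarrow> meets_toric \<Delta> i f)"

lemma resultant_torus_locus:
  assumes \<Delta>: "lattice_polytope \<Delta>" "\<Delta> \<noteq> {}" and R: "resultant_of_degree \<Delta> i d R"
    and f: "f \<in> torus_locus (section_chars \<Delta> i)"
  shows "R f = 0"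
proof (cases "f \<in> frames (section_chars \<Delta> i)")
  case False
  then show ?thesis
    using R grass_sections_non_frame finite_section_chars[OF \<Delta>(1)] unfolding resultant_of_degree_def by blast
next
  case True
  obtain z where z: "(\<Sum>a\<in>section_chars \<Delta> i. torus_char z a *s f a) = 0"
    using f unfolding torus_locus_def by blast
  obtain v where v: "v extreme_point_of \<Delta>"
    using extreme_point_exists_convex lattice_polytope_compact lattice_polytope_convex \<Delta> by metis
  have "(\<Sum>a\<in>section_chars \<Delta> i. torus_char z (a - real i *\<^sub>R v) *s f a)
     = torus_char z (- (real i *\<^sub>R v)) *s (\<Sum>a\<in>section_chars \<Delta> i. torus_char z a *s f a)"
    by (simp add: vec.scale_sum_right flip: torus_char_add)
  then have "meets_toric \<Delta> i f"
    unfolding meets_toric_def using v z torus_char_chart_point by (intro exI[of _ v] exI[of _ "torus_char z"]) simp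
  then show ?thesis using R True unfolding resultant_of_degree_def by blast
qed

text \<open>At a frame where the pulled-back resultant is zero, the system vanishes somewhere on the
  toric variety, and there every polynomial that is zero on the torus locus is zero too. The case
  \<open>k = 1\<close> makes a resultant comparable with its translates, the case
  \<open>\<zeta> = 0\<close> with resultants of other levels.\<close>

lemma dilate_torus_form:
  fixes R :: "(real^'n \<Rightarrow> complex^'k::finite) \<Rightarrow> complex"
  assumes \<Delta>: "lattice_polytope \<Delta>" "\<Delta> \<noteq> {}" and k: "k > 0"
    and R: "resultant_of_degree \<Delta> (k * i) d R"
  shows "torus_form (section_chars \<Delta> i) (\<lambda>f. R (dilate (section_chars \<Delta> i) k \<zeta> f)) (CARD('k) * d)"
  unfolding torus_form_def
proof (intro conjI ballI allI impI)
  let ?A = "section_chars \<Delta> i"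
  have R': "d > 0" "R \<in> grass_sections (section_chars \<Delta> (k * i)) d"
    "\<And>f. f \<in> frames (section_chars \<Delta> (k * i)) \<Longrightarrow> R f = 0 \<longleftrightarrow> meets_toric \<Delta> (k * i) f"
    using R by (auto simp: resultant_of_degree_def)
  show "(\<lambda>f. R (dilate ?A k \<zeta> f)) \<in> frame_polys UNIV"
  proof (rule frame_polys_compose[of R "section_chars \<Delta> (k * i)"])
    show "R \<in> frame_polys (section_chars \<Delta> (k * i))" using R' by (simp add: grass_sections_def)
    show "(\<lambda>f. dilate ?A k \<zeta> f a $ j) \<in> frame_polys UNIV" for a j
      by (cases "(1 / real k) *\<^sub>R a \<in> ?A") (auto simp: dilate_def intro!: frame_polys.intros)
  qed
  show "0 < CARD('k) * d" using R' by simp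
  show "R (dilate ?A k \<zeta> (\<lambda>a. c *s f a)) = c ^ (CARD('k) * d) * R (dilate ?A k \<zeta> f)" for c f
  proof -
    have "dilate ?A k \<zeta> (\<lambda>a. c *s f a) = (\<lambda>m. c *s dilate ?A k \<zeta> f m)"
      by (auto simp: fun_eq_iff dilate_def vec.scale_left_commute)
    then show ?thesis using grass_sections_homogeneous[OF R'(2)] by simp
  qed
  show "R (dilate ?A k \<zeta> f) = 0" if "f \<in> torus_locus ?A" for f
    by (rule resultant_torus_locus[OF \<Delta> R dilate_torus_locus[OF \<Delta>(1) k that]])
  show "p f = 0" if f: "f \<in> frames ?A" "R (dilate ?A k \<zeta> f) = 0"
    and p: "p \<in> frame_polys UNIV" "\<forall>g\<in>torus_locus ?A. p g = 0" for f p
  proof -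
    have "meets_toric \<Delta> (k * i) (dilate ?A k \<zeta> f)"
      using R'(3) dilate_frames[OF \<Delta>(1) k f(1)] f(2) by blast
    then have "meets_toric \<Delta> i f" by (rule dilate_meets[OF \<Delta>(1) k])
    then obtain v \<gamma> where v: "v extreme_point_of \<Delta>" "\<gamma> \<in> chart_points (normal_cone \<Delta> v)"
      "(\<Sum>a\<in>?A. \<gamma> (a - real i *\<^sub>R v) *s f a) = 0"
      unfolding meets_toric_def by blast
    show ?thesis
      by (rule vanish_chart_point[OF p(1) _ finite_section_chars[OF \<Delta>(1)]
            section_chars_vertex[OF \<Delta>(1) v(1)] section_chars_diff_vertex[OF \<Delta>(1) v(1)] v(2,3)])
         (use p in auto)
  qed
qed

lemma dilate_one:
  assumes "R \<in> frame_polys A"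
  shows "R (dilate A 1 \<zeta> f) = R (\<lambda>m. torus_char \<zeta> m *s f m)"
  by (rule frame_polys_cong[OF assms]) (simp add: dilate_def)


section \<open>Growth of resultants along one-parameter subgroups\<close>

definition mean_weight :: "real^'n \<Rightarrow> (real^'n) set \<Rightarrow> real" where
  "mean_weight w A = (\<Sum>a\<in>A. w \<bullet> a) / real (card A)"

definition real_dir :: "real \<Rightarrow> real^'n \<Rightarrow> complex^'n" where
  "real_dir \<tau> w = (\<chi> k. of_real (\<tau> * w $ k))"

lemma torus_char_real_dir: "torus_char (real_dir \<tau> w) m = of_real (exp (\<tau> * (w \<bullet> m)))"
  by (simp add: torus_char_def real_dir_def inner_vec_def sum_distrib_left mult_ac exp_of_real
      flip: of_real_sum of_real_mult)

lemma closure_pointwise_limit: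
  fixes F :: "nat \<Rightarrow> 'a \<Rightarrow> 'b::topological_space"
  assumes "\<And>k. F k \<in> S" "\<And>x. (\<lambda>k. F k x) \<longlonglongrightarrow> l x"
  shows "l \<in> closure S"
proof -
  have "limitin (product_topology (\<lambda>i. euclidean) UNIV) F l sequentially"
    unfolding limitin_componentwise using assms(2) by simp
  then have "F \<longlonglongrightarrow> l" by (simp add: euclidean_product_topology)
  moreover have "F k \<in> closure S" for k by (rule subsetD[OF closure_subset assms(1)])
  ultimately show ?thesis
    using Lim_in_closed_set[OF closed_closure always_eventually sequentially_bot] by blast
qed

text \<open>\<open>R\<close> and its translate are torus forms of the same degree, so a normalized
  subgroup element \<open>T\<close> changes the modulus of \<open>R\<close> by a constant factor. A
  factor below 1 would bring the orbit to 0 on iteration; as this also applies to the inverse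
  element, the factor is 1. Undoing the normalization gives the exponent.\<close>

lemma semistable_weight:
  fixes R :: "(real^'n \<Rightarrow> complex^'k::finite) \<Rightarrow> complex"
  assumes \<Delta>: "lattice_polytope \<Delta>" "\<Delta> \<noteq> {}"
    and card: "2 * CARD('k) \<le> card (section_chars \<Delta> i)"
    and R: "resultant_of_degree \<Delta> i d R"
    and semi: "(\<lambda>_. 0) \<notin> closure (torus_orbit (section_chars \<Delta> i) R)"
  shows "cmod (R (\<lambda>m. torus_char (real_dir \<tau> w) m *s f m))
     = exp (\<tau> * real (CARD('k) * d) * mean_weight w (section_chars \<Delta> i)) * cmod (R f)"
proof -
  let ?A = "section_chars \<Delta> i"
  define D where "D = CARD('k) * d"
  define \<mu> where "\<mu> = mean_weight w ?A"
  have R': "d > 0" "R \<in> grass_sections ?A d" "R \<in> frame_polys ?A"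
    using R by (auto simp: resultant_of_degree_def grass_sections_def)
  have hom: "R (\<lambda>a. c *s f a) = c ^ D * R f" for c f
    unfolding D_def by (rule grass_sections_homogeneous[OF R'(2)])
  have fin: "finite ?A" using finite_section_chars \<Delta> by blast
  have card0: "card ?A > 0" using card by (metis finite le_less_trans less_le_trans mult_pos_pos pos2 zero_less_card_finite)
  have form: "torus_form ?A (\<lambda>f. R (\<lambda>m. torus_char \<zeta> m *s f m)) D" for \<zeta>
    using dilate_torus_form[OF \<Delta>, of 1 i d R \<zeta>] R dilate_one[OF R'(3)] by (simp add: D_def)
  have form1: "torus_form ?A R D" using form[of 0] by simp
  have "\<exists>v. R v \<noteq> 0"
  proof (rule ccontr)
    assume "\<not> ?thesis"
    then have "R = (\<lambda>_. 0)" by auto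
    then have "(\<lambda>_. 0) \<in> torus_orbit ?A R"
      unfolding torus_orbit_def by (auto intro!: exI[of _ "\<lambda>_. 1"])
    then show False using semi closure_subset by blast
  qed
  then obtain v where v: "R v \<noteq> 0" ..
  \<comment> \<open>Subtracting the mean makes the product of the diagonal entries equal to
    1.\<close>
  define T where "T \<tau> a = exp (\<tau> * (w \<bullet> a - \<mu>))" for \<tau> a
  have T_prod: "(\<Prod>a\<in>?A. T \<tau> a) = 1" for \<tau>
  proof -
    have "(\<Sum>a\<in>?A. \<tau> * (w \<bullet> a - \<mu>)) = \<tau> * ((\<Sum>a\<in>?A. w \<bullet> a) - real (card ?A) * \<mu>)"
      by (simp add: sum_subtractf flip: sum_distrib_left)
    also have "\<dots> = 0" using card0 by (simp add: \<mu>_def mean_weight_def)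
    finally show ?thesis by (simp add: T_def flip: exp_sum[OF fin])
  qed
  have ex: "\<exists>\<rho>>0. \<forall>f. cmod (R (\<lambda>a. of_real (T \<tau> a) *s f a)) = \<rho> * cmod (R f)" for \<tau>
  proof -
    define Q where "Q f = R (\<lambda>m. torus_char (real_dir \<tau> w) m *s f m)" for f
    have Qv: "Q (\<lambda>m. torus_char (- real_dir \<tau> w) m *s v m) \<noteq> 0"
      using v by (simp add: Q_def vec.scale_scale torus_char_minus_left)
    obtain v' where v': "R v' \<noteq> 0" "Q v' \<noteq> 0"
      using frame_polys_no_zero_divisors[of R UNIV Q, OF _ _ v Qv] form1 form[of "real_dir \<tau> w"]
      unfolding torus_form_def Q_def by auto
    have "torus_form ?A Q D" using form unfolding Q_def .
    from torus_forms_proportional[OF fin card form1 this v']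
    obtain a b c where abc: "a > 0" "b > 0" "b * D = a * D" "c \<noteq> 0" "\<And>f. R f ^ b = c * Q f ^ a"
      by blast
    have "D > 0" using form1 by (simp add: torus_form_def)
    then have "a = b" using abc(3) by simp
    \<comment> \<open>Equal powers determine the values only up to roots of unity, hence the passage
      to moduli.\<close>
    define \<kappa> where "\<kappa> = root b (cmod c)"
    have \<kappa>: "\<kappa> > 0" "\<kappa> ^ b = cmod c" using abc by (auto simp: \<kappa>_def)
    have "cmod (R f) = \<kappa> * cmod (Q f)" for f
    proof (rule power_eq_imp_eq_base[of _ b])
      show "cmod (R f) ^ b = (\<kappa> * cmod (Q f)) ^ b"
        using abc(5)[of f] \<kappa> \<open>a = b\<close> by (simp add: power_mult_distrib norm_mult flip: norm_power)
    qed (use \<kappa> abc in auto)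
    then have Q: "cmod (Q f) = inverse \<kappa> * cmod (R f)" for f using \<kappa> by (simp add: field_simps)
    have "R (\<lambda>a. of_real (T \<tau> a) *s f a) = of_real (exp (- \<tau> * \<mu>)) ^ D * Q f" for f
      unfolding Q_def hom[symmetric]
      by (simp add: T_def torus_char_real_dir vec.scale_scale exp_add[symmetric] algebra_simps flip: of_real_mult)
    then have "cmod (R (\<lambda>a. of_real (T \<tau> a) *s f a)) = (exp (- \<tau> * \<mu>) ^ D * inverse \<kappa>) * cmod (R f)" for f
      by (simp add: norm_mult norm_power Q)
    then show ?thesis using \<kappa> by (intro exI[of _ "exp (- \<tau> * \<mu>) ^ D * inverse \<kappa>"]) auto
  qed
  have ge: "\<rho> \<ge> 1" if \<rho>: "\<And>f. cmod (R (\<lambda>a. of_real (T \<tau> a) *s f a)) = \<rho> * cmod (R f)" "\<rho> > 0" for \<rho> \<tau>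
  proof (rule ccontr)
    assume "\<not> \<rho> \<ge> 1"
    have it: "cmod (R (\<lambda>a. of_real (T \<tau> a ^ n) *s f a)) = \<rho> ^ n * cmod (R f)" for n f
    proof (induction n arbitrary: f)
      case (Suc n)
      have "R (\<lambda>a. of_real (T \<tau> a ^ Suc n) *s f a) = R (\<lambda>a. of_real (T \<tau> a ^ n) *s (of_real (T \<tau> a) *s f a))"
        by (simp add: vec.scale_scale mult_ac)
      then show ?case using Suc[of "\<lambda>a. of_real (T \<tau> a) *s f a"] \<rho>(1)[of f] by simp
    qed simp
    have "(\<lambda>_. 0) \<in> closure (torus_orbit ?A R)"
    proof (rule closure_pointwise_limit)
      show "(\<lambda>f. R (\<lambda>a. of_real (T \<tau> a ^ n) *s f a)) \<in> torus_orbit ?A R" for n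
        unfolding torus_orbit_def
        by (intro CollectI exI[of _ "\<lambda>a. of_real (T \<tau> a ^ n)"])
           (use T_prod[of \<tau>] in \<open>auto simp: T_def simp flip: of_real_prod prod_power_distrib\<close>)
      show "(\<lambda>n. R (\<lambda>a. of_real (T \<tau> a ^ n) *s f a)) \<longlonglongrightarrow> 0" for f
      proof (rule tendsto_norm_zero_cancel)
        have "(\<lambda>n. \<rho> ^ n * cmod (R f)) \<longlonglongrightarrow> 0 * cmod (R f)"
          using \<open>\<not> \<rho> \<ge> 1\<close> \<rho>(2) by (intro tendsto_intros LIMSEQ_realpow_zero) auto
        then show "(\<lambda>n. cmod (R (\<lambda>a. of_real (T \<tau> a ^ n) *s f a))) \<longlonglongrightarrow> 0"
          by (simp only: it mult_zero_left)
      qed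
    qed
    then show False using semi by simp
  qed
  have one: "cmod (R (\<lambda>a. of_real (T \<tau> a) *s f a)) = cmod (R f)" for \<tau> f
  proof -
    obtain \<rho> where l: "\<rho> > 0" "\<And>f. cmod (R (\<lambda>a. of_real (T \<tau> a) *s f a)) = \<rho> * cmod (R f)"
      using ex[of \<tau>] by blast
    obtain \<rho>' where l': "\<rho>' > 0" "\<And>f. cmod (R (\<lambda>a. of_real (T (- \<tau>) a) *s f a)) = \<rho>' * cmod (R f)"
      using ex[of "- \<tau>"] by blast
    have "T \<tau> a * T (- \<tau>) a = 1" for a by (simp add: T_def flip: exp_add)
    then have "(\<lambda>a. of_real (T \<tau> a) *s (of_real (T (- \<tau>) a) *s v a)) = v"
      by (simp add: vec.scale_scale fun_eq_iff flip: of_real_mult)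
    then have "cmod (R v) = \<rho> * \<rho>' * cmod (R v)"
      using l(2)[of "\<lambda>a. of_real (T (- \<tau>) a) *s v a"] l'(2)[of v] by simp
    then have "\<rho> * \<rho>' = 1" using v by simp
    moreover have "\<rho> \<ge> 1" "\<rho>' \<ge> 1" using ge l l' by blast+
    ultimately have "\<rho> = 1" by (smt (verit, best) mult_le_cancel_left1)
    then show ?thesis using l by simp
  qed
  have "R (\<lambda>m. torus_char (real_dir \<tau> w) m *s f m) = of_real (exp (\<tau> * \<mu>)) ^ D * R (\<lambda>a. of_real (T \<tau> a) *s f a)"
    unfolding hom[symmetric]
    by (simp add: T_def torus_char_real_dir vec.scale_scale exp_add[symmetric] algebra_simps flip: of_real_mult)
  then have "cmod (R (\<lambda>m. torus_char (real_dir \<tau> w) m *s f m)) = exp (\<tau> * \<mu>) ^ D * cmod (R f)"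
    by (simp add: norm_mult norm_power one)
  then show ?thesis
    by (simp add: D_def \<mu>_def mult_ac flip: exp_of_nat_mult)
qed

text \<open>\<open>R\<close> and the pullback \<open>Q\<close> of \<open>R'\<close> have
  proportional powers, with exponents \<open>b\<close> and \<open>a\<close>. Let \<open>D\<close>
  and \<open>D'\<close> be their degrees as forms. Along the subgroup of \<open>w\<close> the first
  grows with weight \<open>D \<mu>\<close> and the second with weight \<open>D' \<mu>' / k\<close>;
  since \<open>b D = a D'\<close>, the degrees cancel.\<close>

lemma semistable_mean_scale:
  fixes R R' :: "(real^'n \<Rightarrow> complex^'k::finite) \<Rightarrow> complex"
  assumes \<Delta>: "lattice_polytope \<Delta>" "\<Delta> \<noteq> {}" and k: "k > 0"
    and card: "2 * CARD('k) \<le> card (section_chars \<Delta> i)" "2 * CARD('k) \<le> card (section_chars \<Delta> (k * i))"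
    and R: "resultant_of_degree \<Delta> i d R" "(\<lambda>_. 0) \<notin> closure (torus_orbit (section_chars \<Delta> i) R)"
    and R': "resultant_of_degree \<Delta> (k * i) d' R'"
      "(\<lambda>_. 0) \<notin> closure (torus_orbit (section_chars \<Delta> (k * i)) R')"
  shows "mean_weight w (section_chars \<Delta> (k * i)) = real k * mean_weight w (section_chars \<Delta> i)"
proof -
  let ?A = "section_chars \<Delta> i"
  let ?A' = "section_chars \<Delta> (k * i)"
  define Q where "Q f = R' (dilate ?A k 0 f)" for f
  have formQ: "torus_form ?A Q (CARD('k) * d')"
    unfolding Q_def by (rule dilate_torus_form[OF \<Delta> k R'(1)])
  have formR: "torus_form ?A R (CARD('k) * d)"
    using dilate_torus_form[OF \<Delta>, of 1 i d R 0] R dilate_one[of R ?A 0]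
    by (auto simp: resultant_of_degree_def grass_sections_def)
  have fin: "finite ?A" using finite_section_chars \<Delta> by blast
  have "\<exists>v. R v \<noteq> 0"
  proof (rule ccontr)
    assume "\<not> ?thesis"
    then have "R = (\<lambda>_. 0)" by auto
    then have "(\<lambda>_. 0) \<in> torus_orbit ?A R"
      unfolding torus_orbit_def by (auto intro!: exI[of _ "\<lambda>_. 1"])
    then show False using R(2) closure_subset by blast
  qed
  then obtain v where v: "R v \<noteq> 0" ..
  \<comment> \<open>Where \<open>R\<close> is nonzero the system is surjective and misses the
    variety. Both properties pass to its dilation, so \<open>Q\<close> is nonzero at the same
    point.\<close>
  have vf: "v \<in> frames ?A"
    using grass_sections_non_frame[of R ?A d] R(1) fin v by (auto simp: resultant_of_degree_def)
  then have "\<not> meets_toric \<Delta> i v" using v R(1) unfolding resultant_of_degree_def by blast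
  then have Qv: "Q v \<noteq> 0"
    using dilate_meets[OF \<Delta>(1) k] dilate_frames[OF \<Delta>(1) k vf] R'(1)
    unfolding Q_def resultant_of_degree_def by blast
  obtain a b c where abc: "a > 0" "b > 0" "b * (CARD('k) * d) = a * (CARD('k) * d')" "c \<noteq> 0"
    "\<And>f. R f ^ b = c * Q f ^ a"
    using torus_forms_proportional[OF fin card(1) formR formQ v Qv] by blast
  define \<mu> \<mu>' where "\<mu> = mean_weight w ?A" and "\<mu>' = mean_weight w ?A'"
  define f where "f = (\<lambda>m. torus_char (real_dir 1 w) m *s v m)"
  have 1: "cmod (R f) = exp (real (CARD('k) * d) * \<mu>) * cmod (R v)"
    unfolding f_def \<mu>_def using semistable_weight[OF \<Delta> card(1) R, where \<tau> = 1] by simp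
  \<comment> \<open>A character \<open>m\<close> becomes \<open>k m\<close> under dilation, so the
    subgroup is run at speed \<open>1 / k\<close>.\<close>
  have "dilate ?A k 0 f = (\<lambda>m. torus_char (real_dir (1 / real k) w) m *s dilate ?A k 0 v m)"
    by (auto simp: dilate_def f_def fun_eq_iff torus_char_real_dir)
  then have 2: "cmod (Q f) = exp (1 / real k * real (CARD('k) * d') * \<mu>') * cmod (Q v)"
    unfolding Q_def \<mu>'_def using semistable_weight[OF \<Delta> card(2) R'] by simp
  have n: "cmod (R f) ^ b = cmod c * cmod (Q f) ^ a" for f
    using abc(5)[of f] by (simp add: norm_mult flip: norm_power)
  have "exp (real (CARD('k) * d) * \<mu>) ^ b * (cmod (R v) ^ b)
      = exp (1 / real k * real (CARD('k) * d') * \<mu>') ^ a * (cmod c * cmod (Q v) ^ a)"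
    using n[of f] unfolding 1 2 by (simp add: power_mult_distrib mult_ac)
  then have "exp (real (CARD('k) * d) * \<mu>) ^ b = exp (1 / real k * real (CARD('k) * d') * \<mu>') ^ a"
    unfolding n[of v, symmetric] using v by simp
  then have "exp (real b * (real (CARD('k) * d) * \<mu>)) = exp (real a * (1 / real k * real (CARD('k) * d') * \<mu>'))"
    by (simp only: exp_of_nat_mult)
  then have "real b * (real (CARD('k) * d) * \<mu>) = real a * (1 / real k * real (CARD('k) * d') * \<mu>')"
    by simp
  then have "real (b * (CARD('k) * d)) * \<mu> = real (a * (CARD('k) * d')) * (\<mu>' / real k)"
    by (simp add: mult_ac)
  moreover have "b * (CARD('k) * d) > 0" using abc(2) R(1) by (simp add: resultant_of_degree_def)
  ultimately have "\<mu> = \<mu>' / real k" unfolding abc(3) by (metis less_numeral_extra(3) mult_left_cancel of_nat_eq_0_iff)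
  then show ?thesis using k by (simp add: \<mu>_def \<mu>'_def)
qed

text \<open>Multiples of one unit vector inside a ball already suffice. Finding lines of surjective
  maps takes \<open>2 * CARD('k)\<close> characters, enough for two disjoint minors.\<close>

lemma eventually_card_section_chars:
  assumes \<Delta>: "lattice_polytope (\<Delta> :: (real^'n) set)" "0 \<in> interior \<Delta>"
  shows "\<exists>i0. \<forall>i\<ge>i0. N \<le> card (section_chars \<Delta> i)"
proof -
  obtain e where e: "e > 0" "cball 0 e \<subseteq> \<Delta>" using \<Delta>(2) mem_interior_cball by blast
  define u :: "real^'n" where "u = axis (SOME k. True) 1"
  have "norm u = 1" by (simp add: u_def norm_axis_1)
  moreover have "u \<in> lattice_points" by (simp add: u_def axis_def lattice_points_def)
  ultimately have u: "norm u = 1" "u \<noteq> 0" "u \<in> lattice_points" by auto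
  show ?thesis
  proof (intro exI[of _ "max 1 (nat \<lceil>real N / e\<rceil>)"] allI impI)
    fix i assume "max 1 (nat \<lceil>real N / e\<rceil>) \<le> i"
    then have i: "i > 0" "real N / e \<le> real i" by linarith+
    have "(\<lambda>j. real j *\<^sub>R u) ` {..<N} \<subseteq> section_chars \<Delta> i"
    proof
      fix x assume "x \<in> (\<lambda>j. real j *\<^sub>R u) ` {..<N}"
      then obtain j where j: "j < N" "x = real j *\<^sub>R u" by auto
      have "real j \<le> e * real i" using j i e by (simp add: field_simps)
      then have "norm ((1 / real i) *\<^sub>R x) \<le> e" using i u j by (simp add: field_simps)
      then have "(1 / real i) *\<^sub>R x \<in> \<Delta>" using e by auto
      moreover have "x = real i *\<^sub>R ((1 / real i) *\<^sub>R x)" using i by simp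
      ultimately show "x \<in> section_chars \<Delta> i"
        using j u lattice_points_scaleR unfolding section_chars_def by blast
    qed
    then have "card ((\<lambda>j. real j *\<^sub>R u) ` {..<N}) \<le> card (section_chars \<Delta> i)"
      by (intro card_mono finite_section_chars \<Delta>)
    moreover have "card ((\<lambda>j. real j *\<^sub>R u) ` {..<N}) = N"
      using u by (subst card_image) (auto simp: inj_on_def)
    ultimately show "N \<le> card (section_chars \<Delta> i)" by simp
  qed
qed

text \<open>Here \<open>w\<close> is fixed and \<open>\<beta>\<close> depends on it. The levels
  \<open>i\<close> and \<open>i0\<close> are compared through their common multiple
  \<open>i * i0\<close>.\<close>

theorem chow_semistable_mean:
  fixes \<Delta> :: "(real^'n) set"
  assumes \<Delta>: "lattice_polytope \<Delta>" "0 \<in> interior \<Delta>"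
    and semi: "asymp_torus_chow_semistable \<Delta>"
  shows "\<exists>i0 \<beta>. \<forall>i\<ge>i0. (\<Sum>a\<in>section_chars \<Delta> i. w \<bullet> a) = \<beta> * real i * real (card (section_chars \<Delta> i))"
proof -
  let ?N = "2 * CARD('n option)"
  obtain i1 where i1: "\<And>i. i \<ge> i1 \<Longrightarrow> ?N \<le> card (section_chars \<Delta> i)"
    using eventually_card_section_chars[OF \<Delta>, of ?N] by blast
  obtain i2 where i2: "\<And>i. i \<ge> i2 \<Longrightarrow> torus_chow_semistable TYPE('n) (section_chars \<Delta> i) (kodaira_image \<Delta> i)"
    using semi unfolding asymp_torus_chow_semistable_def by blast
  define i0 where "i0 = max 1 (max i1 i2)"
  have ne: "\<Delta> \<noteq> {}" using \<Delta> interior_subset by blast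
  have ex: "\<exists>d (R :: (real^'n \<Rightarrow> complex^('n option)) \<Rightarrow> complex).
      resultant_of_degree \<Delta> i d R \<and> (\<lambda>_. 0) \<notin> closure (torus_orbit (section_chars \<Delta> i) R)"
    if "i \<ge> i0" for i
  proof -
    have "i \<ge> i2" using that by (simp add: i0_def)
    from i2[OF this] obtain d and R :: "(real^'n \<Rightarrow> complex^('n option)) \<Rightarrow> complex"
      where "d \<ge> 2" "R \<in> grass_sections (section_chars \<Delta> i) d"
        "\<forall>f\<in>frames (section_chars \<Delta> i).
           R f = 0 \<longleftrightarrow> lin_subspace (section_chars \<Delta> i) f \<inter> kodaira_image \<Delta> i \<noteq> {}"
        "(\<lambda>_. 0) \<notin> closure (torus_orbit (section_chars \<Delta> i) R)"
      unfolding torus_chow_semistable_def is_X_resultant_def by blast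
    then show ?thesis
      unfolding resultant_of_degree_def lin_subspace_kodaira_image[OF \<Delta>(1)]
      by (intro exI[of _ d] exI[of _ R]) simp
  qed
  have scale: "mean_weight w (section_chars \<Delta> (k * i)) = real k * mean_weight w (section_chars \<Delta> i)"
    if ik: "i \<ge> i0" "k > 0" for i k
  proof -
    have ki: "k * i \<ge> i0" using ik by (metis le_trans mult_le_mono1 mult_1 Suc_leI One_nat_def)
    obtain d and R :: "(real^'n \<Rightarrow> complex^('n option)) \<Rightarrow> complex"
      where R: "resultant_of_degree \<Delta> i d R" "(\<lambda>_. 0) \<notin> closure (torus_orbit (section_chars \<Delta> i) R)"
      using ex[OF ik(1)] by blast
    obtain d' and R' :: "(real^'n \<Rightarrow> complex^('n option)) \<Rightarrow> complex"
      where R': "resultant_of_degree \<Delta> (k * i) d' R'" "(\<lambda>_. 0) \<notin> closure (torus_orbit (section_chars \<Delta> (k * i)) R')"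
      using ex[OF ki] by blast
    show ?thesis
      by (rule semistable_mean_scale[OF \<Delta>(1) ne ik(2) _ _ R R']) (use i1 ik ki in \<open>auto simp: i0_def\<close>)
  qed
  define \<beta> where "\<beta> = mean_weight w (section_chars \<Delta> i0) / real i0"
  have "(\<Sum>a\<in>section_chars \<Delta> i. w \<bullet> a) = \<beta> * real i * real (card (section_chars \<Delta> i))"
    if i: "i \<ge> i0" for i
  proof -
    have "i0 > 0" "i > 0" using i by (auto simp: i0_def)
    have "real i * mean_weight w (section_chars \<Delta> i0) = real i0 * mean_weight w (section_chars \<Delta> i)"
      using scale[of i0 i] scale[of i i0] i \<open>i0 > 0\<close> by (simp add: mult.commute)
    then have "mean_weight w (section_chars \<Delta> i) = \<beta> * real i"
      using \<open>i0 > 0\<close> by (simp add: \<beta>_def field_simps)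
    moreover have "card (section_chars \<Delta> i) > 0"
      using i1[of i] i by (auto simp: i0_def)
    ultimately show ?thesis by (simp add: mean_weight_def field_simps)
  qed
  then show ?thesis by blast
qed

section \<open>Ding polystability from the barycenter\<close>

lemma AE_zero_on_open:
  fixes h :: "'a::euclidean_space \<Rightarrow> real"
  assumes ae: "AE x in lborel. x \<in> U \<longrightarrow> h x = 0" and U: "open U" and h: "continuous_on U h" and x: "x \<in> U"
  shows "h x = 0"
proof (rule ccontr)
  assume n: "h x \<noteq> 0"
  define W where "W = U \<inter> h -` (- {0})"
  have "open W" unfolding W_def using U h by (intro continuous_open_preimage) auto
  moreover have "x \<in> W" using n x by (simp add: W_def)
  moreover obtain N where N: "negligible N" "{x. \<not> (x \<in> U \<longrightarrow> h x = 0)} \<subseteq> N"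
    using AE_completion[OF ae] unfolding eventually_ae_filter_negligible by blast
  then have "negligible W" unfolding W_def by (auto intro: negligible_subset)
  ultimately show False using open_not_negligible by blast
qed

lemma continuous_on_Max_affine:
  assumes "finite F" "F \<noteq> {}"
  shows "continuous_on S (\<lambda>x. Max ((\<lambda>(a :: 'a::euclidean_space, b). a \<bullet> x + b) ` F))"
  using assms
proof (induction F rule: finite_ne_induct)
  case (singleton p)
  then show ?case by (cases p) (auto intro!: continuous_intros)
next
  case (insert p F)
  have "Max ((\<lambda>(a, b). a \<bullet> x + b) ` insert p F) = max (fst p \<bullet> x + snd p) (Max ((\<lambda>(a, b). a \<bullet> x + b) ` F))" for x
    using insert by (simp add: case_prod_unfold)
  then show ?case using insert by (auto intro!: continuous_intros)
qed

lemma set_integral_lebesgue_lborel: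
  fixes u :: "'a::euclidean_space \<Rightarrow> real"
  assumes S: "compact S" and v: "continuous_on S v" and eq: "\<And>x. x \<in> S \<Longrightarrow> u x = v x"
  shows "integrable lborel (\<lambda>x. indicator S x * v x)"
    "(LINT x:S|lebesgue. u x) = (\<integral>x. indicator S x * v x \<partial>lborel)"
proof -
  show int: "integrable lborel (\<lambda>x. indicator S x * v x)"
    using borel_integrable_compact[OF S v] by (simp add: indicator_scaleR_eq_if)
  have "(LINT x:S|lebesgue. u x) = (\<integral>x. indicator S x * v x \<partial>lebesgue)"
    unfolding set_lebesgue_integral_def using eq by (intro Bochner_Integration.integral_cong) (auto simp: indicator_def)
  also have "\<dots> = (\<integral>x. indicator S x * v x \<partial>lborel)"
    by (rule integral_completion) (use int in auto)
  finally show "(LINT x:S|lebesgue. u x) = (\<integral>x. indicator S x * v x \<partial>lborel)" .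
qed

text \<open>Subtracting the affine piece that is active at the origin leaves
  \<open>h \<ge> 0\<close>, and the barycenter condition makes the Ding invariant the average of
  \<open>h\<close>. If the average is 0, then \<open>h\<close> vanishes almost everywhere, on the
  interior by continuity, and so on its closure.\<close>

lemma ding_polystable_of_barycenter:
  fixes \<Delta> :: "(real^'n) set"
  assumes \<Delta>: "compact \<Delta>" "convex \<Delta>" "0 \<in> interior \<Delta>"
    and bary: "\<And>w. (\<integral>x. indicator \<Delta> x * (w \<bullet> x) \<partial>lborel) = 0"
  shows "toric_ding_polystable \<Delta>"
  unfolding toric_ding_polystable_def
proof (intro allI impI)
  fix u assume "convex_pl_on \<Delta> u"
  then obtain F where F: "finite F" "F \<noteq> {}" "\<And>x. x \<in> \<Delta> \<Longrightarrow> u x = Max ((\<lambda>(a, b). a \<bullet> x + b) ` F)"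
    unfolding convex_pl_on_def by blast
  \<comment> \<open>The values of \<open>u\<close> are known on \<Delta> only, while the maximum is
    continuous everywhere.\<close>
  define v where "v x = Max ((\<lambda>(a, b). a \<bullet> x + b) ` F)" for x
  have cv: "continuous_on S v" for S unfolding v_def by (rule continuous_on_Max_affine[OF F(1,2)])
  have zero: "0 \<in> \<Delta>" using \<Delta>(3) interior_subset by blast
  define V where "V = measure lborel \<Delta>"
  have "\<Delta> \<in> sets borel" using \<Delta>(1) by (simp add: borel_compact)
  then have VL: "measure lebesgue \<Delta> = V" by (simp add: V_def)
  have fin: "emeasure lborel \<Delta> < \<infinity>" using \<Delta>(1) compact_imp_bounded emeasure_bounded_finite by blast
  have V: "V > 0"
  proof (rule ccontr)
    assume "\<not> V > 0"
    then have "emeasure lborel \<Delta> = 0"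
      using fin emeasure_eq_ennreal_measure[of lborel \<Delta>] by (simp add: V_def ennreal_neg not_less)
    then have "\<Delta> \<in> null_sets lborel" using \<open>\<Delta> \<in> sets borel\<close> by auto
    then have "negligible \<Delta>"
      using null_sets_completion_iff[of \<Delta> lborel] \<open>\<Delta> \<in> sets borel\<close> by (simp add: negligible_iff_null_sets)
    then have "negligible (interior \<Delta>)" using negligible_subset interior_subset by blast
    then show False using open_not_negligible[of "interior \<Delta>"] \<Delta>(3) by auto
  qed
  have aff: "integrable lborel (\<lambda>x. indicator \<Delta> x * (a \<bullet> x + b))"
    "(\<integral>x. indicator \<Delta> x * (a \<bullet> x + b) \<partial>lborel) = b * V" for a b
  proof -
    have i: "integrable lborel (\<lambda>x. indicator \<Delta> x * (a \<bullet> x))"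
      by (rule set_integral_lebesgue_lborel[OF \<Delta>(1)]) (auto intro!: continuous_intros)
    have j: "integrable lborel (\<lambda>x. indicator \<Delta> x * b)"
      by (rule set_integral_lebesgue_lborel[OF \<Delta>(1)]) (auto intro!: continuous_intros)
    show "integrable lborel (\<lambda>x. indicator \<Delta> x * (a \<bullet> x + b))"
      using Bochner_Integration.integrable_add[OF i j] by (simp add: distrib_left)
    have "(\<integral>x. indicator \<Delta> x * (a \<bullet> x + b) \<partial>lborel) = (\<integral>x. indicator \<Delta> x * (a \<bullet> x) \<partial>lborel) + (\<integral>x. indicator \<Delta> x * b \<partial>lborel)"
      using Bochner_Integration.integral_add[OF i j] by (simp add: distrib_left)
    then show "(\<integral>x. indicator \<Delta> x * (a \<bullet> x + b) \<partial>lborel) = b * V"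
      unfolding bary using fin \<open>\<Delta> \<in> sets borel\<close> by (simp add: V_def mult.commute)
  qed
  have ding: "ding_invariant \<Delta> u = - v 0 + 1 / V * (\<integral>x. indicator \<Delta> x * v x \<partial>lborel)"
    unfolding ding_invariant_def VL
    using set_integral_lebesgue_lborel(2)[OF \<Delta>(1) cv, of u] F(3) zero by (simp add: v_def)
  have vint: "integrable lborel (\<lambda>x. indicator \<Delta> x * v x)"
    using set_integral_lebesgue_lborel(1)[OF \<Delta>(1) cv, of v] by simp
  have "v 0 \<in> (\<lambda>(a, b). a \<bullet> 0 + b) ` F" unfolding v_def using F by (intro Max_in) auto
  then obtain a b where ab: "(a, b) \<in> F" "v 0 = b" by auto
  define h where "h x = v x - (a \<bullet> x + b)" for x
  have h0: "h x \<ge> 0" for x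
  proof -
    have "a \<bullet> x + b \<in> (\<lambda>(a, b). a \<bullet> x + b) ` F" using ab(1) by force
    then show ?thesis unfolding h_def v_def using F(1) by (simp add: Max_ge)
  qed
  have hint: "integrable lborel (\<lambda>x. indicator \<Delta> x * h x)"
    and hval: "(\<integral>x. indicator \<Delta> x * h x \<partial>lborel) = (\<integral>x. indicator \<Delta> x * v x \<partial>lborel) - b * V"
    unfolding h_def right_diff_distrib
    using Bochner_Integration.integrable_diff[OF vint aff(1)[of a b]]
      Bochner_Integration.integral_diff[OF vint aff(1)[of a b]] aff(2)[of a b] by auto
  have hnn: "(\<integral>x. indicator \<Delta> x * h x \<partial>lborel) \<ge> 0"
    using h0 by (intro Bochner_Integration.integral_nonneg) auto
  have ding': "ding_invariant \<Delta> u = 1 / V * (\<integral>x. indicator \<Delta> x * h x \<partial>lborel)"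
    unfolding ding hval using V ab(2) by (simp add: field_simps)
  have "affine_fun_on \<Delta> u" if "ding_invariant \<Delta> u = 0"
  proof -
    have "(\<integral>x. indicator \<Delta> x * h x \<partial>lborel) = 0" using that ding' V by simp
    then have "AE x in lborel. indicator \<Delta> x * h x = 0"
      using integral_nonneg_eq_0_iff_AE[OF hint] h0 by simp
    then have "AE x in lborel. x \<in> interior \<Delta> \<longrightarrow> h x = 0"
      by (rule eventually_mono) (use interior_subset in \<open>force simp: indicator_def\<close>)
    moreover have ch: "continuous_on S h" for S
      unfolding h_def by (intro continuous_intros cv)
    ultimately have "h x = 0" if "x \<in> interior \<Delta>" for x
      using AE_zero_on_open[of "interior \<Delta>" h x] that by blast
    then have "interior \<Delta> \<subseteq> h -` {0}" by auto
    moreover have "closed (h -` {0})" using ch[of UNIV] by (intro continuous_closed_vimage) (auto simp: continuous_on_eq_continuous_at)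
    ultimately have "closure (interior \<Delta>) \<subseteq> h -` {0}" by (rule closure_minimal)
    moreover have "\<Delta> \<subseteq> closure (interior \<Delta>)"
      using convex_closure_interior[OF \<Delta>(2)] \<Delta>(3) closure_subset by blast
    ultimately have "h x = 0" if "x \<in> \<Delta>" for x using that by blast
    then have "\<forall>x\<in>\<Delta>. u x = a \<bullet> x + b" using F(3) by (simp add: h_def v_def)
    then show ?thesis unfolding affine_fun_on_def by blast
  qed
  moreover have "ding_invariant \<Delta> u = 0" if af: "affine_fun_on \<Delta> u"
  proof -
    obtain a' b' where ab': "\<And>x. x \<in> \<Delta> \<Longrightarrow> u x = a' \<bullet> x + b'" using af unfolding affine_fun_on_def by blast
    have "(\<integral>x. indicator \<Delta> x * v x \<partial>lborel) = (\<integral>x. indicator \<Delta> x * (a' \<bullet> x + b') \<partial>lborel)"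
      using ab' F(3) by (intro Bochner_Integration.integral_cong) (auto simp: indicator_def v_def)
    moreover have "v 0 = b'" using ab'[OF zero] F(3)[OF zero] by (simp add: v_def)
    ultimately show ?thesis unfolding ding using aff(2)[of a' b'] V by simp
  qed
  moreover have "ding_invariant \<Delta> u \<ge> 0" unfolding ding' using hnn V by simp
  ultimately show "ding_invariant \<Delta> u \<ge> 0 \<and> (ding_invariant \<Delta> u = 0 \<longleftrightarrow> affine_fun_on \<Delta> u)" by blast
qed

section \<open>Riemann sums over the lattice\<close>

lemma AE_lborel_not_in:
  fixes S :: "'a::euclidean_space set"
  assumes "negligible S" "S \<in> sets borel"
  shows "AE x in lborel. x \<notin> S"
  using assms null_sets_completion_iff[of S lborel]
  by (intro AE_not_in) (simp add: negligible_iff_null_sets)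

lemma lborel_integral_reflect:
  fixes f :: "'a::euclidean_space \<Rightarrow> real"
  assumes [measurable]: "f \<in> borel_measurable borel"
  shows "(\<integral>x. f (t - x) \<partial>lborel) = (\<integral>x. f x \<partial>lborel)"
proof -
  have "lborel = distr lborel borel (\<lambda>x. t - x)"
    using lborel_affine[of "-1" t] by (simp add: density_1)
  then have "(\<integral>x. f x \<partial>lborel) = (\<integral>x. f x \<partial>distr lborel borel (\<lambda>x. t - x))" by simp
  also have "\<dots> = (\<integral>x. f (t - x) \<partial>lborel)"
    by (rule integral_distr) auto
  finally show ?thesis ..
qed

text \<open>Cubes of side \<open>1 / L\<close> around the sample points \<open>m / L\<close>:
  half-open, so that they tile the space, and centred, so that reflection in the sample point
  preserves them up to a null set.\<close>

definition cell :: "nat \<Rightarrow> real^'n \<Rightarrow> (real^'n) set" where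
  "cell L m = {x. \<forall>k. m $ k - 1 / 2 \<le> real L * x $ k \<and> real L * x $ k < m $ k + 1 / 2}"

definition round_to_lattice :: "nat \<Rightarrow> real^'n \<Rightarrow> real^'n" where
  "round_to_lattice L x = (\<chi> k. of_int \<lfloor>real L * x $ k + 1 / 2\<rfloor>)"

lemma round_to_lattice: "round_to_lattice L x \<in> lattice_points"
  by (simp add: round_to_lattice_def lattice_points_def)

lemma cell_iff: "m \<in> lattice_points \<Longrightarrow> x \<in> cell L m \<longleftrightarrow> round_to_lattice L x = m"
proof -
  assume m: "m \<in> lattice_points"
  have "m $ k - 1 / 2 \<le> real L * x $ k \<and> real L * x $ k < m $ k + 1 / 2 \<longleftrightarrow>
     of_int \<lfloor>real L * x $ k + 1 / 2\<rfloor> = m $ k" for k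
  proof -
    obtain z where z: "m $ k = of_int z" using m unfolding lattice_points_def by (auto elim: Ints_cases)
    have "of_int \<lfloor>real L * x $ k + 1 / 2\<rfloor> = m $ k \<longleftrightarrow> \<lfloor>real L * x $ k + 1 / 2\<rfloor> = z"
      by (simp add: z)
    also have "\<dots> \<longleftrightarrow> m $ k - 1 / 2 \<le> real L * x $ k \<and> real L * x $ k < m $ k + 1 / 2"
      unfolding floor_eq_iff z by auto
    finally show ?thesis by simp
  qed
  then show ?thesis by (simp add: cell_def round_to_lattice_def vec_eq_iff)
qed

lemma cell_dist:
  assumes "L > 0" "x \<in> cell L (m :: real^'n)"
  shows "norm (x - (1 / real L) *\<^sub>R m) \<le> real CARD('n) / real L"
proof -
  have "\<bar>(x - (1 / real L) *\<^sub>R m) $ k\<bar> \<le> 1 / real L" for k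
  proof -
    have "m $ k - 1 / 2 \<le> real L * x $ k" "real L * x $ k < m $ k + 1 / 2"
      using assms(2) by (auto simp: cell_def)
    then have "\<bar>real L * x $ k - m $ k\<bar> \<le> 1" by linarith
    then have "\<bar>real L * x $ k - m $ k\<bar> / real L \<le> 1 / real L" by (intro divide_right_mono) auto
    moreover have "(x - (1 / real L) *\<^sub>R m) $ k = (real L * x $ k - m $ k) / real L"
      using assms(1) by (simp add: field_simps)
    ultimately show ?thesis by simp
  qed
  then have "(\<Sum>k\<in>UNIV. \<bar>(x - (1 / real L) *\<^sub>R m) $ k\<bar>) \<le> real CARD('n) * (1 / real L)"
    by (intro sum_bounded_above[of UNIV, simplified]) auto
  then show ?thesis using norm_le_l1_cart[of "x - (1 / real L) *\<^sub>R m"] by simp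
qed

lemma cell_borel [measurable]: "cell L m \<in> sets borel"
proof -
  have "{x :: real^'a. m $ k - 1 / 2 \<le> real L * x $ k} \<in> sets borel" for k
    by (intro borel_closed closed_Collect_le continuous_intros)
  moreover have "{x :: real^'a. real L * x $ k < m $ k + 1 / 2} \<in> sets borel" for k
    by (intro borel_open open_Collect_less continuous_intros)
  moreover have "cell L m = (\<Inter>k. {x. m $ k - 1 / 2 \<le> real L * x $ k} \<inter> {x. real L * x $ k < m $ k + 1 / 2})"
    by (auto simp: cell_def)
  ultimately show ?thesis by (simp only:) (intro sets.countable_INT'' sets.Int; simp)
qed

lemma cell_cbox:
  fixes m :: "real^'n"
  assumes "L > 0"
  shows "cell L m \<subseteq> cbox (\<chi> k. (m $ k - 1 / 2) / real L) (\<chi> k. (m $ k + 1 / 2) / real L)"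
    and "box (\<chi> k. (m $ k - 1 / 2) / real L) (\<chi> k. (m $ k + 1 / 2) / real L) \<subseteq> cell L m"
  using assms by (auto simp: cell_def mem_box_cart field_simps less_imp_le)

lemma measure_cell:
  fixes m :: "real^'n"
  assumes "L > 0"
  shows "emeasure lborel (cell L m) = ennreal (1 / real L ^ CARD('n))"
proof -
  define l u :: "real^'n" where "l = (\<chi> k. (m $ k - 1 / 2) / real L)" and "u = (\<chi> k. (m $ k + 1 / 2) / real L)"
  have lu: "l $ k \<le> u $ k" for k using assms by (simp add: l_def u_def divide_right_mono)
  have bas: "l \<bullet> b \<le> u \<bullet> b" if "b \<in> Basis" for b
    using that lu by (auto simp: Basis_vec_def inner_axis)
  have "cbox l u \<noteq> {}" using lu by (simp add: interval_ne_empty_cart)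
  then have c: "measure lborel (cbox l u) = (\<Prod>k\<in>UNIV. u $ k - l $ k)" by (rule content_cbox_cart)
  also have "\<dots> = (\<Prod>k\<in>(UNIV::'n set). 1 / real L)"
    by (intro prod.cong) (auto simp: l_def u_def diff_divide_distrib[symmetric])
  finally have c: "measure lborel (cbox l u) = 1 / real L ^ CARD('n)" by (simp add: power_one_over)
  have e1: "emeasure lborel (cbox l u) = ennreal (1 / real L ^ CARD('n))"
    using c emeasure_eq_ennreal_measure[of lborel "cbox l u"] emeasure_lborel_cbox_finite[of l u]
    by (simp add: less_top)
  have e2: "emeasure lborel (box l u) = emeasure lborel (cbox l u)"
    using bas by (simp add: emeasure_lborel_box_eq emeasure_lborel_cbox_eq)
  have "emeasure lborel (cell L m) \<le> emeasure lborel (cbox l u)"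
    using cell_cbox[OF assms, of m] by (intro emeasure_mono) (auto simp: l_def u_def)
  moreover have "emeasure lborel (box l u) \<le> emeasure lborel (cell L m)"
    using cell_cbox[OF assms, of m] by (intro emeasure_mono) (auto simp: l_def u_def)
  ultimately show ?thesis using e1 e2 by simp
qed

lemma cell_reflect_AE:
  fixes m :: "real^'n"
  assumes "L > 0"
  shows "AE x in lborel. (2 / real L) *\<^sub>R m - x \<in> cell L m \<longleftrightarrow> x \<in> cell L m"
proof -
  define N where "N k s = {x :: real^'n. axis k 1 \<bullet> x = (m $ k + s) / real L}" for k s
  have "AE x in lborel. x \<notin> N k s" for k s
    unfolding N_def by (intro AE_lborel_not_in negligible_hyperplane borel_closed closed_hyperplane)
       (simp add: axis_eq_0_iff)
  then have "AE x in lborel. \<forall>k\<in>UNIV. x \<notin> N k (1/2) \<and> x \<notin> N k (- 1/2)"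
    by (subst AE_finite_all) auto
  then show ?thesis
  proof (eventually_elim)
    case (elim x)
    have "real L * x $ k \<noteq> m $ k + 1 / 2" "real L * x $ k \<noteq> m $ k - 1 / 2" for k
      using elim assms by (auto simp: N_def inner_axis' field_simps)
    moreover have "real L * ((2 / real L) *\<^sub>R m - x) $ k = 2 * m $ k - real L * x $ k" for k
      using assms by (simp add: algebra_simps)
    ultimately show ?case unfolding cell_def mem_Collect_eq
      by (simp only:) (smt (verit))
  qed
qed

lemma cell_sum_eq:
  assumes "finite F" "F \<subseteq> lattice_points"
  shows "(\<Sum>m\<in>F. indicator (cell L m) x * d m) = (if round_to_lattice L x \<in> F then d (round_to_lattice L x) else (0::real))"
proof -
  have "(\<Sum>m\<in>F. indicator (cell L m) x * d m) = (\<Sum>m\<in>F. if round_to_lattice L x = m then d m else 0)"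
    using assms(2) cell_iff by (intro sum.cong) (auto simp: indicator_def)
  then show ?thesis using assms(1) by simp
qed

text \<open>A point lies in a single cell, so all local errors together form one function
  \<open>h L\<close>. It is bounded, supported in a fixed ball and tends to 0 almost everywhere, and
  dominated convergence applies.\<close>

lemma cell_sum_limit:
  fixes d :: "nat \<Rightarrow> real^'n \<Rightarrow> real^'n \<Rightarrow> real"
  assumes F: "\<And>L. finite (F L)" "\<And>L. F L \<subseteq> lattice_points" "\<And>L m. m \<in> F L \<Longrightarrow> norm m \<le> real L * B"
    and meas: "\<And>L m. d L m \<in> borel_measurable borel"
    and bound: "\<And>L m x. L > 0 \<Longrightarrow> m \<in> F L \<Longrightarrow> x \<in> cell L m \<Longrightarrow> \<bar>d L m x\<bar> \<le> K"
    and lim: "AE x in lborel. \<forall>e>0. \<forall>\<^sub>F L in sequentially. \<forall>m\<in>F L. x \<in> cell L m \<longrightarrow> \<bar>d L m x\<bar> \<le> e"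
  shows "(\<lambda>L. \<Sum>m\<in>F L. \<integral>x. indicator (cell L m) x * d L m x \<partial>lborel) \<longlonglongrightarrow> 0"
proof -
  note [measurable] = meas
  let ?B = "cball 0 (B + real CARD('n)) :: (real^'n) set"
  define h where "h L x = (\<Sum>m\<in>F L. indicator (cell L m) x * d L m x)" for L x
  have integ: "integrable lborel (\<lambda>x. \<bar>K\<bar> * indicator ?B x)"
    using emeasure_bounded_finite[OF bounded_cball, of 0 "B + real CARD('n)"]
    by (intro integrable_mult_right integrable_real_indicator) auto
  have inB: "x \<in> ?B" if "L > 0" "m \<in> F L" "x \<in> cell L m" for L m x
  proof -
    have "norm x \<le> norm ((1 / real L) *\<^sub>R m) + norm (x - (1 / real L) *\<^sub>R m)"
      by (metis add.commute diff_add_cancel norm_triangle_ineq)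
    also have "norm ((1 / real L) *\<^sub>R m) \<le> B"
      using F(3)[OF that(2)] that(1) by (simp add: field_simps)
    also have "norm (x - (1 / real L) *\<^sub>R m) \<le> real CARD('n) / real L"
      by (rule cell_dist[OF that(1,3)])
    also have "\<dots> \<le> real CARD('n)" using that(1) by (simp add: field_simps)
    finally show ?thesis by simp
  qed
  have single: "norm (indicator (cell L m) x * d L m x) \<le> \<bar>K\<bar> * indicator ?B x" if "L > 0" "m \<in> F L" for L m x
    using bound[OF that, of x] inB[OF that, of x] by (auto simp: indicator_def)
  have int_single: "integrable lborel (\<lambda>x. indicator (cell L m) x * d L m x)" if "L > 0" "m \<in> F L" for L m
    by (rule Bochner_Integration.integrable_bound[OF integ]) (use single[OF that] in auto)
  have hb: "norm (h L x) \<le> \<bar>K\<bar> * indicator ?B x" if "L > 0" for L x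
    using single[OF that, of "round_to_lattice L x" x] cell_iff[OF round_to_lattice[of L x], of x L]
    unfolding h_def cell_sum_eq[OF F(1,2)] by auto
  have h0: "AE x in lborel. (\<lambda>L. h (Suc L) x) \<longlonglongrightarrow> 0"
    using lim
  proof eventually_elim
    case (elim x)
    have "\<forall>\<^sub>F L in sequentially. \<bar>h L x\<bar> \<le> e" if "e > 0" for e
      using elim[rule_format, OF that]
    proof eventually_elim
      case (elim L)
      then show ?case
        using that cell_iff[OF round_to_lattice[of L x], of x L] unfolding h_def cell_sum_eq[OF F(1,2)] by auto
    qed
    note ev = this
    have "(\<lambda>L. h L x) \<longlonglongrightarrow> 0"
    proof (rule tendstoI)
      fix e :: real assume "e > 0"
      with ev[of "e / 2"] show "\<forall>\<^sub>F L in sequentially. dist (h L x) 0 < e"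
        by (auto elim!: eventually_mono)
    qed
    then show ?case by (rule LIMSEQ_Suc)
  qed
  \<comment> \<open>The bounds hold for positive \<open>L\<close>, so the index is shifted by
    one.\<close>
  have "(\<lambda>L. \<integral>x. h (Suc L) x \<partial>lborel) \<longlonglongrightarrow> (\<integral>x. 0 \<partial>(lborel :: (real^'n) measure))"
  proof (rule integral_dominated_convergence[where w = "\<lambda>x. \<bar>K\<bar> * indicator ?B x"])
    show "(\<lambda>x. h (Suc L) x) \<in> borel_measurable lborel" for L unfolding h_def by measurable
    show "AE x in lborel. norm (h (Suc L) x) \<le> \<bar>K\<bar> * indicator ?B x" for L using hb by simp
  qed (use integ h0 in auto)
  moreover have eq: "(\<integral>x. h (Suc L) x \<partial>lborel) = (\<Sum>m\<in>F (Suc L). \<integral>x. indicator (cell (Suc L) m) x * d (Suc L) m x \<partial>lborel)" for L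
    unfolding h_def by (rule Bochner_Integration.integral_sum) (rule int_single, auto)
  ultimately have "(\<lambda>L. \<Sum>m\<in>F (Suc L). \<integral>x. indicator (cell (Suc L) m) x * d (Suc L) m x \<partial>lborel) \<longlonglongrightarrow> 0"
    by (simp only: eq Bochner_Integration.integral_zero)
  then show ?thesis by (rule LIMSEQ_imp_Suc)
qed


text \<open>The margin \<open>CARD('n)\<close> beyond the radius \<open>B\<close> retains every cell
  that meets the support, since a center is within \<open>CARD('n) / L\<close> of the points of its
  cell.\<close>

definition lattice_ball :: "real \<Rightarrow> nat \<Rightarrow> (real^'n) set" where
  "lattice_ball B L = lattice_points \<inter> cball 0 (real L * (B + real CARD('n)))"

definition riemann_sum :: "real \<Rightarrow> (real^'n \<Rightarrow> real) \<Rightarrow> nat \<Rightarrow> real" where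
  "riemann_sum B \<phi> L = (\<Sum>m\<in>lattice_ball B L. \<phi> ((1 / real L) *\<^sub>R m)) / real L ^ CARD('n)"

lemma lattice_ball:
  "finite (lattice_ball B L)" "lattice_ball B L \<subseteq> lattice_points"
  "m \<in> lattice_ball B L \<Longrightarrow> norm (m :: real^'n) \<le> real L * (B + real CARD('n))"
  by (auto simp: lattice_ball_def finite_lattice_points_bounded)

lemma round_in_lattice_ball:
  assumes "L > 0" "norm (x :: real^'n) \<le> B"
  shows "round_to_lattice L x \<in> lattice_ball B L"
proof -
  let ?m = "round_to_lattice L x"
  have "x \<in> cell L ?m" using cell_iff[OF round_to_lattice] by blast
  from cell_dist[OF assms(1) this] have d: "norm (x - (1 / real L) *\<^sub>R ?m) \<le> real CARD('n) / real L" .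
  have "real CARD('n) / real L \<le> real CARD('n)" using assms(1) by (simp add: field_simps)
  moreover have "norm ((1 / real L) *\<^sub>R ?m) \<le> norm x + norm (x - (1 / real L) *\<^sub>R ?m)"
    by (metis norm_minus_commute norm_triangle_sub)
  ultimately have "norm ((1 / real L) *\<^sub>R ?m) \<le> B + real CARD('n)" using d assms(2) by linarith
  then have "norm ?m \<le> real L * (B + real CARD('n))" using assms(1) by (simp add: field_simps)
  then show ?thesis by (simp add: lattice_ball_def round_to_lattice)
qed

lemma integrable_cell:
  fixes \<phi> :: "real^'n \<Rightarrow> real"
  assumes "L > 0" "integrable lborel \<phi>"
  shows "integrable lborel (\<lambda>x. indicator (cell L m) x * \<phi> x)"
  by (rule Bochner_Integration.integrable_bound[OF assms(2)])
     (use assms(2) in \<open>auto simp: indicator_def dest!: borel_measurable_integrable\<close>)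

lemma integral_cells:
  fixes \<phi> :: "real^'n \<Rightarrow> real"
  assumes "L > 0" and \<phi>: "integrable lborel \<phi>" "\<And>x. norm x > B \<Longrightarrow> \<phi> x = 0"
  shows "(\<integral>x. \<phi> x \<partial>lborel) = (\<Sum>m\<in>lattice_ball B L. \<integral>x. indicator (cell L m) x * \<phi> x \<partial>lborel)"
proof -
  have "\<phi> x = (\<Sum>m\<in>lattice_ball B L. indicator (cell L m) x * \<phi> x)" for x
    using cell_sum_eq[OF lattice_ball(1,2), of L x "\<lambda>_. \<phi> x" B L] round_in_lattice_ball[OF assms(1), of x B] \<phi>(2)[of x]
    by (cases "norm x \<le> B") auto
  then have "(\<integral>x. \<phi> x \<partial>lborel) = (\<integral>x. (\<Sum>m\<in>lattice_ball B L. indicator (cell L m) x * \<phi> x) \<partial>lborel)" by simp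
  also have "\<dots> = (\<Sum>m\<in>lattice_ball B L. \<integral>x. indicator (cell L m) x * \<phi> x \<partial>lborel)"
    by (rule Bochner_Integration.integral_sum) (rule integrable_cell[OF assms(1) \<phi>(1)])
  finally show ?thesis .
qed

lemma integral_cell_const:
  fixes m :: "real^'n"
  assumes "L > 0"
  shows "integrable lborel (\<lambda>x. indicator (cell L m) x * c)"
    "(\<integral>x. indicator (cell L m) x * c \<partial>lborel) = c / real L ^ CARD('n)"
proof -
  have e: "emeasure lborel (cell L m) < \<infinity>" by (simp add: measure_cell[OF assms])
  then show "integrable lborel (\<lambda>x. indicator (cell L m) x * c)"
    by (intro integrable_mult_left integrable_real_indicator) auto
  have "measure lborel (cell L m) = 1 / real L ^ CARD('n)"
    by (simp add: measure_def measure_cell[OF assms])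
  then show "(\<integral>x. indicator (cell L m) x * c \<partial>lborel) = c / real L ^ CARD('n)" by simp
qed

lemma bounded_support_integrable:
  fixes \<phi> :: "real^'n \<Rightarrow> real"
  assumes "\<phi> \<in> borel_measurable borel" "\<And>x. \<bar>\<phi> x\<bar> \<le> K" "\<And>x. norm x > B \<Longrightarrow> \<phi> x = 0"
  shows "integrable lborel \<phi>"
proof (rule Bochner_Integration.integrable_bound)
  show "integrable lborel (\<lambda>x. K * indicator (cball 0 B :: (real^'n) set) x)"
    using emeasure_bounded_finite[OF bounded_cball, of 0 B]
    by (intro integrable_mult_right integrable_real_indicator) auto
  have "norm (\<phi> x) \<le> norm (K * indicator (cball 0 B) x)" for x
    using assms(2)[of x] assms(3)[of x] by (auto simp: indicator_def)
  then show "AE x in lborel. norm (\<phi> x) \<le> norm (K * indicator (cball 0 B :: (real^'n) set) x)" by simp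
qed (use assms in auto)

lemma riemann_sum_limit:
  fixes \<phi> :: "real^'n \<Rightarrow> real"
  assumes meas: "\<phi> \<in> borel_measurable borel" and bound: "\<And>x. \<bar>\<phi> x\<bar> \<le> K"
    and supp: "\<And>x. norm x > B \<Longrightarrow> \<phi> x = 0" and cont: "AE x in lborel. isCont \<phi> x"
  shows "(riemann_sum B \<phi>) \<longlonglongrightarrow> (\<integral>x. \<phi> x \<partial>lborel)"
proof -
  have int: "integrable lborel \<phi>" by (rule bounded_support_integrable[OF meas bound supp])
  have "(\<lambda>L. \<Sum>m\<in>lattice_ball B L. \<integral>x. indicator (cell L m) x * (\<phi> x - \<phi> ((1 / real L) *\<^sub>R m)) \<partial>lborel) \<longlonglongrightarrow> 0"
  proof (rule cell_sum_limit[where B = "B + real CARD('n)" and K = "2 * K"])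
    show "\<bar>\<phi> x - \<phi> ((1 / real L) *\<^sub>R m)\<bar> \<le> 2 * K" for L m x
      using bound[of x] bound[of "(1 / real L) *\<^sub>R m"] by linarith
    show "AE x in lborel. \<forall>e>0. \<forall>\<^sub>F L in sequentially. \<forall>m\<in>lattice_ball B L. x \<in> cell L m \<longrightarrow>
       \<bar>\<phi> x - \<phi> ((1 / real L) *\<^sub>R m)\<bar> \<le> e"
      using cont
    proof (eventually_elim, intro allI impI)
      fix x :: "real^'n" and e assume c: "isCont \<phi> x" and e: "e > (0::real)"
      obtain \<delta> where \<delta>: "\<delta> > 0" "\<And>y. dist y x < \<delta> \<Longrightarrow> dist (\<phi> y) (\<phi> x) < e"
        using c e unfolding continuous_at_eps_delta by blast
      have "\<forall>\<^sub>F L in sequentially. real CARD('n) / real L < \<delta>"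
        using \<delta>(1) by real_asymp
      then show "\<forall>\<^sub>F L in sequentially. \<forall>m\<in>lattice_ball B L. x \<in> cell L m \<longrightarrow>
         \<bar>\<phi> x - \<phi> ((1 / real L) *\<^sub>R m)\<bar> \<le> e"
        using eventually_gt_at_top[of 0]
      proof (eventually_elim, intro ballI impI)
        fix L m assume L: "real CARD('n) / real L < \<delta>" "0 < L" "x \<in> cell L m"
        have "dist ((1 / real L) *\<^sub>R m) x < \<delta>"
          using cell_dist[OF L(2,3)] L(1) by (simp add: dist_norm norm_minus_commute)
        from \<delta>(2)[OF this] show "\<bar>\<phi> x - \<phi> ((1 / real L) *\<^sub>R m)\<bar> \<le> e"
          by (simp add: dist_real_def)
      qed
    qed
  qed (use meas lattice_ball(1,3) lattice_ball(2)[THEN subsetD] in auto)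
  moreover have "(\<Sum>m\<in>lattice_ball B L. \<integral>x. indicator (cell L m) x * (\<phi> x - \<phi> ((1 / real L) *\<^sub>R m)) \<partial>lborel)
     = (\<integral>x. \<phi> x \<partial>lborel) - riemann_sum B \<phi> L" if "L > 0" for L
  proof -
    have "(\<integral>x. indicator (cell L m) x * (\<phi> x - \<phi> ((1 / real L) *\<^sub>R m)) \<partial>lborel)
      = (\<integral>x. indicator (cell L m) x * \<phi> x \<partial>lborel) - \<phi> ((1 / real L) *\<^sub>R m) / real L ^ CARD('n)" for m
      unfolding right_diff_distrib
      by (subst Bochner_Integration.integral_diff[OF integrable_cell[OF that int] integral_cell_const(1)[OF that]])
         (simp only: integral_cell_const(2)[OF that])
    then show ?thesis
      by (simp add: sum_subtractf integral_cells[OF that int supp] riemann_sum_def sum_divide_distrib)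
  qed
  ultimately have "(\<lambda>L. (\<integral>x. \<phi> x \<partial>lborel) - riemann_sum B \<phi> L) \<longlonglongrightarrow> 0"
    by (rule Lim_transform_eventually[OF _ eventually_mono[OF eventually_gt_at_top[of 0]]]) auto
  from tendsto_diff[OF tendsto_const[of "\<integral>x. \<phi> x \<partial>lborel"] this] show ?thesis by simp
qed

text \<open>Averaging each cell with its reflection in the center replaces the first differences of
  \<open>\<phi>\<close> by second differences, which are small away from the kinks of \<open>\<phi>\<close>.\<close>

lemma riemann_sum_error:
  fixes \<phi> :: "real^'n \<Rightarrow> real"
  assumes lip: "\<And>x y. \<bar>\<phi> x - \<phi> y\<bar> \<le> K * norm (x - y)"
    and supp: "\<And>x. norm x > B \<Longrightarrow> \<phi> x = 0"
    and second: "AE x in lborel. \<exists>\<delta>>0. \<exists>M. \<forall>c y. c + y \<in> ball x \<delta> \<longrightarrow> c - y \<in> ball x \<delta> \<longrightarrow>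
       \<bar>\<phi> (c + y) + \<phi> (c - y) - 2 * \<phi> c\<bar> \<le> M * (norm y)\<^sup>2"
  shows "(\<lambda>L. real L * (riemann_sum B \<phi> L - (\<integral>x. \<phi> x \<partial>lborel))) \<longlonglongrightarrow> 0"
proof -
  have "continuous_on UNIV \<phi>"
  proof (rule continuous_on_eq_continuous_at[THEN iffD2, OF open_UNIV], intro ballI)
    fix x :: "real^'n"
    have "((\<lambda>y. K * norm (y - x)) \<longlongrightarrow> K * norm (x - x)) (at x)" by (intro tendsto_intros)
    then have "((\<lambda>y. \<phi> y - \<phi> x) \<longlongrightarrow> 0) (at x)"
      by (intro Lim_null_comparison[of "\<lambda>y. \<phi> y - \<phi> x" "\<lambda>y. K * norm (y - x)"]) (use lip in auto)
    then show "isCont \<phi> x" unfolding isCont_def by (rule LIM_zero_cancel)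
  qed
  then have meas [measurable]: "\<phi> \<in> borel_measurable borel" by (rule borel_measurable_continuous_onI)
  have "K \<ge> 0"
    using lip[of "axis undefined 1" 0] by (smt (verit) axis_eq_0_iff mult_neg_pos zero_less_norm_iff diff_zero zero_neq_one abs_ge_zero)
  have int: "integrable lborel \<phi>"
  proof (rule bounded_support_integrable[OF meas _ supp])
    show "\<bar>\<phi> x\<bar> \<le> \<bar>\<phi> 0\<bar> + K * \<bar>B\<bar>" for x
      using lip[of x 0] supp[of x] mult_left_mono[of "norm x" "\<bar>B\<bar>" K] \<open>K \<ge> 0\<close>
      by (cases "norm x > B") (auto, smt (verit) mult_nonneg_nonneg abs_ge_zero)
  qed
  \<comment> \<open>\<open>L\<close> times the error of the central sample against the mean over two
    reflected points. The Lipschitz bound keeps it bounded, and the bound on second differences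
    makes it of order \<open>1 / L\<close> at almost every point.\<close>
  define d where "d L m x = real L * ((\<phi> x + \<phi> ((2 / real L) *\<^sub>R m - x)) / 2 - \<phi> ((1 / real L) *\<^sub>R m))" for L m x
  have mid: "\<bar>(p + q) / 2 - c\<bar> \<le> r" if "\<bar>p - c\<bar> \<le> r" "\<bar>q - c\<bar> \<le> r" for p q c r :: real
    using that by (auto simp: abs_le_iff field_simps)
  have twice: "(2 / real L) *\<^sub>R m = (1 / real L) *\<^sub>R m + (1 / real L) *\<^sub>R m" for L and m :: "real^'n"
    by (simp flip: scaleR_left_distrib)
  have "(\<lambda>L. \<Sum>m\<in>lattice_ball B L. \<integral>x. indicator (cell L m) x * d L m x \<partial>lborel) \<longlonglongrightarrow> 0"
  proof (rule cell_sum_limit[where B = "B + real CARD('n)" and K = "K * real CARD('n)"])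
    show "\<bar>d L m x\<bar> \<le> K * real CARD('n)" if L: "L > 0" "x \<in> cell L m" for L m x
    proof -
      let ?c = "(1 / real L) *\<^sub>R m"
      have "\<bar>\<phi> x - \<phi> ?c\<bar> \<le> K * norm (x - ?c)" by (rule lip)
      moreover have "\<bar>\<phi> ((2 / real L) *\<^sub>R m - x) - \<phi> ?c\<bar> \<le> K * norm (x - ?c)"
      proof -
        have "(2 / real L) *\<^sub>R m - x - ?c = ?c - x" unfolding twice by (simp only: algebra_simps add_diff_cancel)
        then have "norm ((2 / real L) *\<^sub>R m - x - ?c) = norm (x - ?c)" by (simp only: norm_minus_commute)
        then show ?thesis using lip[of "(2 / real L) *\<^sub>R m - x" ?c] by (simp only:)
      qed
      ultimately have "\<bar>(\<phi> x + \<phi> ((2 / real L) *\<^sub>R m - x)) / 2 - \<phi> ?c\<bar> \<le> K * norm (x - ?c)"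
        by (rule mid)
      also have "\<dots> \<le> K * (real CARD('n) / real L)"
        using cell_dist[OF L] \<open>K \<ge> 0\<close> by (intro mult_left_mono)
      finally have "real L * \<bar>(\<phi> x + \<phi> ((2 / real L) *\<^sub>R m - x)) / 2 - \<phi> ?c\<bar> \<le> real L * (K * (real CARD('n) / real L))"
        by (intro mult_left_mono) auto
      then show ?thesis using L(1) by (simp add: d_def abs_mult)
    qed
    show "AE x in lborel. \<forall>e>0. \<forall>\<^sub>F L in sequentially. \<forall>m\<in>lattice_ball B L. x \<in> cell L m \<longrightarrow> \<bar>d L m x\<bar> \<le> e"
      using second
    proof (eventually_elim, intro allI impI)
      fix x :: "real^'n" and e
      assume "\<exists>\<delta>>0. \<exists>M. \<forall>c y. c + y \<in> ball x \<delta> \<longrightarrow> c - y \<in> ball x \<delta> \<longrightarrow>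
        \<bar>\<phi> (c + y) + \<phi> (c - y) - 2 * \<phi> c\<bar> \<le> M * (norm y)\<^sup>2" and e: "e > (0::real)"
      then obtain \<delta> M where \<delta>: "\<delta> > 0" "\<And>c y. c + y \<in> ball x \<delta> \<Longrightarrow> c - y \<in> ball x \<delta> \<Longrightarrow>
        \<bar>\<phi> (c + y) + \<phi> (c - y) - 2 * \<phi> c\<bar> \<le> M * (norm y)\<^sup>2" by blast
      have "\<forall>\<^sub>F L in sequentially. 2 * (real CARD('n) / real L) < \<delta>"
        using \<delta>(1) by real_asymp
      moreover have "\<forall>\<^sub>F L in sequentially. \<bar>M\<bar> * (real CARD('n))\<^sup>2 / real L < e"
        using e by real_asymp
      ultimately show "\<forall>\<^sub>F L in sequentially. \<forall>m\<in>lattice_ball B L. x \<in> cell L m \<longrightarrow> \<bar>d L m x\<bar> \<le> e"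
        using eventually_gt_at_top[of 0]
      proof (eventually_elim, intro ballI impI)
        fix L m assume L: "2 * (real CARD('n) / real L) < \<delta>" "\<bar>M\<bar> * (real CARD('n))\<^sup>2 / real L < e" "0 < L" "x \<in> cell L m"
        define c y where "c = (1 / real L) *\<^sub>R m" and "y = x - c"
        have y: "norm y \<le> real CARD('n) / real L"
          unfolding y_def c_def by (rule cell_dist[OF L(3,4)])
        have cy: "c + y = x" "c - y = (2 / real L) *\<^sub>R m - x"
          unfolding y_def c_def twice by (simp_all add: algebra_simps)
        have "x - (c - y) = 2 *\<^sub>R y" unfolding scaleR_2 y_def by (simp only: algebra_simps)
        then have "dist x (c - y) = 2 * norm y" unfolding dist_norm by simp
        then have "c - y \<in> ball x \<delta>" using y L(1) by simp
        moreover have "c + y \<in> ball x \<delta>" using \<delta>(1) by (simp add: cy)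
        ultimately have "\<bar>\<phi> x + \<phi> ((2 / real L) *\<^sub>R m - x) - 2 * \<phi> c\<bar> \<le> M * (norm y)\<^sup>2"
          using \<delta>(2)[of c y] unfolding cy by blast
        also have "\<dots> \<le> \<bar>M\<bar> * (real CARD('n) / real L)\<^sup>2"
          using y by (intro mult_mono power_mono) auto
        finally have "real L * \<bar>\<phi> x + \<phi> ((2 / real L) *\<^sub>R m - x) - 2 * \<phi> c\<bar> \<le> real L * (\<bar>M\<bar> * (real CARD('n) / real L)\<^sup>2)"
          by (intro mult_left_mono) auto
        also have "\<dots> = \<bar>M\<bar> * (real CARD('n))\<^sup>2 / real L"
          using L(3) by (simp add: power2_eq_square field_simps)
        finally have "real L * \<bar>\<phi> x + \<phi> ((2 / real L) *\<^sub>R m - x) - 2 * \<phi> c\<bar> \<le> e" using L(2) by simp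
        moreover have "2 * \<bar>d L m x\<bar> = real L * \<bar>\<phi> x + \<phi> ((2 / real L) *\<^sub>R m - x) - 2 * \<phi> c\<bar>"
        proof -
          have "2 * d L m x = real L * (\<phi> x + \<phi> ((2 / real L) *\<^sub>R m - x) - 2 * \<phi> c)"
            by (simp add: d_def c_def algebra_simps)
          then have "\<bar>2 * d L m x\<bar> = \<bar>real L * (\<phi> x + \<phi> ((2 / real L) *\<^sub>R m - x) - 2 * \<phi> c)\<bar>" by simp
          then show ?thesis by (simp add: abs_mult)
        qed
        ultimately show "\<bar>d L m x\<bar> \<le> e" using e by linarith
      qed
    qed
    show "d L m \<in> borel_measurable borel" for L m unfolding d_def by measurable
  qed (use lattice_ball(1,3) lattice_ball(2)[THEN subsetD] in auto)
  moreover have "(\<Sum>m\<in>lattice_ball B L. \<integral>x. indicator (cell L m) x * d L m x \<partial>lborel)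
     = - (real L * (riemann_sum B \<phi> L - (\<integral>x. \<phi> x \<partial>lborel)))" if L: "L > 0" for L
  proof -
    \<comment> \<open>A cell is symmetric up to a null set, so the reflected function has the same
      integral over it.\<close>
    have refl_int: "integrable lborel (\<lambda>x. indicator (cell L m) x * \<phi> ((2 / real L) *\<^sub>R m - x))"
      "(\<integral>x. indicator (cell L m) x * \<phi> ((2 / real L) *\<^sub>R m - x) \<partial>lborel) = (\<integral>x. indicator (cell L m) x * \<phi> x \<partial>lborel)" for m
    proof -
      define \<psi> where "\<psi> x = indicator (cell L m) x * \<phi> x" for x
      have "(\<integral>x. \<psi> x \<partial>lborel) = (\<integral>x. \<psi> ((2 / real L) *\<^sub>R m - x) \<partial>lborel)"
        by (rule lborel_integral_reflect[symmetric]) (simp add: \<psi>_def)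
      also have "\<dots> = (\<integral>x. indicator (cell L m) x * \<phi> ((2 / real L) *\<^sub>R m - x) \<partial>lborel)"
        using cell_reflect_AE[OF L, of m]
        by (intro integral_cong_AE) (auto simp: \<psi>_def indicator_def elim!: eventually_mono)
      finally show "(\<integral>x. indicator (cell L m) x * \<phi> ((2 / real L) *\<^sub>R m - x) \<partial>lborel) = (\<integral>x. indicator (cell L m) x * \<phi> x \<partial>lborel)"
        by (simp add: \<psi>_def)
      obtain K' where K': "\<And>x. \<bar>\<phi> x\<bar> \<le> K'"
      proof
        show "\<bar>\<phi> x\<bar> \<le> \<bar>\<phi> 0\<bar> + K * \<bar>B\<bar>" for x
          using lip[of x 0] supp[of x] mult_left_mono[of "norm x" "\<bar>B\<bar>" K] \<open>K \<ge> 0\<close>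
          by (cases "norm x > B") (auto, smt (verit) mult_nonneg_nonneg abs_ge_zero)
      qed
      show "integrable lborel (\<lambda>x. indicator (cell L m) x * \<phi> ((2 / real L) *\<^sub>R m - x))"
      proof (rule Bochner_Integration.integrable_bound[OF integral_cell_const(1)[OF L, of m K']])
        have "norm (indicator (cell L m) x * \<phi> ((2 / real L) *\<^sub>R m - x)) \<le> norm (indicator (cell L m) x * K')" for x
          using K'[of "(2 / real L) *\<^sub>R m - x"] by (auto simp: indicator_def)
        then show "AE x in lborel. norm (indicator (cell L m) x * \<phi> ((2 / real L) *\<^sub>R m - x)) \<le> norm (indicator (cell L m) x * K')"
          by simp
      qed simp
    qed
    have "(\<integral>x. indicator (cell L m) x * d L m x \<partial>lborel)
      = real L * ((\<integral>x. indicator (cell L m) x * \<phi> x \<partial>lborel) - \<phi> ((1 / real L) *\<^sub>R m) / real L ^ CARD('n))" for m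
    proof -
      have "(\<integral>x. indicator (cell L m) x * d L m x \<partial>lborel)
        = (\<integral>x. (real L / 2) * (indicator (cell L m) x * \<phi> x + indicator (cell L m) x * \<phi> ((2 / real L) *\<^sub>R m - x))
            - indicator (cell L m) x * (real L * \<phi> ((1 / real L) *\<^sub>R m)) \<partial>lborel)"
        by (intro Bochner_Integration.integral_cong) (auto simp: d_def field_simps)
      also have "\<dots> = (real L / 2) * ((\<integral>x. indicator (cell L m) x * \<phi> x \<partial>lborel) + (\<integral>x. indicator (cell L m) x * \<phi> x \<partial>lborel))
          - real L * \<phi> ((1 / real L) *\<^sub>R m) / real L ^ CARD('n)"
        by (subst Bochner_Integration.integral_diff[OF
              integrable_mult_right[OF Bochner_Integration.integrable_add[OF integrable_cell[OF L int] refl_int(1)]]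
              integral_cell_const(1)[OF L]],
            subst Bochner_Integration.integral_mult_right_zero,
            subst Bochner_Integration.integral_add[OF integrable_cell[OF L int] refl_int(1)])
           (simp only: refl_int(2) integral_cell_const(2)[OF L])
      finally show ?thesis by (simp add: algebra_simps)
    qed
    then have "(\<Sum>m\<in>lattice_ball B L. \<integral>x. indicator (cell L m) x * d L m x \<partial>lborel)
      = real L * ((\<integral>x. \<phi> x \<partial>lborel) - riemann_sum B \<phi> L)"
      by (simp add: sum_subtractf integral_cells[OF L int supp] riemann_sum_def sum_divide_distrib flip: sum_distrib_left)
    then show ?thesis by (simp add: algebra_simps)
  qed
  ultimately have "(\<lambda>L. - (real L * (riemann_sum B \<phi> L - (\<integral>x. \<phi> x \<partial>lborel)))) \<longlonglongrightarrow> 0"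
    by (rule Lim_transform_eventually[OF _ eventually_mono[OF eventually_gt_at_top[of 0]]]) auto
  from tendsto_minus[OF this] show ?thesis by simp
qed

section \<open>Reflexive polytopes\<close>

text \<open>When the convex hull of \<open>V\<close> is the dual polytope, this is the Minkowski
  gauge of \<Delta>.\<close>

definition gauge_of :: "(real^'n) set \<Rightarrow> real^'n \<Rightarrow> real" where
  "gauge_of V x = Max ((\<lambda>u. - (u \<bullet> x)) ` V)"

lemma gauge_le_iff: "finite V \<Longrightarrow> V \<noteq> {} \<Longrightarrow> gauge_of V x \<le> c \<longleftrightarrow> (\<forall>u\<in>V. - (u \<bullet> x) \<le> c)"
  by (simp add: gauge_of_def)

lemma gauge_ge: "finite V \<Longrightarrow> u \<in> V \<Longrightarrow> - (u \<bullet> x) \<le> gauge_of V x"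
  by (simp add: gauge_of_def)

lemma gauge_attained:
  assumes "finite V" "V \<noteq> {}"
  obtains u where "u \<in> V" "gauge_of V x = - (u \<bullet> x)"
proof -
  have "gauge_of V x \<in> (\<lambda>u. - (u \<bullet> x)) ` V"
    unfolding gauge_of_def using assms by (intro Max_in) auto
  then show ?thesis using that by blast
qed

lemma gauge_scale:
  assumes "finite V" "V \<noteq> {}" "c > 0"
  shows "gauge_of V (c *\<^sub>R x) = c * gauge_of V x"
proof -
  have le: "gauge_of V (c *\<^sub>R x) \<le> c * gauge_of V x" if "c > 0" for c x
    unfolding gauge_le_iff[OF assms(1,2)]
    using gauge_ge[OF assms(1)] mult_left_mono[of _ _ c] that by fastforce
  have "gauge_of V ((1 / c) *\<^sub>R (c *\<^sub>R x)) \<le> 1 / c * gauge_of V (c *\<^sub>R x)"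
    by (rule le) (use assms in simp)
  then have "c * gauge_of V x \<le> gauge_of V (c *\<^sub>R x)" using assms(3) by (simp add: field_simps)
  with le[OF assms(3), of x] show ?thesis by simp
qed

lemma gauge_lipschitz:
  assumes "finite V" "V \<noteq> {}"
  shows "\<bar>gauge_of V x - gauge_of V y\<bar> \<le> (\<Sum>u\<in>V. norm u) * norm (x - y)"
proof -
  have le: "gauge_of V x \<le> gauge_of V y + (\<Sum>u\<in>V. norm u) * norm (x - y)" for x y
    unfolding gauge_le_iff[OF assms]
  proof
    fix u assume u: "u \<in> V"
    have "- (u \<bullet> x) = - (u \<bullet> y) + u \<bullet> (y - x)" by (simp add: inner_diff_right)
    also have "u \<bullet> (y - x) \<le> norm u * norm (x - y)"
      using norm_cauchy_schwarz[of u "y - x"] by (simp add: norm_minus_commute)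
    also have "norm u \<le> (\<Sum>u\<in>V. norm u)" using u assms by (intro member_le_sum) auto
    also have "- (u \<bullet> y) \<le> gauge_of V y" by (rule gauge_ge[OF assms(1) u])
    finally show "- (u \<bullet> x) \<le> gauge_of V y + (\<Sum>u\<in>V. norm u) * norm (x - y)"
      by (simp add: mult_right_mono)
  qed
  show ?thesis using le[of x y] le[of y x] by (simp add: abs_le_iff norm_minus_commute)
qed

text \<open>Off the hyperplanes on which two members of \<open>V\<close> agree, the maximum is
  attained by one \<open>u\<close> only, and this persists nearby. The set where the gauge is 1 lies
  in the hyperplanes \<open>u \<bullet> x = - 1\<close> with \<open>u\<close> nonzero.\<close>

lemma gauge_locally_linear:
  fixes V :: "(real^'n) set"
  assumes "finite V" "V \<noteq> {}"
  shows "AE x in lborel. gauge_of V x \<noteq> 1 \<and> (\<exists>u\<in>V. \<exists>\<delta>>0. \<forall>y\<in>ball x \<delta>. gauge_of V y = - (u \<bullet> y))"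
proof -
  define H where "H u v = {x. (u - v) \<bullet> x = (0::real)}" for u v :: "real^'n"
  define N where "N = (\<Union>u\<in>V. \<Union>v\<in>V - {u}. H u v)"
  define N' where "N' = (\<Union>u\<in>V - {0}. {x. u \<bullet> x = -1})"
  have "negligible N" "closed N"
    unfolding N_def H_def using assms(1)
    by (auto intro!: negligible_Union negligible_hyperplane closed_UN closed_hyperplane)
  moreover have "negligible N'" "closed N'"
    unfolding N'_def using assms(1)
    by (auto intro!: negligible_Union negligible_hyperplane closed_UN closed_hyperplane)
  ultimately have "AE x in lborel. x \<notin> N \<union> N'"
    by (intro AE_lborel_not_in negligible_Un) (auto intro: borel_closed)
  then show ?thesis
  proof (eventually_elim)
    case (elim x)
    obtain u where u: "u \<in> V" "gauge_of V x = - (u \<bullet> x)" using gauge_attained[OF assms] by blast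
    have ne: "gauge_of V x \<noteq> 1"
      using elim u by (cases "u = 0") (auto simp: N'_def)
    have lt: "- (v \<bullet> x) < - (u \<bullet> x)" if "v \<in> V - {u}" for v
    proof -
      have "x \<notin> H u v" using elim u that by (auto simp: N_def)
      then have "u \<bullet> x \<noteq> v \<bullet> x" by (simp add: H_def inner_diff_left)
      then show ?thesis using gauge_ge[OF assms(1), of v x] that u by auto
    qed
    define W where "W = (\<Inter>v\<in>V - {u}. {y. u \<bullet> y < v \<bullet> y})"
    have "open W" unfolding W_def using assms(1)
      by (intro open_INT finite_Diff ballI open_Collect_less continuous_intros)
    moreover have "x \<in> W" using lt by (auto simp: W_def)
    ultimately obtain \<delta> where \<delta>: "\<delta> > 0" "ball x \<delta> \<subseteq> W" using open_contains_ball by blast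
    have "gauge_of V y = - (u \<bullet> y)" if "y \<in> ball x \<delta>" for y
    proof (rule antisym)
      show "gauge_of V y \<le> - (u \<bullet> y)"
        unfolding gauge_le_iff[OF assms] using that \<delta>(2) by (auto simp: W_def dest!: subsetD) (metis DiffI less_imp_le order_refl singletonD)
      show "- (u \<bullet> y) \<le> gauge_of V y" by (rule gauge_ge[OF assms(1) u(1)])
    qed
    then show ?case using ne u(1) \<delta>(1) by blast
  qed
qed

locale reflexive_gauge =
  fixes \<Delta> V :: "(real^'n) set" and B :: real
  assumes V: "finite V" "V \<noteq> {}" "V \<subseteq> lattice_points"
    and \<Delta>: "\<Delta> = {x. gauge_of V x \<le> 1}"
    and B: "\<And>x. x \<in> \<Delta> \<Longrightarrow> norm x \<le> B"
    and nonneg: "\<And>x. gauge_of V x \<ge> 0"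
begin

abbreviation "g \<equiv> gauge_of V"

text \<open>A lattice point \<open>m\<close> of the L-fold dilate of \<Delta> belongs to exactly
  \<open>L - g m\<close> of the levels below \<open>L\<close>; divided by \<open>L\<close> this
  number is \<open>tent (m / L)\<close>.\<close>

definition tent :: "real^'n \<Rightarrow> real" where "tent x = max 0 (1 - g x)"

text \<open>The factor \<open>1 + g x\<close> comes from the sum of \<open>j + 1/2\<close> over \<open>l \<le> j < L\<close>, which is
  \<open>(L - l) (L + l) / 2\<close>.\<close>

definition weighted_tent :: "real^'n \<Rightarrow> real \<Rightarrow> real^'n \<Rightarrow> real" where
  "weighted_tent w \<beta> x = (w \<bullet> x - \<beta> / 2 * (1 + g x)) * tent x"

lemma outside: "x \<notin> \<Delta> \<Longrightarrow> tent x = 0" by (simp add: tent_def \<Delta>)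

lemma outside_ball: "norm x > B \<Longrightarrow> tent x = 0" using B outside by (meson not_le)

lemma tent_lipschitz: "\<bar>tent x - tent y\<bar> \<le> (\<Sum>u\<in>V. norm u) * norm (x - y)"
  using gauge_lipschitz[OF V(1,2), of x y] unfolding tent_def by (auto simp: max_def abs_if split: if_splits)

lemma tent_bounds: "0 \<le> tent x" "tent x \<le> 1" using nonneg[of x] by (auto simp: tent_def)

lemma gauge_continuous: "continuous_on S g"
proof -
  have "(\<Sum>u\<in>V. norm u)-lipschitz_on S g"
    by (rule lipschitz_onI) (use gauge_lipschitz[OF V(1,2)] in \<open>auto simp: dist_norm sum_nonneg\<close>)
  then show ?thesis by (rule lipschitz_on_continuous_on)
qed

lemma tent_continuous: "continuous_on S tent"
  unfolding tent_def[abs_def] by (intro continuous_intros gauge_continuous)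

lemma weighted_tent_lipschitz:
  "\<exists>K. \<forall>x y. \<bar>weighted_tent w \<beta> x - weighted_tent w \<beta> y\<bar> \<le> K * norm (x - y)"
proof -
  define G where "G = (\<Sum>u\<in>V. norm u)"
  define \<psi> where "\<psi> x = w \<bullet> x - \<beta> / 2 * (1 + g x)" for x
  define K where "K = (norm w * \<bar>B\<bar> + \<bar>\<beta>\<bar>) * G + (norm w + \<bar>\<beta>\<bar> * G)"
  have G: "G \<ge> 0" by (simp add: G_def sum_nonneg)
  then have K: "K \<ge> 0" by (simp add: K_def)
  have psi_lip: "\<bar>\<psi> x - \<psi> y\<bar> \<le> (norm w + \<bar>\<beta>\<bar> * G) * norm (x - y)" for x y
  proof -
    have "\<psi> x - \<psi> y = w \<bullet> (x - y) - \<beta> / 2 * (g x - g y)" by (simp add: \<psi>_def inner_diff_right algebra_simps add_divide_distrib)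
    then have "\<bar>\<psi> x - \<psi> y\<bar> \<le> \<bar>w \<bullet> (x - y)\<bar> + \<bar>\<beta> / 2 * (g x - g y)\<bar>" by linarith
    also have "\<bar>w \<bullet> (x - y)\<bar> \<le> norm w * norm (x - y)" by (rule Cauchy_Schwarz_ineq2)
    also have "\<bar>\<beta> / 2 * (g x - g y)\<bar> \<le> \<bar>\<beta>\<bar> * (G * norm (x - y))"
      unfolding abs_mult G_def by (intro mult_mono gauge_lipschitz[OF V(1,2)]) auto
    finally show ?thesis by (simp add: algebra_simps)
  qed
  have psi_bound: "\<bar>\<psi> x\<bar> \<le> norm w * \<bar>B\<bar> + \<bar>\<beta>\<bar>" if "x \<in> \<Delta>" for x
  proof -
    have "\<bar>\<psi> x\<bar> \<le> \<bar>w \<bullet> x\<bar> + \<bar>\<beta> / 2 * (1 + g x)\<bar>" unfolding \<psi>_def by linarith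
    also have "\<bar>w \<bullet> x\<bar> \<le> norm w * norm x" by (rule Cauchy_Schwarz_ineq2)
    also have "norm w * norm x \<le> norm w * \<bar>B\<bar>" using B[OF that] by (intro mult_left_mono) auto
    also have "\<bar>\<beta> / 2 * (1 + g x)\<bar> \<le> \<bar>\<beta>\<bar> / 2 * 2"
      unfolding abs_mult using that nonneg[of x] by (intro mult_mono) (auto simp: \<Delta>)
    finally show ?thesis by simp
  qed
  \<comment> \<open>The factor \<open>\<psi>\<close> is unbounded on the whole space, so the product
    is split in such a way that \<open>\<psi>\<close> itself is taken only at the point
    \<open>x\<close> of \<Delta>.\<close>
  have main: "\<bar>weighted_tent w \<beta> x - weighted_tent w \<beta> y\<bar> \<le> K * norm (x - y)" if "x \<in> \<Delta>" for x y
  proof -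
    have "weighted_tent w \<beta> x - weighted_tent w \<beta> y = \<psi> x * (tent x - tent y) + (\<psi> x - \<psi> y) * tent y"
      unfolding weighted_tent_def \<psi>_def[symmetric] by (simp add: algebra_simps)
    then have "\<bar>weighted_tent w \<beta> x - weighted_tent w \<beta> y\<bar> \<le> \<bar>\<psi> x\<bar> * \<bar>tent x - tent y\<bar> + \<bar>\<psi> x - \<psi> y\<bar> * \<bar>tent y\<bar>"
      by (metis abs_mult abs_triangle_ineq)
    also have "\<bar>\<psi> x\<bar> * \<bar>tent x - tent y\<bar> \<le> (norm w * \<bar>B\<bar> + \<bar>\<beta>\<bar>) * (G * norm (x - y))"
      using psi_bound[OF that] tent_lipschitz[of x y] by (intro mult_mono) (auto simp: G_def)
    also have "\<bar>\<psi> x - \<psi> y\<bar> * \<bar>tent y\<bar> \<le> ((norm w + \<bar>\<beta>\<bar> * G) * norm (x - y)) * 1"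
      using psi_lip[of x y] tent_bounds[of y] G by (intro mult_mono) auto
    finally show ?thesis by (simp add: K_def algebra_simps)
  qed
  have "\<bar>weighted_tent w \<beta> x - weighted_tent w \<beta> y\<bar> \<le> K * norm (x - y)" for x y
  proof (cases "x \<in> \<Delta>")
    case False
    show ?thesis
    proof (cases "y \<in> \<Delta>")
      case True
      then show ?thesis using main[of y x] by (simp add: abs_minus_commute norm_minus_commute)
    next
      case F: False
      then show ?thesis using outside[OF False] outside[OF F] K by (simp add: weighted_tent_def)
    qed
  qed (rule main)
  then show ?thesis by blast
qed

text \<open>Near almost every point the gauge is linear and different from 1. The function is then
  locally 0 or a quadratic polynomial, whose second difference is a quadratic form in
  \<open>y\<close>.\<close>

lemma weighted_tent_second_difference:
  "AE x in lborel. \<exists>\<delta>>0. \<exists>M. \<forall>c y. c + y \<in> ball x \<delta> \<longrightarrow> c - y \<in> ball x \<delta> \<longrightarrow>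
     \<bar>weighted_tent w \<beta> (c + y) + weighted_tent w \<beta> (c - y) - 2 * weighted_tent w \<beta> c\<bar> \<le> M * (norm y)\<^sup>2"
  using gauge_locally_linear[OF V(1,2)]
proof eventually_elim
  case (elim x)
  then obtain u \<delta> where g1: "g x \<noteq> 1" and u: "\<delta> > 0" "\<And>y. y \<in> ball x \<delta> \<Longrightarrow> g y = - (u \<bullet> y)" by blast
  have mid: "c \<in> ball x \<epsilon>" if "c + y \<in> ball x \<epsilon>" "c - y \<in> ball x \<epsilon>" for c y \<epsilon>
  proof -
    have "(1/2) *\<^sub>R (c + y) + (1/2) *\<^sub>R (c - y) \<in> ball x \<epsilon>"
      using convexD[OF convex_ball that, of "1/2" "1/2"] by simp
    moreover have "(1/2) *\<^sub>R (c + y) + (1/2) *\<^sub>R (c - y) = c"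
      by (simp add: scaleR_right_distrib scaleR_right_diff_distrib flip: scaleR_left_distrib)
    ultimately show ?thesis by simp
  qed
  show ?case
  proof (cases "g x > 1")
    case True
    have "open {y. g y > 1}" by (intro open_Collect_less continuous_intros gauge_continuous)
    then obtain \<epsilon> where e: "\<epsilon> > 0" "ball x \<epsilon> \<subseteq> {y. g y > 1}" using True open_contains_ball by blast
    have z: "weighted_tent w \<beta> y = 0" if "y \<in> ball x \<epsilon>" for y
      using e(2) that by (auto simp: weighted_tent_def tent_def)
    show ?thesis
      by (intro exI[of _ \<epsilon>] conjI exI[of _ 0] allI impI e(1)) (use z mid in auto)
  next
    case False
    then have "g x < 1" using g1 by simp
    have "open {y. g y < 1}" by (intro open_Collect_less continuous_intros gauge_continuous)
    then obtain \<epsilon>1 where e1: "\<epsilon>1 > 0" "ball x \<epsilon>1 \<subseteq> {y. g y < 1}" using \<open>g x < 1\<close> open_contains_ball by blast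
    define \<epsilon> where "\<epsilon> = min \<delta> \<epsilon>1"
    have e: "\<epsilon> > 0" "\<epsilon> \<le> \<delta>" "\<epsilon> \<le> \<epsilon>1" using u(1) e1(1) by (auto simp: \<epsilon>_def)
    have z: "weighted_tent w \<beta> y = (w \<bullet> y - \<beta> / 2 * (1 - u \<bullet> y)) * (1 + u \<bullet> y)" if "y \<in> ball x \<epsilon>" for y
    proof -
      have "g y = - (u \<bullet> y)" using u(2)[of y] e that by simp
      moreover have "y \<in> ball x \<epsilon>1" using e that by simp
      then have "g y < 1" using e1(2) by blast
      ultimately have "g y = - (u \<bullet> y)" "g y < 1" by blast+
      then show ?thesis by (simp add: weighted_tent_def tent_def)
    qed
    define M where "M = 2 * ((norm w + \<bar>\<beta> / 2\<bar> * norm u) * norm u)"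
    have "\<bar>weighted_tent w \<beta> (c + y) + weighted_tent w \<beta> (c - y) - 2 * weighted_tent w \<beta> c\<bar> \<le> M * (norm y)\<^sup>2"
      if cy: "c + y \<in> ball x \<epsilon>" "c - y \<in> ball x \<epsilon>" for c y
    proof -
      have "weighted_tent w \<beta> (c + y) + weighted_tent w \<beta> (c - y) - 2 * weighted_tent w \<beta> c
          = 2 * ((w \<bullet> y + \<beta> / 2 * (u \<bullet> y)) * (u \<bullet> y))"
        unfolding z[OF cy(1)] z[OF cy(2)] z[OF mid[OF cy]] inner_add_right inner_diff_right
        by (simp add: field_simps)
      moreover have "\<bar>(w \<bullet> y + \<beta> / 2 * (u \<bullet> y)) * (u \<bullet> y)\<bar> \<le> ((norm w + \<bar>\<beta> / 2\<bar> * norm u) * norm y) * (norm u * norm y)"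
      proof -
        have wy: "\<bar>w \<bullet> y\<bar> \<le> norm w * norm y" "\<bar>u \<bullet> y\<bar> \<le> norm u * norm y" by (rule Cauchy_Schwarz_ineq2)+
        have "\<bar>w \<bullet> y + \<beta> / 2 * (u \<bullet> y)\<bar> \<le> \<bar>w \<bullet> y\<bar> + \<bar>\<beta> / 2 * (u \<bullet> y)\<bar>" by (rule abs_triangle_ineq)
        also have "\<dots> \<le> norm w * norm y + \<bar>\<beta> / 2\<bar> * (norm u * norm y)"
          unfolding abs_mult using wy by (intro add_mono mult_left_mono) auto
        finally have "\<bar>w \<bullet> y + \<beta> / 2 * (u \<bullet> y)\<bar> \<le> (norm w + \<bar>\<beta> / 2\<bar> * norm u) * norm y"
          by (simp add: algebra_simps)
        then show ?thesis unfolding abs_mult using wy(2) by (intro mult_mono) auto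
      qed
      ultimately show ?thesis by (simp add: M_def power2_eq_square algebra_simps)
    qed
    then show ?thesis using e(1) by blast
  qed
qed

section \<open>Lattice sums over all levels below L\<close>

lemma gauge_divide: "j > 0 \<Longrightarrow> g ((1 / real j) *\<^sub>R m) = g m / real j"
  using gauge_scale[OF V(1,2), of "1 / real j" m] by simp

lemma divide_mem_iff: "j > 0 \<Longrightarrow> (1 / real j) *\<^sub>R m \<in> \<Delta> \<longleftrightarrow> g m \<le> real j"
  unfolding \<Delta> mem_Collect_eq gauge_divide by (simp add: divide_le_eq)

lemma section_chars_gauge:
  assumes "j > 0"
  shows "section_chars \<Delta> j = {m \<in> lattice_points. g m \<le> real j}"
proof -
  have "m \<in> (*\<^sub>R) (real j) ` \<Delta> \<longleftrightarrow> g m \<le> real j" for m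
  proof
    assume "m \<in> (*\<^sub>R) (real j) ` \<Delta>"
    then obtain x where "g x \<le> 1" "m = real j *\<^sub>R x" by (auto simp: \<Delta>)
    then show "g m \<le> real j" using assms gauge_scale[OF V(1,2), of "real j" x] by (simp add: mult_left_le)
  next
    assume "g m \<le> real j"
    then have "(1 / real j) *\<^sub>R m \<in> \<Delta>"
      using divide_mem_iff[OF assms] by blast
    moreover have "m = real j *\<^sub>R ((1 / real j) *\<^sub>R m)" using assms by simp
    ultimately show "m \<in> (*\<^sub>R) (real j) ` \<Delta>" by blast
  qed
  then show ?thesis unfolding section_chars_def by auto
qed

text \<open>The members of \<open>V\<close> are lattice points and pair integrally with
  \<open>m\<close>. This is the integrality that reflexivity provides.\<close>

lemma gauge_lattice:
  assumes "m \<in> lattice_points"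
  shows "g m = real (nat \<lfloor>g m\<rfloor>)"
proof -
  obtain u where u: "u \<in> V" "g m = - (u \<bullet> m)" using gauge_attained[OF V(1,2)] by blast
  have "u \<bullet> m \<in> \<int>"
    using u(1) V(3) assms unfolding lattice_points_def inner_vec_def
    by (auto intro!: Ints_sum Ints_mult)
  then have "g m \<in> \<int>" using u by simp
  then show ?thesis using nonneg[of m] by (auto elim!: Ints_cases)
qed

definition level :: "nat \<Rightarrow> (real^'n) set" where "level j = {m \<in> lattice_points. g m \<le> real j}"

lemma level_subset:
  assumes "j \<le> L" "L > 0"
  shows "level j \<subseteq> lattice_ball B L"
proof
  fix m assume m: "m \<in> level j"
  then have "g m \<le> real L" using assms by (simp add: level_def)
  then have "(1 / real L) *\<^sub>R m \<in> \<Delta>"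
    using divide_mem_iff[OF assms(2)] by blast
  from B[OF this] have "norm m \<le> real L * B" using assms by (simp add: field_simps)
  then have "norm m \<le> real L * (B + real CARD('n))" by (simp add: distrib_left add_increasing2)
  then show "m \<in> lattice_ball B L" using m by (simp add: level_def lattice_ball_def)
qed

lemma tent_sum:
  assumes "L > 0"
  shows "(\<Sum>m\<in>lattice_ball B L. f m * tent ((1 / real L) *\<^sub>R m)) = (\<Sum>m\<in>level L. f m * (1 - g m / real L))"
proof -
  have t: "tent ((1 / real L) *\<^sub>R m) = max 0 (1 - g m / real L)" for m
    unfolding tent_def gauge_divide[OF assms] ..
  have "(\<Sum>m\<in>lattice_ball B L. f m * tent ((1 / real L) *\<^sub>R m)) = (\<Sum>m\<in>level L. f m * tent ((1 / real L) *\<^sub>R m))"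
  proof (rule sum.mono_neutral_right[OF lattice_ball(1) level_subset[OF order_refl assms]], intro ballI)
    fix m assume "m \<in> lattice_ball B L - level L"
    then have "g m > real L" using lattice_ball(2)[of B L] by (auto simp: level_def)
    then have "1 - g m / real L \<le> 0" using assms by (simp add: field_simps)
    then show "f m * tent ((1 / real L) *\<^sub>R m) = 0" by (simp add: t)
  qed
  also have "\<dots> = (\<Sum>m\<in>level L. f m * (1 - g m / real L))"
  proof (intro sum.cong refl)
    fix m assume "m \<in> level L"
    then have "1 - g m / real L \<ge> 0" using assms by (simp add: level_def field_simps)
    then show "f m * tent ((1 / real L) *\<^sub>R m) = f m * (1 - g m / real L)" by (simp add: t)
  qed
  finally show ?thesis .
qed

text \<open>Exchange of summation: by integrality of the gauge, \<open>m\<close> is present from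
  level \<open>g m\<close> onwards.\<close>

lemma sum_levels:
  assumes "L > 0"
  shows "(\<Sum>j<L. \<Sum>m\<in>level j. f j m) = (\<Sum>m\<in>level L. \<Sum>j\<in>{nat \<lfloor>g m\<rfloor>..<L}. f j m)"
proof -
  have fin: "finite (level L)" using level_subset[OF order_refl assms] lattice_ball(1) finite_subset by blast
  have "(\<Sum>j<L. \<Sum>m\<in>level j. f j m) = (\<Sum>j<L. \<Sum>m\<in>level L. if nat \<lfloor>g m\<rfloor> \<le> j then f j m else 0)"
  proof (rule sum.cong[OF refl])
    fix j assume "j \<in> {..<L}"
    then have "level L \<inter> {m. nat \<lfloor>g m\<rfloor> \<le> j} = level j"
      using gauge_lattice unfolding level_def by (auto; metis of_nat_le_iff of_nat_less_iff less_imp_le order_trans)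
    then show "(\<Sum>m\<in>level j. f j m) = (\<Sum>m\<in>level L. if nat \<lfloor>g m\<rfloor> \<le> j then f j m else 0)"
      using fin by (simp add: sum.If_cases)
  qed
  also have "\<dots> = (\<Sum>m\<in>level L. \<Sum>j<L. if nat \<lfloor>g m\<rfloor> \<le> j then f j m else 0)" by (rule sum.swap)
  also have "\<dots> = (\<Sum>m\<in>level L. \<Sum>j\<in>{nat \<lfloor>g m\<rfloor>..<L}. f j m)"
  proof (rule sum.cong[OF refl])
    fix m
    have "{..<L} \<inter> {j. nat \<lfloor>g m\<rfloor> \<le> j} = {nat \<lfloor>g m\<rfloor>..<L}" by auto
    then show "(\<Sum>j<L. if nat \<lfloor>g m\<rfloor> \<le> j then f j m else 0) = (\<Sum>j\<in>{nat \<lfloor>g m\<rfloor>..<L}. f j m)"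
      by (simp add: sum.If_cases)
  qed
  finally show ?thesis .
qed

text \<open>At the midpoints \<open>j + 1/2\<close> the sum is exactly half a difference of squares,
  without a linear term.\<close>

lemma half_odd_sum: "l \<le> L \<Longrightarrow> (\<Sum>j\<in>{l..<L}. real j + 1 / 2) = ((real L)\<^sup>2 - (real l)\<^sup>2) / 2"
  by (induction L rule: dec_induct) (auto simp: power2_eq_square field_simps)

text \<open>With \<open>j\<close> written as \<open>(j + 1/2) - 1/2\<close>, the first part gives
  \<open>L ^ 2\<close> times \<open>weighted_tent\<close> at \<open>m / L\<close>. The second leaves
  a term of lower order with factor \<open>\<beta> / 2\<close>, and this term later isolates
  \<open>\<beta>\<close>.\<close>

lemma weighted_sum_levels:
  assumes "L > 0"
  shows "(\<Sum>m\<in>level L. (w \<bullet> m - \<beta> / 2 * (real L + g m)) * (real L - g m))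
     = (\<Sum>j<L. \<Sum>m\<in>level j. w \<bullet> m - \<beta> * real j) - \<beta> / 2 * (\<Sum>m\<in>level L. real L - g m)"
proof -
  have "(\<Sum>j\<in>{nat \<lfloor>g m\<rfloor>..<L}. w \<bullet> m - \<beta> * real j) = (w \<bullet> m - \<beta> / 2 * (real L + g m)) * (real L - g m) + \<beta> / 2 * (real L - g m)"
    if m: "m \<in> level L" for m
  proof -
    define l where "l = nat \<lfloor>g m\<rfloor>"
    have gl: "g m = real l" using m gauge_lattice by (simp add: level_def l_def)
    then have l: "l \<le> L" using m by (simp add: level_def)
    have "(\<Sum>j\<in>{l..<L}. w \<bullet> m - \<beta> * real j) = (\<Sum>j\<in>{l..<L}. (w \<bullet> m + \<beta> / 2) - \<beta> * (real j + 1 / 2))"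
      by (intro sum.cong) (auto simp: algebra_simps)
    also have "\<dots> = (real L - real l) * (w \<bullet> m + \<beta> / 2) - \<beta> * (\<Sum>j\<in>{l..<L}. real j + 1 / 2)"
      using l by (simp add: sum_subtractf of_nat_diff flip: sum_distrib_left)
    also have "\<dots> = (w \<bullet> m - \<beta> / 2 * (real L + real l)) * (real L - real l) + \<beta> / 2 * (real L - real l)"
      unfolding half_odd_sum[OF l] by (simp add: power2_eq_square field_simps)
    finally show ?thesis unfolding gl[symmetric] unfolding l_def .
  qed
  then show ?thesis
    unfolding sum_levels[OF assms] by (simp add: sum.distrib sum_distrib_left)
qed

text \<open>\<open>L\<close> times the Riemann sum of \<open>weighted_tent\<close> tends to
  \<open>- \<beta> / 2\<close> times the integral of \<open>tent\<close>. As the Riemann sum is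
  within \<open>o(1 / L)\<close> of its integral, that integral is 0, and so is
  \<open>\<beta>\<close>, because \<open>tent\<close> has nonzero integral. The Riemann sums of
  \<open>w \<bullet> x\<close> over \<Delta> then vanish for large \<open>L\<close>.\<close>

lemma barycenter_zero:
  assumes conv: "convex \<Delta>" and i0: "\<And>i. i \<ge> i0 \<Longrightarrow> (\<Sum>a\<in>section_chars \<Delta> i. w \<bullet> a) = \<beta> * real i * real (card (section_chars \<Delta> i))"
  shows "(\<integral>x. indicator \<Delta> x * (w \<bullet> x) \<partial>lborel) = 0"
proof -
  define n where "n = CARD('n)"
  define \<phi> where "\<phi> = weighted_tent w \<beta>"
  define i1 where "i1 = max 1 i0"
  \<comment> \<open>The contribution of the finitely many levels not covered by the hypothesis; it
    disappears after division by a power of \<open>L\<close>.\<close>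
  define C where "C = (\<Sum>j<i1. \<Sum>m\<in>level j. w \<bullet> m - \<beta> * real j)"
  have lev: "level j = section_chars \<Delta> j" if "j > 0" for j
    using section_chars_gauge[OF that] by (simp add: level_def)
  have zero: "(\<Sum>m\<in>level j. w \<bullet> m - \<beta> * real j) = 0" if "j \<ge> i1" for j
    using i0[of j] lev[of j] that by (simp add: i1_def sum_subtractf)
  have Csum: "(\<Sum>j<L. \<Sum>m\<in>level j. w \<bullet> m - \<beta> * real j) = C" if "L \<ge> i1" for L
    unfolding C_def using that zero by (intro sum.mono_neutral_right) auto
  have rs: "real L * riemann_sum B \<phi> L = C / real L ^ Suc n - \<beta> / 2 * riemann_sum B tent L" if L: "L \<ge> i1" for L
  proof -
    have L0: "L > 0" using L by (simp add: i1_def)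
    have "riemann_sum B \<phi> L = (\<Sum>m\<in>level L. (w \<bullet> ((1 / real L) *\<^sub>R m) - \<beta> / 2 * (1 + g ((1 / real L) *\<^sub>R m))) * (1 - g m / real L)) / real L ^ n"
      unfolding riemann_sum_def \<phi>_def weighted_tent_def n_def by (subst tent_sum[OF L0]) simp
    also have "(\<Sum>m\<in>level L. (w \<bullet> ((1 / real L) *\<^sub>R m) - \<beta> / 2 * (1 + g ((1 / real L) *\<^sub>R m))) * (1 - g m / real L))
       = (\<Sum>m\<in>level L. (w \<bullet> m - \<beta> / 2 * (real L + g m)) * (real L - g m) / (real L)\<^sup>2)"
    proof (intro sum.cong refl)
      fix m
      have gm: "g ((1 / real L) *\<^sub>R m) = g m / real L" by (rule gauge_divide[OF L0])
      show "(w \<bullet> ((1 / real L) *\<^sub>R m) - \<beta> / 2 * (1 + g ((1 / real L) *\<^sub>R m))) * (1 - g m / real L)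
        = (w \<bullet> m - \<beta> / 2 * (real L + g m)) * (real L - g m) / (real L)\<^sup>2"
        unfolding gm using L0 by (simp add: power2_eq_square field_simps)
    qed
    also have "\<dots> = (C - \<beta> / 2 * (\<Sum>m\<in>level L. real L - g m)) / (real L)\<^sup>2"
      unfolding sum_divide_distrib[symmetric] weighted_sum_levels[OF L0] Csum[OF L] ..
    finally have 1: "riemann_sum B \<phi> L = (C - \<beta> / 2 * (\<Sum>m\<in>level L. real L - g m)) / (real L)\<^sup>2 / real L ^ n" .
    have "riemann_sum B tent L = (\<Sum>m\<in>level L. 1 - g m / real L) / real L ^ n"
      unfolding riemann_sum_def n_def using tent_sum[OF L0, of "\<lambda>_. 1"] by simp
    also have "(\<Sum>m\<in>level L. 1 - g m / real L) = (\<Sum>m\<in>level L. (real L - g m) / real L)"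
      using L0 by (intro sum.cong) (auto simp: field_simps)
    also have "\<dots> = (\<Sum>m\<in>level L. real L - g m) / real L" by (simp add: sum_divide_distrib)
    finally have 2: "riemann_sum B tent L = (\<Sum>m\<in>level L. real L - g m) / real L / real L ^ n" .
    show ?thesis unfolding 1 2 using L0 by (simp add: power2_eq_square field_simps)
  qed
  have tent_meas: "tent \<in> borel_measurable borel"
    by (rule borel_measurable_continuous_onI[OF tent_continuous])
  have rs_tent: "riemann_sum B tent \<longlonglongrightarrow> (\<integral>x. tent x \<partial>lborel)"
  proof (rule riemann_sum_limit[OF tent_meas, where K = 1])
    show "\<bar>tent x\<bar> \<le> 1" for x using tent_bounds[of x] by simp
    show "AE x in lborel. isCont tent x"
      using tent_continuous[of UNIV] by (simp add: continuous_on_eq_continuous_at)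
  qed (rule outside_ball)
  obtain K where K: "\<And>x y. \<bar>\<phi> x - \<phi> y\<bar> \<le> K * norm (x - y)"
    using weighted_tent_lipschitz unfolding \<phi>_def by blast
  have err: "(\<lambda>L. real L * (riemann_sum B \<phi> L - (\<integral>x. \<phi> x \<partial>lborel))) \<longlonglongrightarrow> 0"
  proof (rule riemann_sum_error[OF K])
    show "\<phi> x = 0" if "norm x > B" for x using outside_ball[OF that] by (simp add: \<phi>_def weighted_tent_def)
  qed (use weighted_tent_second_difference in \<open>auto simp: \<phi>_def\<close>)
  define I where "I = (\<integral>x. \<phi> x \<partial>lborel)"
  have C0: "(\<lambda>L. C / real L ^ Suc n) \<longlonglongrightarrow> 0"
    by (rule real_tendsto_divide_at_top[OF tendsto_const]) 
       (intro filterlim_pow_at_top filterlim_real_sequentially, simp)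
  have "(\<lambda>L. (C / real L ^ Suc n - \<beta> / 2 * riemann_sum B tent L) - real L * (riemann_sum B \<phi> L - I))
      \<longlonglongrightarrow> (0 - \<beta> / 2 * (\<integral>x. tent x \<partial>lborel)) - 0"
    by (intro tendsto_diff tendsto_mult tendsto_const C0 rs_tent err[folded I_def])
  moreover have "\<forall>\<^sub>F L in sequentially. (C / real L ^ Suc n - \<beta> / 2 * riemann_sum B tent L) - real L * (riemann_sum B \<phi> L - I) = real L * I"
    using eventually_ge_at_top[of i1] 
  proof eventually_elim
    case (elim L)
    show ?case unfolding rs[OF elim, symmetric] by (simp add: algebra_simps)
  qed
  ultimately have lim: "(\<lambda>L. real L * I) \<longlonglongrightarrow> - (\<beta> / 2 * (\<integral>x. tent x \<partial>lborel))"
    by (simp add: Lim_transform_eventually)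
  have "I = 0"
  proof -
    have "(\<lambda>L. real L * I * (1 / real L)) \<longlonglongrightarrow> - (\<beta> / 2 * (\<integral>x. tent x \<partial>lborel)) * 0"
      by (intro tendsto_mult lim lim_1_over_n)
    moreover have "\<forall>\<^sub>F L in sequentially. real L * I * (1 / real L) = I"
      using eventually_gt_at_top[of 0] by eventually_elim simp
    ultimately have "(\<lambda>L. I) \<longlonglongrightarrow> - (\<beta> / 2 * (\<integral>x. tent x \<partial>lborel)) * 0"
      by (rule Lim_transform_eventually)
    then show ?thesis using LIMSEQ_const_iff by fastforce
  qed
  then have "\<beta> * (\<integral>x. tent x \<partial>lborel) = 0" using lim by (simp add: LIMSEQ_const_iff)
  moreover have "(\<integral>x. tent x \<partial>lborel) \<noteq> 0"
  proof
    assume z: "(\<integral>x. tent x \<partial>lborel) = 0"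
    have "integrable lborel tent"
      by (rule bounded_support_integrable[OF tent_meas, of 1 B]) (use tent_bounds outside_ball in auto)
    then have "AE x in lborel. tent x = 0"
      using integral_nonneg_eq_0_iff_AE[of lborel tent] tent_bounds z by simp
    then have "tent 0 = 0"
      using AE_zero_on_open[of UNIV tent 0] tent_continuous by simp
    moreover have "g 0 = 0" using gauge_attained[OF V(1,2), of 0] by (metis inner_zero_right neg_equal_0_iff_equal)
    ultimately show False by (simp add: tent_def)
  qed
  ultimately have "\<beta> = 0" by simp
  \<comment> \<open>With \<open>\<beta> = 0\<close> mere convergence suffices, so the jump at the
    frontier, a null set by convexity, does no harm.\<close>
  define \<rho> where "\<rho> x = indicator \<Delta> x * (w \<bullet> x)" for x
  have cl: "closed \<Delta>" unfolding \<Delta> by (intro closed_Collect_le continuous_intros gauge_continuous)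
  have "riemann_sum B \<rho> \<longlonglongrightarrow> (\<integral>x. \<rho> x \<partial>lborel)"
  proof (rule riemann_sum_limit[where K = "norm w * \<bar>B\<bar>"])
    show "\<rho> \<in> borel_measurable borel" unfolding \<rho>_def using cl
      by (intro borel_measurable_times borel_measurable_indicator borel_measurable_continuous_onI
          borel_closed continuous_intros)
    show "\<bar>\<rho> x\<bar> \<le> norm w * \<bar>B\<bar>" for x
    proof (cases "x \<in> \<Delta>")
      case True
      have "\<bar>w \<bullet> x\<bar> \<le> norm w * norm x" by (rule Cauchy_Schwarz_ineq2)
      also have "\<dots> \<le> norm w * \<bar>B\<bar>" using B[OF True] by (intro mult_left_mono) auto
      finally show ?thesis using True by (simp add: \<rho>_def)
    qed (simp add: \<rho>_def)
    show "\<rho> x = 0" if "norm x > B" for x using B[of x] that by (auto simp: \<rho>_def indicator_def)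
    have "AE x in lborel. x \<notin> frontier \<Delta>"
      by (intro AE_lborel_not_in negligible_convex_frontier conv) (simp add: borel_closed)
    then show "AE x in lborel. isCont \<rho> x"
    proof eventually_elim
      case (elim x)
      show ?case
      proof (cases "x \<in> \<Delta>")
        case True
        then have "x \<in> interior \<Delta>" using elim closure_subset by (auto simp: frontier_def)
        moreover have "continuous_on (interior \<Delta>) \<rho>"
        proof -
          have "continuous_on (interior \<Delta>) (\<lambda>x. w \<bullet> x)" by (intro continuous_intros)
          then show ?thesis by (rule continuous_on_eq) (use interior_subset in \<open>auto simp: \<rho>_def indicator_def\<close>)
        qed
        ultimately show ?thesis using continuous_on_eq_continuous_at[OF open_interior] by blast
      next
        case False
        moreover have "continuous_on (- \<Delta>) \<rho>"
          by (rule continuous_on_eq[OF continuous_on_const[of _ 0]]) (auto simp: \<rho>_def)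
        ultimately show ?thesis using continuous_on_eq_continuous_at[of "- \<Delta>"] cl by (auto simp: open_Compl)
      qed
    qed
  qed
  moreover have "riemann_sum B \<rho> L = 0" if L: "L \<ge> i1" for L
  proof -
    have L0: "L > 0" using L by (simp add: i1_def)
    have "(\<Sum>m\<in>lattice_ball B L. \<rho> ((1 / real L) *\<^sub>R m)) = (\<Sum>m\<in>level L. \<rho> ((1 / real L) *\<^sub>R m))"
    proof (rule sum.mono_neutral_right[OF lattice_ball(1) level_subset[OF order_refl L0]], intro ballI)
      fix m assume "m \<in> lattice_ball B L - level L"
      then have "g m > real L" using lattice_ball(2)[of B L] by (auto simp: level_def)
      then have "(1 / real L) *\<^sub>R m \<notin> \<Delta>"
        unfolding divide_mem_iff[OF L0] by simp
      then show "\<rho> ((1 / real L) *\<^sub>R m) = 0" by (simp add: \<rho>_def)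
    qed
    also have "\<dots> = (\<Sum>m\<in>level L. (w \<bullet> m) / real L)"
    proof (intro sum.cong refl)
      fix m assume "m \<in> level L"
      then have "(1 / real L) *\<^sub>R m \<in> \<Delta>"
        unfolding divide_mem_iff[OF L0] by (simp add: level_def)
      then show "\<rho> ((1 / real L) *\<^sub>R m) = (w \<bullet> m) / real L" by (simp add: \<rho>_def)
    qed
    also have "\<dots> = 0" using zero[OF L] \<open>\<beta> = 0\<close> by (simp add: sum_divide_distrib[symmetric])
    finally show ?thesis by (simp add: riemann_sum_def)
  qed
  then have "\<forall>\<^sub>F L in sequentially. riemann_sum B \<rho> L = 0"
    using eventually_ge_at_top[of i1] by (rule eventually_mono[rotated])
  ultimately have "(\<lambda>L. 0) \<longlonglongrightarrow> (\<integral>x. \<rho> x \<partial>lborel)" using Lim_transform_eventually by fastforce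
  from LIMSEQ_const_iff[THEN iffD1, OF this] show ?thesis by (simp add: \<rho>_def)
qed

end

text \<open>\<open>V\<close> is a finite set of lattice points with the dual polytope as convex
  hull. A negative value of the gauge would put the dual polytope into an open half-space that
  misses the origin.\<close>

lemma reflexive_polytope_gauge:
  assumes "reflexive_polytope \<Delta>"
  shows "\<exists>V B. reflexive_gauge \<Delta> V B"
proof -
  obtain P where P: "lattice_polytope P" "0 \<in> interior P" "\<Delta> = {y. \<forall>x\<in>P. x \<bullet> y \<ge> - 1}"
    using assms unfolding reflexive_polytope_def by blast
  obtain V where V: "finite V" "V \<subseteq> lattice_points" "P = convex hull V"
    using P(1) unfolding lattice_polytope_def by blast
  have "P \<noteq> {}" using P(2) interior_subset by blast
  then have Vne: "V \<noteq> {}" using V(3) by auto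
  have "bounded \<Delta>"
    using assms lattice_polytope_compact compact_imp_bounded unfolding reflexive_polytope_def by blast
  then obtain B where B: "\<And>x. x \<in> \<Delta> \<Longrightarrow> norm x \<le> B" unfolding bounded_iff by blast
  have "(\<forall>x\<in>P. x \<bullet> y \<ge> - 1) \<longleftrightarrow> gauge_of V y \<le> 1" for y
  proof
    assume "\<forall>x\<in>P. x \<bullet> y \<ge> - 1"
    moreover have "V \<subseteq> P" unfolding V(3) by (rule hull_subset)
    ultimately have "u \<bullet> y \<ge> - 1" if "u \<in> V" for u using that by (meson subsetD)
    then show "gauge_of V y \<le> 1" unfolding gauge_le_iff[OF V(1) Vne] by force
  next
    assume "gauge_of V y \<le> 1"
    then have "V \<subseteq> {x. y \<bullet> x \<ge> - 1}" unfolding gauge_le_iff[OF V(1) Vne] by (auto simp: inner_commute)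
    then have "P \<subseteq> {x. y \<bullet> x \<ge> - 1}" unfolding V(3) by (intro hull_minimal convex_halfspace_ge)
    then show "\<forall>x\<in>P. x \<bullet> y \<ge> - 1" by (auto simp: inner_commute)
  qed
  then have \<Delta>: "\<Delta> = {x. gauge_of V x \<le> 1}" using P(3) by simp
  have "gauge_of V x \<ge> 0" for x
  proof (rule ccontr)
    assume "\<not> gauge_of V x \<ge> 0"
    then have "u \<bullet> x > 0" if "u \<in> V" for u using gauge_ge[OF V(1) that, of x] by linarith
    then have "V \<subseteq> {u. x \<bullet> u > 0}" by (auto simp: inner_commute)
    then have "P \<subseteq> {u. x \<bullet> u > 0}" unfolding V(3) by (intro hull_minimal convex_halfspace_gt)
    moreover have "0 \<in> P" using P(2) interior_subset by blast
    ultimately show False by auto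
  qed
  then show ?thesis using V Vne \<Delta> B
    by (intro exI[of _ V] exI[of _ B]) (unfold_locales, auto)
qed

theorem theorem1p3:
  fixes \<Delta> :: "(real^'n) set"
  assumes "reflexive_polytope \<Delta>"
    and "asymp_torus_chow_semistable \<Delta>"
  shows "toric_ding_polystable \<Delta>"
proof -
  have lat: "lattice_polytope \<Delta>" "0 \<in> interior \<Delta>"
    using assms(1) unfolding reflexive_polytope_def by auto
  obtain V B where "reflexive_gauge \<Delta> V B" using reflexive_polytope_gauge[OF assms(1)] by blast
  then interpret reflexive_gauge \<Delta> V B .
  show ?thesis
  proof (rule ding_polystable_of_barycenter)
    fix w
    obtain i0 \<beta> where "\<And>i. i \<ge> i0 \<Longrightarrow>
        (\<Sum>a\<in>section_chars \<Delta> i. w \<bullet> a) = \<beta> * real i * real (card (section_chars \<Delta> i))"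
      using chow_semistable_mean[OF lat assms(2)] by blast
    then show "(\<integral>x. indicator \<Delta> x * (w \<bullet> x) \<partial>lborel) = 0"
      by (rule barycenter_zero[OF lattice_polytope_convex[OF lat(1)]])
  qed (use lat lattice_polytope_compact lattice_polytope_convex in auto)
qed

end
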